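(* Let $m\ge 0$, $p\ge 2m+1$ be integers, and let $u\in C^{p+2}(\bar\Omega)$ with $u^{(k)}(a)=u^{(k)}(b)=0$ for $k=0,\ldots,m$ be the solution of $(f,v)=a(u,v)$ for all $v\in H_0^{m+1}(\Omega)$. Let $U_{p,m,\Gamma_\Omega}\in S_0^{p,m,\Gamma_\Omega}$ be the solution of $(f,V)=a(U_{p,m,\Gamma_\Omega},V)$ for all $V\in S_0^{p,m,\Gamma_\Omega}$, and let $W_{p,m,\Gamma_\Omega}\in S_0^{p,m,\Gamma_\Omega}$ be the piecewise Hermite-Jacobi interpolant of $u$. If $$\Vert u-W_{p,m,\Gamma_\Omega}\Vert_{m+1}\ge C(p,m)\,H^{p-m}$$ with a constant $C(p,m)>0$, then $$\frac{\Vert u-U_{p,m,\Gamma_\Omega}\Vert_{m+1}}{\Vert u-W_{p,m,\Gamma_\Omega}\Vert_{m+1}}=1+\mathcal{O}(H).$$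
   Context: $\Omega=[a,b]$; $\Vert\cdot\Vert_{k}$ is the $H^k(\Omega)$ norm; $(\cdot,\cdot)$ is the $L^2(\Omega)$ inner product. The functions $f,p_k\in C^p(\bar\Omega)$, $k=0,\ldots,m+1$, are given with $p_{m+1}(x)>0$. The bilinear form is $a(u,v)=\sum_{k=0}^{m+1}\int_\Omega p_k(x)u^{(k)}(x)v^{(k)}(x)\,dx$; the equation $(f,v)=a(u,v)$ is the weak form of $f=\sum_{k=1}^{m+1}((-1)^kp_ku^{(k)})^{(k)}+p_0u$ on $\Omega$ with $u^{(k)}(a)=u^{(k)}(b)=0$, $k=0,\ldots,m$. Partition: $\Gamma_\Omega=\{a=x_0<\cdots<x_N=b\}$, $\Omega_j=(x_{j-1},x_j)$, $h_j=x_j-x_{j-1}$, $m_j=(x_{j-1}+x_j)/2$, $H=\max_jh_j$, $\beta H=\min_jh_j$ with $\beta$ bounded below by a positive constant independently of $N$. The $\mathcal{O}(H)$ refers to $H\to0$ over a family of such partitions, with $C(p,m)$ independent of the partition. $S^{p,m,\Gamma_\Omega}$ is the space of $C^m(\bar\Omega)$ functions that are polynomials of degree at most $p$ on each $\Omega_j$; $S_0^{p,m,\Gamma_\Omega}$ is the subspace of those whose derivatives of order $0,\ldots,m$ vanish at $a$ and $b$. Piecewise Hermite-Jacobi interpolant: let $\mu_2<\cdots<\mu_{p-2m}$ be the $p-2m-1$ roots (real, simple, in $(-1,1)$; none if $p=2m+1$) of the $(m+1)$-st derivative $P_{p-m}^{(m+1)}$ of the Legendre polynomial $P_{p-m}$.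 $W_{p,m,\Gamma_\Omega}$ is, on each $\bar\Omega_j$, the polynomial of degree at most $p$ whose derivatives of order $0,\ldots,m$ agree with those of $u$ at $x_{j-1}$ and $x_j$ and which agrees with $u$ at $m_j+h_j\mu_i/2$, $i=2,\ldots,p-2m$. *)

theory Defs
  imports "HOL-Analysis.Analysis" "HOL-Computational_Algebra.Polynomial"
    "HOL-Library.Landau_Symbols"
begin

section \<open>Classical derivatives on a closed interval\<close>

text \<open>Derivatives are taken relative to \<open>S\<close>, so at the end points of \<open>{a..b}\<close> they are one-sided.\<close>

definition deriv_on :: "real set \<Rightarrow> nat \<Rightarrow> (real \<Rightarrow> real) \<Rightarrow> real \<Rightarrow> real" where
  "deriv_on S k f = ((\<lambda>g x. vector_derivative g (at x within S)) ^^ k) f"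

definition C_on :: "nat \<Rightarrow> real set \<Rightarrow> (real \<Rightarrow> real) set" where
  "C_on k S = {f. (\<forall>i<k. deriv_on S i f differentiable_on S) \<and> continuous_on S (deriv_on S k f)}"


section \<open>Sobolev spaces on a bounded interval\<close>

text \<open>
  Elements of these spaces are represented by functions on the whole real line of which only the
  restriction to \<open>{a..b}\<close>, up to null sets, is relevant.
\<close>

definition test_fun :: "real \<Rightarrow> real \<Rightarrow> (real \<Rightarrow> real) set" where
  "test_fun a b = {\<phi>. (\<forall>k x. (deriv ^^ k) \<phi> differentiable at x) \<and>
     (\<exists>K. compact K \<and> K \<subseteq> {a<..<b} \<and> (\<forall>x. x \<notin> K \<longrightarrow> \<phi> x = 0))}"

definition is_weak_deriv :: "real \<Rightarrow> real \<Rightarrow> nat \<Rightarrow> (real \<Rightarrow> real) \<Rightarrow> (real \<Rightarrow> real) \<Rightarrow> bool" where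
  "is_weak_deriv a b k v g \<longleftrightarrow>
     set_integrable lebesgue {a..b} v \<and> set_integrable lebesgue {a..b} g \<and>
     (\<forall>\<phi>\<in>test_fun a b.
        (LINT x:{a..b}|lebesgue. v x * (deriv ^^ k) \<phi> x) =
        (-1) ^ k * (LINT x:{a..b}|lebesgue. g x * \<phi> x))"

text \<open>The weak derivative is determined only almost everywhere; any representative will do.\<close>

definition weak_deriv :: "real \<Rightarrow> real \<Rightarrow> nat \<Rightarrow> (real \<Rightarrow> real) \<Rightarrow> real \<Rightarrow> real" where
  "weak_deriv a b k v = (SOME g. is_weak_deriv a b k v g)"

definition L2_fun :: "real \<Rightarrow> real \<Rightarrow> (real \<Rightarrow> real) set" where
  "L2_fun a b = {g. g \<in> borel_measurable (lebesgue_on {a..b}) \<and>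
     set_integrable lebesgue {a..b} (\<lambda>x. (g x)\<^sup>2)}"

definition L2_inner :: "real \<Rightarrow> real \<Rightarrow> (real \<Rightarrow> real) \<Rightarrow> (real \<Rightarrow> real) \<Rightarrow> real" where
  "L2_inner a b f g = (LINT x:{a..b}|lebesgue. f x * g x)"

definition H_space :: "real \<Rightarrow> real \<Rightarrow> nat \<Rightarrow> (real \<Rightarrow> real) set" where
  "H_space a b k = {v. \<forall>i\<le>k. \<exists>g. is_weak_deriv a b i v g \<and> g \<in> L2_fun a b}"

definition H_norm :: "real \<Rightarrow> real \<Rightarrow> nat \<Rightarrow> (real \<Rightarrow> real) \<Rightarrow> real" where
  "H_norm a b k v =
     sqrt (\<Sum>i\<le>k. LINT x:{a..b}|lebesgue. (weak_deriv a b i v x)\<^sup>2)"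

definition H0_space :: "real \<Rightarrow> real \<Rightarrow> nat \<Rightarrow> (real \<Rightarrow> real) set" where
  "H0_space a b k = {v \<in> H_space a b k.
     \<forall>\<epsilon>>0. \<exists>\<phi>\<in>test_fun a b. H_norm a b k (\<lambda>x. v x - \<phi> x) < \<epsilon>}"

text \<open>
  The coefficients are \<open>c 0, \<dots>, c (m + 1)\<close>. Weak derivatives are used because the derivative of
  order \<open>m + 1\<close> of a piecewise polynomial in \<open>C\<^sup>m\<close> need not exist at the nodes.
\<close>

definition bilin_form ::
  "real \<Rightarrow> real \<Rightarrow> nat \<Rightarrow> (nat \<Rightarrow> real \<Rightarrow> real) \<Rightarrow> (real \<Rightarrow> real) \<Rightarrow> (real \<Rightarrow> real) \<Rightarrow> real" where
  "bilin_form a b m c u v =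
     (\<Sum>k\<le>m+1. LINT x:{a..b}|lebesgue. c k x * weak_deriv a b k u x * weak_deriv a b k v x)"


section \<open>Partitions and piecewise polynomials\<close>

text \<open>A partition is given by the number \<open>N\<close> of its elements and its nodes \<open>x 0, \<dots>, x N\<close>.\<close>

definition is_partition :: "real \<Rightarrow> real \<Rightarrow> nat \<Rightarrow> (nat \<Rightarrow> real) \<Rightarrow> bool" where
  "is_partition a b N x \<longleftrightarrow> 0 < N \<and> x 0 = a \<and> x N = b \<and> (\<forall>j\<in>{1..N}. x (j - 1) < x j)"

definition max_step :: "nat \<Rightarrow> (nat \<Rightarrow> real) \<Rightarrow> real" where
  "max_step N x = Max ((\<lambda>j. x j - x (j - 1)) ` {1..N})"

definition min_step :: "nat \<Rightarrow> (nat \<Rightarrow> real) \<Rightarrow> real" where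
  "min_step N x = Min ((\<lambda>j. x j - x (j - 1)) ` {1..N})"

definition spline_space ::
  "nat \<Rightarrow> nat \<Rightarrow> real \<Rightarrow> real \<Rightarrow> nat \<Rightarrow> (nat \<Rightarrow> real) \<Rightarrow> (real \<Rightarrow> real) set" where
  "spline_space p m a b N x = {v \<in> C_on m {a..b}.
     \<forall>j\<in>{1..N}. \<exists>q :: real poly. degree q \<le> p \<and> (\<forall>t\<in>{x (j - 1)<..<x j}. v t = poly q t)}"

definition spline_space0 ::
  "nat \<Rightarrow> nat \<Rightarrow> real \<Rightarrow> real \<Rightarrow> nat \<Rightarrow> (nat \<Rightarrow> real) \<Rightarrow> (real \<Rightarrow> real) set" where
  "spline_space0 p m a b N x = {v \<in> spline_space p m a b N x.
     \<forall>k\<le>m. deriv_on {a..b} k v a = 0 \<and> deriv_on {a..b} k v b = 0}"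


section \<open>Piecewise Hermite-Jacobi interpolation\<close>

text \<open>Legendre polynomials by Rodrigues' formula, normalised to take the value 1 at 1.\<close>

definition legendre_poly :: "nat \<Rightarrow> real poly" where
  "legendre_poly n = smult (1 / (2 ^ n * fact n)) ((pderiv ^^ n) ([:-1, 0, 1:] ^ n))"

definition HJ_nodes :: "nat \<Rightarrow> nat \<Rightarrow> real set" where
  "HJ_nodes p m = {\<mu>. poly ((pderiv ^^ (m + 1)) (legendre_poly (p - m))) \<mu> = 0}"

text \<open>
  \<open>W\<close> is the interpolant of \<open>u\<close>: on the element from \<open>l\<close> to \<open>r\<close> it is a polynomial of degree at
  most \<open>p\<close> with \<open>2 (m + 1)\<close> Hermite conditions at the end points and, since \<open>HJ_nodes p m\<close>
  consists of \<open>p - 2 m - 1\<close> points, altogether \<open>p + 1\<close> conditions.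
\<close>

definition is_HJ_interpolant ::
  "nat \<Rightarrow> nat \<Rightarrow> real \<Rightarrow> real \<Rightarrow> nat \<Rightarrow> (nat \<Rightarrow> real) \<Rightarrow> (real \<Rightarrow> real) \<Rightarrow> (real \<Rightarrow> real) \<Rightarrow> bool" where
  "is_HJ_interpolant p m a b N x u W \<longleftrightarrow>
     (\<forall>j\<in>{1..N}. let l = x (j - 1); r = x j in
        \<exists>q :: real poly. degree q \<le> p \<and> (\<forall>t\<in>{l..r}. W t = poly q t) \<and>
          (\<forall>k\<le>m. poly ((pderiv ^^ k) q) l = deriv_on {a..b} k u l \<and>
                  poly ((pderiv ^^ k) q) r = deriv_on {a..b} k u r) \<and>
          (\<forall>\<mu>\<in>HJ_nodes p m. let t = (l + r) / 2 + (r - l) * \<mu> / 2 in poly q t = u t))"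

end

theory Submission
  imports Defs
begin

text \<open>
  It suffices to show that \<open>U - W\<close> is of order \<open>H ^ (p + 1 - m)\<close> in the norm of order \<open>m + 1\<close>, one order more
  than the assumed lower bound. A function with vanishing initial data is identified with its
  derivative \<open>g\<close> of order \<open>m + 1\<close>; integration by parts turns the bilinear form into the pairing of
  \<open>red g\<close>, a multiple of \<open>g\<close> plus a Volterra operator, with the derivative of order \<open>m + 1\<close> of the test
  function, and vanishing data at the right end means orthogonality to the polynomials of degree \<open>m\<close>.

  Consistency: on each element the interpolation error is, up to higher order, a multiple of a
  polynomial whose derivative of order \<open>m + 1\<close> is a Legendre polynomial, hence orthogonal to the
  derivatives of splines; freezing the leading coefficient on each element leaves a factor \<open>H\<close>.

  Stability: if \<open>red g\<close> is small when tested with splines, then it is close to a polynomial of degree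
  \<open>m\<close>, because \<open>red g\<close> is within \<open>H\<close> of a piecewise polynomial. For the continuous problem, \<open>g\<close> is
  controlled by the distance of \<open>red g\<close> to these polynomials: solving Volterra equations and
  Gronwall's lemma reduce this to a finite-dimensional injectivity statement, which is the uniqueness
  of the weak solution. Neither Garding's inequality nor a compactness argument is needed.
\<close>

section \<open>Piecewise continuous functions and iterated integrals\<close>

text \<open>The lower order coefficients carry no sign, so the form need not be coercive, and
  stability has to be extracted from the uniqueness of the weak solution alone. The way out is that
  the equation without conditions at \<open>b\<close> is an initial value problem and hence always
  well-posed; only the \<open>m + 1\<close> end conditions remain, and for them uniqueness is a
  statement of linear algebra.

  The quotient of the two norms is reached through the reverse triangle inequality: the difference
  of the norms is at most a multiple of the L2 norm of the derivative of order \<open>m + 1\<close>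
  of \<open>U - W\<close>, and division by the lower bound of order \<open>p - m\<close> leaves one
  factor \<open>H\<close>.

  The derivative of order \<open>m + 1\<close> of a spline jumps at the nodes, and its value there
  may be unspecified. Hence the class \<open>pc\<close>: bounded on the closed interval and
  continuous off a finite set. It is closed under sums, products and integration, and on it the
  Lebesgue integrals of the definitions agree with the gauge integral, for which the fundamental
  theorem of calculus is at hand.\<close>

definition pc :: "real \<Rightarrow> real \<Rightarrow> (real \<Rightarrow> real) \<Rightarrow> bool" where
  "pc a b g \<longleftrightarrow> bounded (g ` {a..b}) \<and> (\<exists>S. finite S \<and> (\<forall>t\<in>{a<..<b} - S. isCont g t))"

lemma pcI:
  assumes "\<And>t. t \<in> {a..b} \<Longrightarrow> \<bar>g t\<bar> \<le> B" "finite S" "\<And>t. t \<in> {a<..<b} - S \<Longrightarrow> isCont g t"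
  shows "pc a b g"
  unfolding pc_def bounded_iff using assms by force

lemma pc_bound:
  assumes "pc a b g"
  obtains B where "B \<ge> 0" "\<And>t. t \<in> {a..b} \<Longrightarrow> \<bar>g t\<bar> \<le> B"
proof -
  from assms obtain B where "\<forall>x\<in>g ` {a..b}. norm x \<le> B"
    unfolding pc_def bounded_iff by blast
  then have "\<And>t. t \<in> {a..b} \<Longrightarrow> \<bar>g t\<bar> \<le> B" by auto
  then have "max B 0 \<ge> 0" "\<And>t. t \<in> {a..b} \<Longrightarrow> \<bar>g t\<bar> \<le> max B 0"
    by (auto simp: le_max_iff_disj)
  then show thesis by (rule that)
qed

lemma pc_continuous:
  assumes "continuous_on {a..b} g"
  shows "pc a b g"
proof -
  have "bounded (g ` {a..b})"
    using assms by (intro compact_imp_bounded compact_continuous_image) auto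
  moreover have "isCont g t" if "t \<in> {a<..<b}" for t
    using continuous_on_interior[OF assms, of t] that by simp
  ultimately show ?thesis unfolding pc_def by (metis Diff_empty finite.emptyI)
qed

lemma pc_const [simp]: "pc a b (\<lambda>t. k)"
  by (intro pc_continuous continuous_intros)

text \<open>One pattern for all pointwise operations: the third hypothesis gives continuity off the
  union of the two exceptional sets, and the fourth says that \<open>F\<close> maps bounded sets to
  bounded sets.\<close>

lemma pc_combine:
  assumes "pc a b f" "pc a b g"
    and "\<And>t. isCont f t \<Longrightarrow> isCont g t \<Longrightarrow> isCont (\<lambda>t. F (f t) (g t)) t"
    and "\<And>B1 B2. \<exists>B. \<forall>x y. \<bar>x\<bar> \<le> B1 \<and> \<bar>y\<bar> \<le> B2 \<longrightarrow> \<bar>F x y\<bar> \<le> (B::real)"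
  shows "pc a b (\<lambda>t. F (f t) (g t))"
proof -
  obtain B1 B2 where B: "\<And>t. t \<in> {a..b} \<Longrightarrow> \<bar>f t\<bar> \<le> B1" "\<And>t. t \<in> {a..b} \<Longrightarrow> \<bar>g t\<bar> \<le> B2"
    using assms(1,2) by (metis pc_bound)
  obtain B3 where "\<forall>x y. \<bar>x\<bar> \<le> B1 \<and> \<bar>y\<bar> \<le> B2 \<longrightarrow> \<bar>F x y\<bar> \<le> B3"
    using assms(4) by blast
  moreover obtain S1 S2 where "finite S1" "finite S2" "\<forall>t\<in>{a<..<b} - S1. isCont f t"
    "\<forall>t\<in>{a<..<b} - S2. isCont g t"
    using assms(1,2) unfolding pc_def by blast
  ultimately show ?thesis
    by (intro pcI[of a b _ B3 "S1 \<union> S2"]) (use B assms(3) in auto)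
qed

lemma pc_add: "pc a b f \<Longrightarrow> pc a b g \<Longrightarrow> pc a b (\<lambda>t. f t + g t)"
proof (erule (1) pc_combine)
  show "\<exists>B. \<forall>x y. \<bar>x\<bar> \<le> B1 \<and> \<bar>y\<bar> \<le> B2 \<longrightarrow> \<bar>x + y\<bar> \<le> B" for B1 B2 :: real
    by (rule exI[of _ "B1 + B2"]) auto
qed auto

lemma pc_diff: "pc a b f \<Longrightarrow> pc a b g \<Longrightarrow> pc a b (\<lambda>t. f t - g t)"
proof (erule (1) pc_combine)
  show "\<exists>B. \<forall>x y. \<bar>x\<bar> \<le> B1 \<and> \<bar>y\<bar> \<le> B2 \<longrightarrow> \<bar>x - y\<bar> \<le> B" for B1 B2 :: real
    by (rule exI[of _ "B1 + B2"]) auto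
qed auto

lemma pc_mult: "pc a b f \<Longrightarrow> pc a b g \<Longrightarrow> pc a b (\<lambda>t. f t * g t)"
proof (erule (1) pc_combine)
  show "\<exists>B. \<forall>x y. \<bar>x\<bar> \<le> B1 \<and> \<bar>y\<bar> \<le> B2 \<longrightarrow> \<bar>x * y\<bar> \<le> B" for B1 B2 :: real
    by (rule exI[of _ "B1 * B2"]) (auto simp: abs_mult intro: mult_mono')
qed auto

lemma pc_cmult: "pc a b f \<Longrightarrow> pc a b (\<lambda>t. k * f t)"
  by (rule pc_mult) auto

lemma pc_abs: "pc a b f \<Longrightarrow> pc a b (\<lambda>t. \<bar>f t\<bar>)"
proof (erule pc_combine[where F = "\<lambda>x y. \<bar>x\<bar>" and g = "\<lambda>_. 0"])
  show "\<exists>B. \<forall>x y. \<bar>x\<bar> \<le> B1 \<and> \<bar>y\<bar> \<le> B2 \<longrightarrow> \<bar>\<bar>x\<bar>\<bar> \<le> B" for B1 B2 :: real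
    by (rule exI[of _ B1]) auto
qed (auto intro: continuous_intros pc_continuous)

lemma pc_power2: "pc a b f \<Longrightarrow> pc a b (\<lambda>t. (f t)\<^sup>2)"
  by (simp add: power2_eq_square pc_mult)

lemma pc_sum: "(\<And>i. i \<in> I \<Longrightarrow> pc a b (f i)) \<Longrightarrow> pc a b (\<lambda>t. \<Sum>i\<in>I. f i t)"
  by (induction I rule: infinite_finite_induct) (auto intro: pc_add)

lemma pc_poly [simp]: "pc a b (poly q)"
  by (intro pc_continuous continuous_intros)

lemma pc_divide:
  assumes "pc a b f" "continuous_on {a..b} g" "\<And>t. t \<in> {a..b} \<Longrightarrow> g t \<noteq> 0"
  shows "pc a b (\<lambda>t. f t / g t)"
proof -
  have "pc a b (\<lambda>t. inverse (g t))"
    using assms by (intro pc_continuous continuous_intros) auto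
  then show ?thesis
    using assms(1) pc_mult by (simp add: divide_inverse)
qed

lemma pc_cong:
  assumes "pc a b f" "\<And>t. t \<in> {a..b} \<Longrightarrow> g t = f t"
  shows "pc a b g"
proof -
  have "isCont g t" if "isCont f t" "t \<in> {a<..<b}" for t
  proof -
    have "\<forall>\<^sub>F s in nhds t. f s = g s"
      using eventually_nhds_in_open[of "{a<..<b}" t] that assms(2)
      by (auto elim!: eventually_mono)
    then show ?thesis using isCont_cong that(1) by blast
  qed
  moreover have "g ` {a..b} = f ` {a..b}" using assms(2) by (auto simp: image_def)
  ultimately show ?thesis using assms(1) unfolding pc_def by (metis DiffD1)
qed

lemma pc_subset:
  assumes "pc a b f" "a \<le> c" "d \<le> b"
  shows "pc c d f"
proof -
  have "f ` {c..d} \<subseteq> f ` {a..b}" "{c<..<d} \<subseteq> {a<..<b}" using assms by auto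
  then show ?thesis using assms(1) unfolding pc_def by (meson Diff_iff bounded_subset in_mono)
qed

text \<open>Off the exceptional set and the end points \<open>g\<close> is continuous on an open
  set, hence measurable there, and it is bounded; what is left out is a null set. This is the bridge
  between the two integrals.\<close>

lemma pc_abs_integrable:
  assumes "pc a b g"
  shows "g absolutely_integrable_on {a..b}"
proof -
  obtain S where S: "finite S" "\<forall>t\<in>{a<..<b} - S. isCont g t"
    using assms unfolding pc_def by blast
  obtain B where B: "\<And>t. t \<in> {a..b} \<Longrightarrow> \<bar>g t\<bar> \<le> B" using pc_bound[OF assms] by blast
  have opn: "open ({a<..<b} - S)" using S(1) by (intro open_Diff finite_imp_closed) auto
  then have sets: "{a<..<b} - S \<in> sets lebesgue" by auto
  have "continuous_on ({a<..<b} - S) g"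
    using S(2) by (simp add: continuous_at_imp_continuous_on)
  then have "g \<in> borel_measurable (lebesgue_on ({a<..<b} - S))"
    using sets by (rule continuous_imp_measurable_on_sets_lebesgue)
  moreover have "(\<lambda>t. B) integrable_on ({a<..<b} - S)"
  proof -
    have "{a<..<b} - S \<in> lmeasurable"
      using sets by (rule_tac fmeasurableI2[of "{a..b}"]) auto
    then show ?thesis by (rule integrable_on_const)
  qed
  ultimately have int: "g absolutely_integrable_on ({a<..<b} - S)"
    by (rule measurable_bounded_by_integrable_imp_absolutely_integrable[OF _ sets])
       (use B in auto)
  have "negligible (S \<union> {a, b})" using S(1) by (simp add: negligible_finite)
  then show ?thesis
    by (intro absolutely_integrable_spike_set[OF int]) (rule negligible_subset, assumption, force)+
qed

lemma pc_integrable: "pc a b g \<Longrightarrow> g integrable_on {a..b}"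
  using pc_abs_integrable absolutely_integrable_on_def by blast

lemma pc_integrable_subset: "pc a b g \<Longrightarrow> a \<le> c \<Longrightarrow> d \<le> b \<Longrightarrow> g integrable_on {c..d}"
  by (meson pc_integrable pc_subset)

lemma pc_lint: "pc a b g \<Longrightarrow> (LINT t:{a..b}|lebesgue. g t) = integral {a..b} g"
  by (simp add: set_lebesgue_integral_eq_integral(2) pc_abs_integrable)

lemma pc_measurable: "pc a b g \<Longrightarrow> g \<in> borel_measurable (lebesgue_on {a..b})"
  by (rule absolutely_integrable_imp_borel_measurable[OF pc_abs_integrable]) auto

section \<open>Iterated integration from the left end point and integration by parts\<close>

definition J :: "real \<Rightarrow> (real \<Rightarrow> real) \<Rightarrow> real \<Rightarrow> real" where
  "J a g t = integral {a..t} g"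

abbreviation Jn :: "real \<Rightarrow> nat \<Rightarrow> (real \<Rightarrow> real) \<Rightarrow> real \<Rightarrow> real" where
  "Jn a n \<equiv> (J a ^^ n)"

lemma J_at_start [simp]: "J a g a = 0"
  by (simp add: J_def)

lemma J_cong: "(\<And>s. s \<in> {a..t} \<Longrightarrow> f s = g s) \<Longrightarrow> J a f t = J a g t"
  unfolding J_def by (rule integral_cong) auto

lemma Jn_cong:
  "(\<And>s. s \<in> {a..b} \<Longrightarrow> f s = g s) \<Longrightarrow> t \<in> {a..b} \<Longrightarrow> Jn a n f t = Jn a n g t"
proof (induction n arbitrary: t)
  case (Suc n)
  have "J a (Jn a n f) t = J a (Jn a n g) t"
    by (rule J_cong) (use Suc in auto)
  then show ?case by simp
qed auto

lemma J_cont: "pc a b g \<Longrightarrow> continuous_on {a..b} (J a g)"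
  unfolding J_def[abs_def] by (intro indefinite_integral_continuous_1 pc_integrable)

lemma pc_J: "pc a b g \<Longrightarrow> pc a b (J a g)"
  by (rule pc_continuous[OF J_cont])

lemma pc_Jn: "pc a b g \<Longrightarrow> pc a b (Jn a n g)"
  by (induction n) (auto intro: pc_J)

lemma Jn_cont: "pc a b g \<Longrightarrow> n > 0 \<Longrightarrow> continuous_on {a..b} (Jn a n g)"
  by (cases n) (auto intro: J_cont pc_Jn)

lemma Jn_at_start [simp]: "n > 0 \<Longrightarrow> Jn a n g a = 0"
  by (cases n) auto

lemma J_deriv:
  assumes "pc a b g" "isCont g t" "t \<in> {a<..<b}"
  shows "(J a g has_real_derivative g t) (at t)"
proof -
  have "((\<lambda>u. integral {a..u} g) has_vector_derivative g t) (at t within ({a..b} - {}))"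
    using assms
    by (intro integral_has_vector_derivative_continuous_at)
       (auto intro: pc_integrable continuous_at_imp_continuous_at_within)
  moreover have "at t within {a..b} = at t"
    using assms(3) by (simp add: at_within_Icc_at)
  ultimately show ?thesis
    by (simp add: has_real_derivative_iff_has_vector_derivative J_def[abs_def])
qed

lemma J_deriv_within:
  assumes "continuous_on {a..b} g" "t \<in> {a..b}"
  shows "(J a g has_real_derivative g t) (at t within {a..b})"
  using integral_has_real_derivative[OF assms] by (simp add: J_def[abs_def])

lemma J_deriv_off_finite:
  assumes "pc a b g"
  obtains S where "finite S" "\<And>t. t \<in> {a<..<b} - S \<Longrightarrow> (J a g has_real_derivative g t) (at t)"
proof -
  obtain S where "finite S" "\<forall>t\<in>{a<..<b} - S. isCont g t"
    using assms unfolding pc_def by blast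
  then show thesis using J_deriv[OF assms] by (intro that[of S]) auto
qed

lemma parts_pc:
  assumes "a \<le> b" "pc a b g" "pc a b F'" "continuous_on {a..b} F" "finite T"
    "\<And>t. t \<in> {a<..<b} - T \<Longrightarrow> (F has_real_derivative F' t) (at t)"
  shows "integral {a..b} (\<lambda>t. F t * g t) = F b * J a g b - integral {a..b} (\<lambda>t. F' t * J a g t)"
proof -
  obtain S where S: "finite S" "\<And>t. t \<in> {a<..<b} - S \<Longrightarrow> (J a g has_real_derivative g t) (at t)"
    using J_deriv_off_finite[OF assms(2)] by blast
  have "((\<lambda>t. F t * g t + F' t * J a g t) has_integral (F b * J a g b - F a * J a g a)) {a..b}"
  proof (rule fundamental_theorem_of_calculus_interior_strong[of "S \<union> T"])
    show "continuous_on {a..b} (\<lambda>t. F t * J a g t)"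
      using assms J_cont by (intro continuous_intros) auto
    show "((\<lambda>t. F t * J a g t) has_vector_derivative F t * g t + F' t * J a g t) (at t)"
      if "t \<in> {a<..<b} - (S \<union> T)" for t
      unfolding has_real_derivative_iff_has_vector_derivative[symmetric]
      using that by (auto intro!: derivative_eq_intros S(2) assms(6))
  qed (use S assms in auto)
  moreover have "pc a b (\<lambda>t. F t * g t)" "pc a b (\<lambda>t. F' t * J a g t)"
    using assms by (auto intro!: pc_mult pc_J pc_continuous[of a b F])
  ultimately show ?thesis
    using integral_add[OF pc_integrable pc_integrable, of a b "\<lambda>t. F t * g t" "\<lambda>t. F' t * J a g t"]
    by (simp add: integral_unique)
qed

lemma parts_J:
  assumes "a \<le> b" "pc a b g" "pc a b h"
  shows "integral {a..b} (\<lambda>t. J a h t * g t) = J a h b * J a g b - integral {a..b} (\<lambda>t. h t * J a g t)"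
proof -
  obtain S where "finite S" "\<And>t. t \<in> {a<..<b} - S \<Longrightarrow> (J a h has_real_derivative h t) (at t)"
    using J_deriv_off_finite[OF assms(3)] by blast
  then show ?thesis using assms by (intro parts_pc[of a b g h "J a h" S] J_cont)
qed

text \<open>Only data of \<open>w\<close> at \<open>b\<close> enter: at \<open>a\<close> all
  boundary terms vanish because every iterated integral starts there. So \<open>h\<close> is
  arbitrary, which lets terms with variable coefficients be rewritten as integrals against
  \<open>w\<close> itself.\<close>

lemma parts_Jn:
  assumes "a \<le> b" "pc a b h" "pc a b w" "\<And>k. 1 \<le> k \<Longrightarrow> k \<le> n \<Longrightarrow> Jn a k w b = 0"
  shows "integral {a..b} (\<lambda>t. h t * Jn a n w t) = (-1) ^ n * integral {a..b} (\<lambda>t. Jn a n h t * w t)"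
  using assms
proof (induction n arbitrary: h)
  case (Suc n)
  have "integral {a..b} (\<lambda>t. Jn a (Suc n) h t * w t) = integral {a..b} (\<lambda>t. Jn a n (J a h) t * w t)"
    by (simp add: funpow_Suc_right del: funpow.simps)
  moreover have "integral {a..b} (\<lambda>t. J a h t * Jn a n w t)
      = (-1) ^ n * integral {a..b} (\<lambda>t. Jn a n (J a h) t * w t)"
    using Suc by (intro Suc.IH) (auto intro: pc_J)
  moreover have "integral {a..b} (\<lambda>t. J a h t * Jn a n w t)
      = J a h b * J a (Jn a n w) b - integral {a..b} (\<lambda>t. h t * J a (Jn a n w) t)"
    using Suc by (intro parts_J) (auto intro: pc_Jn)
  moreover have "J a (Jn a n w) b = 0" using Suc.prems(4)[of "Suc n"] by simp
  ultimately show ?case by simp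
qed auto

subsection \<open>Norm estimates\<close>

definition nrm :: "real \<Rightarrow> real \<Rightarrow> (real \<Rightarrow> real) \<Rightarrow> real" where
  "nrm a b g = sqrt (integral {a..b} (\<lambda>t. (g t)\<^sup>2))"

lemma integral_nonneg_pc: "pc a b g \<Longrightarrow> (\<And>t. t \<in> {a..b} \<Longrightarrow> g t \<ge> 0) \<Longrightarrow> integral {a..b} g \<ge> 0"
  by (rule integral_nonneg) (auto intro: pc_integrable)

lemma nrm_nonneg [simp]: "nrm a b g \<ge> 0" if "pc a b g"
  unfolding nrm_def using that by (auto intro!: integral_nonneg_pc pc_power2)

lemma nrm_square: "pc a b g \<Longrightarrow> (nrm a b g)\<^sup>2 = integral {a..b} (\<lambda>t. (g t)\<^sup>2)"
  unfolding nrm_def by (auto intro!: real_sqrt_pow2 integral_nonneg_pc pc_power2)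

lemma discriminant_nonpos:
  fixes A B C :: real
  assumes "\<And>s. A + 2 * s * B + s\<^sup>2 * C \<ge> 0"
  shows "B\<^sup>2 \<le> A * C"
proof (cases "C = 0")
  case True
  have "B = 0"
  proof (rule ccontr)
    assume "B \<noteq> 0"
    \<comment> \<open>With \<open>C = 0\<close> the expression is affine in \<open>s\<close>; this
      choice of \<open>s\<close> makes it \<open>-1\<close>.\<close>
    then show False using assms[of "- (A + 1) / (2 * B)"] True by (simp add: field_simps)
  qed
  then show ?thesis using True by simp
next
  case False
  have "C \<ge> 0"
  proof (rule ccontr)
    assume "\<not> C \<ge> 0"
    then have "C < 0" by simp
    have A: "A \<ge> 0" using assms[of 0] by simp
    \<comment> \<open>At \<open>s\<close> and \<open>-s\<close> the mixed terms cancel, so the two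
      inequalities add up to \<open>2 * A - 2 * (A + 1) \<ge> 0\<close>, a contradiction.\<close>
    let ?s = "sqrt ((A + 1) / - C)"
    have "?s\<^sup>2 = (A + 1) / - C" using A \<open>C < 0\<close> by (intro real_sqrt_pow2 divide_nonneg_nonneg) auto
    then have "?s\<^sup>2 * C = - (A + 1)" using False by (simp add: field_simps)
    then show False using assms[of ?s] assms[of "- ?s"] by (simp add: algebra_simps)
  qed
  then have "C > 0" using False by simp
  have "A + 2 * (- B / C) * B + (- B / C)\<^sup>2 * C = A - B\<^sup>2 / C"
    using \<open>C > 0\<close> by (simp add: field_simps power2_eq_square)
  then have "A - B\<^sup>2 / C \<ge> 0" using assms[of "- B / C"] by metis
  then show ?thesis using \<open>C > 0\<close> by (simp add: field_simps)
qed

lemma cauchy_schwarz: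
  assumes "pc a b f" "pc a b g"
  shows "\<bar>integral {a..b} (\<lambda>t. f t * g t)\<bar> \<le> nrm a b f * nrm a b g"
proof -
  let ?A = "integral {a..b} (\<lambda>t. (f t)\<^sup>2)" and ?C = "integral {a..b} (\<lambda>t. (g t)\<^sup>2)"
    and ?B = "integral {a..b} (\<lambda>t. f t * g t)"
  have "?A + 2 * s * ?B + s\<^sup>2 * ?C \<ge> 0" for s
  proof -
    have "0 \<le> integral {a..b} (\<lambda>t. (f t + s * g t)\<^sup>2)"
      using assms by (intro integral_nonneg_pc pc_power2 pc_add pc_cmult) auto
    also have "(\<lambda>t. (f t + s * g t)\<^sup>2) = (\<lambda>t. (f t)\<^sup>2 + ((2 * s) * (f t * g t) + s\<^sup>2 * (g t)\<^sup>2))"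
      by (simp add: fun_eq_iff power2_eq_square algebra_simps)
    also have "integral {a..b} \<dots> = ?A + ((2 * s) * ?B + s\<^sup>2 * ?C)"
      using assms
      by (simp add: integral_add pc_integrable pc_add pc_mult pc_cmult pc_power2 integral_mult_right)
    finally show ?thesis by simp
  qed
  then have "?B\<^sup>2 \<le> ?A * ?C" by (rule discriminant_nonpos)
  then have "\<bar>?B\<bar> \<le> sqrt (?A * ?C)" by (intro real_le_rsqrt) simp
  then show ?thesis by (simp add: nrm_def real_sqrt_mult)
qed

lemma nrm_cong: "(\<And>t. t \<in> {a..b} \<Longrightarrow> f t = g t) \<Longrightarrow> nrm a b f = nrm a b g"
  unfolding nrm_def by (metis (no_types, lifting) integral_cong)

lemma nrm_triangle:
  assumes "pc a b f" "pc a b g"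
  shows "nrm a b (\<lambda>t. f t + g t) \<le> nrm a b f + nrm a b g"
proof (rule power2_le_imp_le)
  have "(nrm a b (\<lambda>t. f t + g t))\<^sup>2 = integral {a..b} (\<lambda>t. (f t)\<^sup>2 + (2 * (f t * g t) + (g t)\<^sup>2))"
    using assms by (subst nrm_square) (auto intro: pc_add simp: power2_sum algebra_simps)
  also have "\<dots> = (nrm a b f)\<^sup>2 + 2 * integral {a..b} (\<lambda>t. f t * g t) + (nrm a b g)\<^sup>2"
    using assms by (simp add: nrm_square integral_add pc_integrable pc_add pc_mult pc_cmult pc_power2
        integral_mult_right)
  also have "\<dots> \<le> (nrm a b f + nrm a b g)\<^sup>2"
    using cauchy_schwarz[OF assms] by (simp add: power2_sum)
  finally show "(nrm a b (\<lambda>t. f t + g t))\<^sup>2 \<le> (nrm a b f + nrm a b g)\<^sup>2" .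
qed (use assms in auto)

lemma nrm_cmult: "nrm a b (\<lambda>t. k * f t) = \<bar>k\<bar> * nrm a b f"
  unfolding nrm_def by (simp add: power_mult_distrib integral_mult_right real_sqrt_mult)

text \<open>The exceptional set is meant for the nodes of a partition, where bounds obtained on the
  open elements say nothing.\<close>

lemma nrm_le_off_finite:
  assumes "pc a b f" "pc a b g" "finite S" "\<And>t. t \<in> {a..b} - S \<Longrightarrow> \<bar>f t\<bar> \<le> g t"
  shows "nrm a b f \<le> nrm a b g"
proof -
  let ?h = "\<lambda>t. if t \<in> S then (g t)\<^sup>2 else (f t)\<^sup>2"
  have neg: "negligible S" using assms(3) by (rule negligible_finite)
  have int: "(\<lambda>t. (f t)\<^sup>2) integrable_on {a..b}" "(\<lambda>t. (g t)\<^sup>2) integrable_on {a..b}"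
    using assms by (auto intro: pc_integrable pc_power2)
  have "integral {a..b} (\<lambda>t. (f t)\<^sup>2) = integral {a..b} ?h"
    using neg by (rule integral_spike) auto
  also have "\<dots> \<le> integral {a..b} (\<lambda>t. (g t)\<^sup>2)"
  proof (rule integral_le[OF _ int(2)])
    show "?h integrable_on {a..b}" using int(1) neg by (rule integrable_spike) auto
    show "?h t \<le> (g t)\<^sup>2" if "t \<in> {a..b}" for t
    proof (cases "t \<in> S")
      case False
      then show ?thesis using assms(4)[of t] that by (auto intro: power2_le_iff_abs_le[THEN iffD2] dest: abs_ge_zero[THEN order_trans])
    qed auto
  qed
  finally have "integral {a..b} (\<lambda>t. (f t)\<^sup>2) \<le> integral {a..b} (\<lambda>t. (g t)\<^sup>2)" .
  then show ?thesis unfolding nrm_def by simp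
qed

lemma integral_abs_le_nrm:
  assumes "pc a b f" "a \<le> b"
  shows "integral {a..b} (\<lambda>t. \<bar>f t\<bar>) \<le> sqrt (b - a) * nrm a b f"
proof -
  have "nrm a b (\<lambda>t. 1) = sqrt (b - a)" "nrm a b (\<lambda>t. \<bar>f t\<bar>) = nrm a b f"
    using assms by (auto simp: nrm_def)
  then show ?thesis
    using cauchy_schwarz[of a b "\<lambda>t. 1" "\<lambda>t. \<bar>f t\<bar>"] assms pc_abs by auto
qed

lemma J_mono:
  assumes "pc a b f" "pc a b g" "\<And>s. s \<in> {a..t} \<Longrightarrow> f s \<le> g s" "t \<le> b"
  shows "J a f t \<le> J a g t"
  unfolding J_def using assms by (intro integral_le) (auto intro: pc_integrable_subset)

lemma J_abs_le:
  assumes "pc a b f" "t \<in> {a..b}"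
  shows "\<bar>J a f t\<bar> \<le> J a (\<lambda>s. \<bar>f s\<bar>) t"
  using integral_norm_bound_integral[of f "{a..t}" "\<lambda>s. \<bar>f s\<bar>"] assms pc_abs[OF assms(1)]
  unfolding J_def by (auto intro: pc_integrable_subset)

lemma J_abs_mono:
  assumes "pc a b f" "s \<le> t" "t \<in> {a..b}" "s \<ge> a"
  shows "J a (\<lambda>s. \<bar>f s\<bar>) s \<le> J a (\<lambda>s. \<bar>f s\<bar>) t"
  unfolding J_def using assms pc_abs[OF assms(1)]
  by (intro integral_subset_le) (auto intro: pc_integrable_subset)

text \<open>The integral of the absolute value increases with \<open>t\<close>, so every integration
  after the first costs a factor \<open>b - a\<close>. Keeping this integral up to \<open>t\<close>,
  not up to \<open>b\<close>, is what makes Picard iteration and Gronwall's lemma applicable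
  later.\<close>

lemma Jn_abs_le:
  assumes "pc a b f" "t \<in> {a..b}"
  shows "\<bar>Jn a (Suc n) f t\<bar> \<le> (b - a) ^ n * J a (\<lambda>s. \<bar>f s\<bar>) t"
  using assms(2)
proof (induction n arbitrary: t)
  case 0
  then show ?case using J_abs_le[OF assms(1)] by simp
next
  case (Suc n)
  let ?A = "J a (\<lambda>s. \<bar>f s\<bar>)"
  have A0: "?A s \<ge> 0" if "s \<in> {a..b}" for s
    using J_abs_le[OF assms(1) that] by linarith
  have "\<bar>Jn a (Suc (Suc n)) f t\<bar> \<le> J a (\<lambda>s. \<bar>Jn a (Suc n) f s\<bar>) t"
    using J_abs_le[OF pc_Jn[OF assms(1)] Suc.prems, of "Suc n"] by simp
  also have "\<dots> \<le> J a (\<lambda>s. (b - a) ^ n * ?A t) t"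
  proof (rule J_mono)
    show "pc a b (\<lambda>s. \<bar>Jn a (Suc n) f s\<bar>)" using assms(1) by (intro pc_abs pc_Jn)
    show "\<bar>Jn a (Suc n) f s\<bar> \<le> (b - a) ^ n * ?A t" if "s \<in> {a..t}" for s
    proof -
      have "\<bar>Jn a (Suc n) f s\<bar> \<le> (b - a) ^ n * ?A s" using that Suc by auto
      also have "\<dots> \<le> (b - a) ^ n * ?A t"
        using that Suc.prems assms by (intro mult_left_mono J_abs_mono) auto
      finally show ?thesis .
    qed
  qed (use Suc.prems in auto)
  also have "\<dots> = (t - a) * ((b - a) ^ n * ?A t)" using Suc.prems by (simp add: J_def)
  also have "\<dots> \<le> (b - a) * ((b - a) ^ n * ?A t)"
    using Suc.prems A0 by (intro mult_right_mono mult_nonneg_nonneg) auto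
  finally show ?case by (simp add: mult.assoc)
qed

section \<open>Smooth functions\<close>

text \<open>Differentiability \<open>k\<close> times on the whole line, without continuity of the
  last derivative. Naming the derivative existentially keeps the inductions for products and
  compositions free of \<open>deriv\<close>; taken for all \<open>k\<close>, the notion is
  smoothness.\<close>

primrec Ck :: "nat \<Rightarrow> (real \<Rightarrow> real) \<Rightarrow> bool" where
  "Ck 0 f = True"
| "Ck (Suc k) f = (\<exists>f'. (\<forall>x. (f has_real_derivative f' x) (at x)) \<and> Ck k f')"

lemma Ck_SucI: "(\<And>x. (f has_real_derivative f' x) (at x)) \<Longrightarrow> Ck k f' \<Longrightarrow> Ck (Suc k) f"
  by auto

lemma Ck_mono: "Ck (Suc k) f \<Longrightarrow> Ck k f"
  by (induction k arbitrary: f) auto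

lemma Ck_add: "Ck k f \<Longrightarrow> Ck k g \<Longrightarrow> Ck k (\<lambda>x. f x + g x)"
proof (induction k arbitrary: f g)
  case (Suc k)
  then obtain f' g' where "\<forall>x. (f has_real_derivative f' x) (at x)" "Ck k f'"
    "\<forall>x. (g has_real_derivative g' x) (at x)" "Ck k g'" by auto
  then show ?case using Suc.IH[of f' g']
    by (auto intro!: exI[of _ "\<lambda>x. f' x + g' x"] derivative_eq_intros)
qed auto

lemma Ck_mult: "Ck k f \<Longrightarrow> Ck k g \<Longrightarrow> Ck k (\<lambda>x. f x * g x)"
proof (induction k arbitrary: f g)
  case (Suc k)
  then obtain f' g' where d: "\<forall>x. (f has_real_derivative f' x) (at x)" "Ck k f'"
    "\<forall>x. (g has_real_derivative g' x) (at x)" "Ck k g'" by auto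
  have "Ck k (\<lambda>x. f' x * g x + g' x * f x)"
    using Suc d Ck_mono by (intro Ck_add) blast+
  moreover have "((\<lambda>x. f x * g x) has_real_derivative f' x * g x + g' x * f x) (at x)" for x
    using d by (auto intro: DERIV_mult)
  ultimately show ?case by (rule Ck_SucI[rotated])
qed auto

lemma Ck_affine: "Ck k f \<Longrightarrow> Ck k (\<lambda>x. f (r * x + s))"
proof (induction k arbitrary: f)
  case (Suc k)
  then obtain f' where d: "\<forall>x. (f has_real_derivative f' x) (at x)" "Ck k f'" by auto
  have "Ck k (\<lambda>x. r)" for k and r :: real
    by (induction k arbitrary: r) (auto intro!: exI[of _ "\<lambda>_. 0"])
  then have "Ck k (\<lambda>x. f' (r * x + s) * r)" using Suc d by (intro Ck_mult) auto
  moreover have "((\<lambda>x. f (r * x + s)) has_real_derivative f' (r * x + s) * r) (at x)" for x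
    by (rule DERIV_chain2[OF d(1)[rule_format]]) (auto intro!: derivative_eq_intros)
  ultimately show ?case by (rule Ck_SucI[rotated])
qed auto

lemma Ck_poly: "Ck k (poly q)"
proof (induction k arbitrary: q)
  case (Suc k)
  then show ?case unfolding Ck.simps using poly_DERIV by blast
qed auto

lemma Ck_iff: "Ck k f \<longleftrightarrow> (\<forall>i<k. \<forall>x. (deriv ^^ i) f differentiable at x)"
proof (induction k arbitrary: f)
  case (Suc k)
  have "Ck (Suc k) f \<longleftrightarrow> (\<forall>x. f differentiable at x) \<and> Ck k (deriv f)"
  proof
    assume "Ck (Suc k) f"
    then obtain f' where d: "\<forall>x. (f has_real_derivative f' x) (at x)" "Ck k f'" by auto
    then have "deriv f = f'" by (auto intro: DERIV_imp_deriv)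
    then show "(\<forall>x. f differentiable at x) \<and> Ck k (deriv f)"
      using d real_differentiable_def by blast
  next
    assume *: "(\<forall>x. f differentiable at x) \<and> Ck k (deriv f)"
    then have "\<forall>x. (f has_real_derivative deriv f x) (at x)"
      using DERIV_deriv_iff_real_differentiable by blast
    then show "Ck (Suc k) f" using * by auto
  qed
  also have "\<dots> \<longleftrightarrow> (\<forall>i<Suc k. \<forall>x. (deriv ^^ i) f differentiable at x)"
    by (simp add: Suc.IH All_less_Suc2 funpow_Suc_right del: funpow.simps)
  finally show ?case .
qed auto

definition smooth :: "(real \<Rightarrow> real) \<Rightarrow> bool" where
  "smooth f \<longleftrightarrow> (\<forall>k x. (deriv ^^ k) f differentiable at x)"

lemma smooth_Ck: "smooth f \<longleftrightarrow> (\<forall>k. Ck k f)"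
  unfolding smooth_def Ck_iff by (meson lessI)

lemma smooth_add: "smooth f \<Longrightarrow> smooth g \<Longrightarrow> smooth (\<lambda>x. f x + g x)"
  unfolding smooth_Ck by (blast intro: Ck_add)

lemma smooth_mult: "smooth f \<Longrightarrow> smooth g \<Longrightarrow> smooth (\<lambda>x. f x * g x)"
  unfolding smooth_Ck by (blast intro: Ck_mult)

lemma smooth_affine: "smooth f \<Longrightarrow> smooth (\<lambda>x. f (r * x + s))"
  unfolding smooth_Ck by (blast intro: Ck_affine)

lemma smooth_poly: "smooth (poly q)"
  unfolding smooth_Ck by (blast intro: Ck_poly)

lemma smooth_const: "smooth (\<lambda>x. k)"
proof -
  have "(\<lambda>x. k) = poly [:k:]" by auto
  then show ?thesis using smooth_poly by metis
qed

lemma smooth_power: "smooth f \<Longrightarrow> smooth (\<lambda>x. f x ^ n)"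
  by (induction n) (auto intro: smooth_mult smooth_const)

lemma smooth_deriv: "smooth f \<Longrightarrow> smooth (deriv f)"
  unfolding smooth_def by (metis funpow_Suc_right comp_apply)

lemma smooth_DERIV: "smooth f \<Longrightarrow> (f has_real_derivative deriv f x) (at x)"
  unfolding smooth_def DERIV_deriv_iff_real_differentiable by (metis funpow_0)

lemma smooth_primitive:
  assumes "smooth f" "\<And>x. (F has_real_derivative f x) (at x)"
  shows "smooth F"
proof -
  have "Ck k F" for k using assms unfolding smooth_Ck by (cases k) auto
  then show ?thesis by (simp add: smooth_Ck)
qed

subsection \<open>Bump functions\<close>

text \<open>In the variable \<open>y = 1 / x\<close> this is \<open>q(y) exp(-y)\<close>, continued
  by 0. The polynomial factor makes the family closed under differentiation: as
  \<open>d/dx = - y\<^sup>2 d/dy\<close>, the derivative has \<open>y\<^sup>2 (q - q')\<close> in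
  place of \<open>q\<close>.\<close>

definition flat :: "real poly \<Rightarrow> real \<Rightarrow> real" where
  "flat q x = (if x \<le> 0 then 0 else poly q (1 / x) * exp (- (1 / x)))"

lemma poly_div_exp_tendsto_0: "((\<lambda>x. poly q x / exp x) \<longlongrightarrow> (0::real)) at_top"
proof -
  have "((\<lambda>x. \<Sum>i\<le>degree q. coeff q i * (x ^ i / exp x)) \<longlongrightarrow> (\<Sum>i\<le>degree q. coeff q i * 0)) at_top"
    by (intro tendsto_sum tendsto_mult tendsto_const tendsto_power_div_exp_0)
  then show ?thesis by (simp add: poly_altdef sum_divide_distrib)
qed

lemma flat_DERIV:
  "(flat q has_real_derivative flat ([:0, 0, 1:] * (q - pderiv q)) x) (at x)"
proof -
  consider "x < 0" | "x > 0" | "x = 0" by linarith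
  then show ?thesis
  proof cases
    case 1
    then have "\<forall>\<^sub>F s in nhds x. flat q s = 0"
      using eventually_nhds_in_open[of "{..<0}" x] by (auto simp: flat_def elim!: eventually_mono)
    then have "(flat q has_real_derivative 0) (at x) \<longleftrightarrow> ((\<lambda>s. 0) has_real_derivative 0) (at x)"
      by (intro DERIV_cong_ev) auto
    then show ?thesis using 1 by (simp add: flat_def)
  next
    case 2
    then have "\<forall>\<^sub>F s in nhds x. flat q s = poly q (1 / s) * exp (- (1 / s))"
      using eventually_nhds_in_open[of "{0<..}" x] by (auto simp: flat_def elim!: eventually_mono)
    then have "(flat q has_real_derivative flat ([:0, 0, 1:] * (q - pderiv q)) x) (at x) \<longleftrightarrow>
       ((\<lambda>s. poly q (1 / s) * exp (- (1 / s))) has_real_derivative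
          flat ([:0, 0, 1:] * (q - pderiv q)) x) (at x)"
      by (intro DERIV_cong_ev) auto
    moreover have "((\<lambda>s. poly q (1 / s)) has_real_derivative poly (pderiv q) (1 / x) * (- 1 / x\<^sup>2)) (at x)"
      by (rule DERIV_chain2[OF poly_DERIV]) (use 2 in \<open>auto intro!: derivative_eq_intros simp: power2_eq_square\<close>)
    then have "((\<lambda>s. poly q (1 / s) * exp (- (1 / s))) has_real_derivative
          flat ([:0, 0, 1:] * (q - pderiv q)) x) (at x)"
      using 2 by (auto intro!: derivative_eq_intros simp: flat_def power2_eq_square field_simps)
    ultimately show ?thesis by simp
  next
    case 3
    \<comment> \<open>The difference quotient at 0 is \<open>y q(y) / exp(y)\<close> with
      \<open>y = 1 / h\<close>; the extra factor \<open>y\<close> is the reason for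
      \<open>pCons 0 q\<close>.\<close>
    have "((\<lambda>h. flat q h / h) \<longlongrightarrow> 0) (at_right 0)"
    proof (rule Lim_transform_eventually)
      show "((\<lambda>h. poly (pCons 0 q) (inverse h) / exp (inverse h)) \<longlongrightarrow> 0) (at_right 0)"
        by (rule filterlim_compose[OF poly_div_exp_tendsto_0 filterlim_inverse_at_top_right])
      have "\<forall>\<^sub>F h :: real in at_right 0. h > 0" by (simp add: eventually_at_right_less)
      then show "\<forall>\<^sub>F h in at_right 0. poly (pCons 0 q) (inverse h) / exp (inverse h) = flat q h / h"
        by eventually_elim (auto simp: flat_def exp_minus field_simps)
    qed
    moreover have "((\<lambda>h. flat q h / h) \<longlongrightarrow> 0) (at_left 0)"
    proof (rule Lim_transform_eventually[OF tendsto_const])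
      have "\<forall>\<^sub>F h :: real in at_left 0. h < 0" by (simp add: eventually_at_left_field) (metis less_add_one minus_add_cancel neg_less_0_iff_less zero_less_one)
      then show "\<forall>\<^sub>F h in at_left 0. 0 = flat q h / h"
        by eventually_elim (auto simp: flat_def)
    qed
    ultimately have "((\<lambda>h. flat q h / h) \<longlongrightarrow> 0) (at 0)" by (rule filterlim_split_at[rotated])
    then show ?thesis using 3 by (simp add: DERIV_def flat_def[of _ 0])
  qed
qed

lemma Ck_flat: "Ck k (flat q)"
proof (induction k arbitrary: q)
  case (Suc k)
  show ?case unfolding Ck.simps using flat_DERIV Suc by blast
qed auto

definition bump :: "real \<Rightarrow> real \<Rightarrow> real \<Rightarrow> real" where
  "bump c d t = flat 1 (t - c) * flat 1 (d - t)"

lemma smooth_bump: "smooth (bump c d)"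
proof -
  have "smooth (flat 1)" by (simp add: smooth_Ck Ck_flat)
  then have "smooth (\<lambda>t. flat 1 (1 * t + - c) * flat 1 ((-1) * t + d))"
    by (intro smooth_mult smooth_affine)
  then show ?thesis by (simp add: bump_def[abs_def])
qed

lemma flat_1_bounds: "0 \<le> flat 1 t" "flat 1 t \<le> 1" "t > 0 \<Longrightarrow> 0 < flat 1 t"
  by (auto simp: flat_def)

lemma bump_bounds:
  "0 \<le> bump c d t" "bump c d t \<le> 1" "t \<in> {c<..<d} \<Longrightarrow> 0 < bump c d t"
  "t \<notin> {c<..<d} \<Longrightarrow> bump c d t = 0"
  unfolding bump_def using flat_1_bounds by (auto intro: mult_le_one simp: flat_def)

section \<open>Test functions: closure properties and approximation of indicators\<close>

lemma test_fun_iff: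
  "\<phi> \<in> test_fun a b \<longleftrightarrow> smooth \<phi> \<and> (\<exists>K. compact K \<and> K \<subseteq> {a<..<b} \<and> (\<forall>x. x \<notin> K \<longrightarrow> \<phi> x = 0))"
  by (simp add: test_fun_def smooth_def)

lemma test_fun_add: "\<phi> \<in> test_fun a b \<Longrightarrow> \<psi> \<in> test_fun a b \<Longrightarrow> (\<lambda>x. \<phi> x + \<psi> x) \<in> test_fun a b"
  unfolding test_fun_iff
proof (elim conjE exE, intro conjI)
  fix K L assume "compact K" "K \<subseteq> {a<..<b}" "\<forall>x. x \<notin> K \<longrightarrow> \<phi> x = 0"
    "compact L" "L \<subseteq> {a<..<b}" "\<forall>x. x \<notin> L \<longrightarrow> \<psi> x = 0"
  then show "\<exists>K. compact K \<and> K \<subseteq> {a<..<b} \<and> (\<forall>x. x \<notin> K \<longrightarrow> \<phi> x + \<psi> x = 0)"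
    by (intro exI[of _ "K \<union> L"]) auto
qed (auto intro: smooth_add)

lemma test_fun_mult: "\<phi> \<in> test_fun a b \<Longrightarrow> smooth g \<Longrightarrow> (\<lambda>x. g x * \<phi> x) \<in> test_fun a b"
  unfolding test_fun_iff by (auto intro: smooth_mult)

lemma test_fun_cmult: "\<phi> \<in> test_fun a b \<Longrightarrow> (\<lambda>x. k * \<phi> x) \<in> test_fun a b"
  by (intro test_fun_mult smooth_const)

lemma test_fun_0: "(\<lambda>x. 0) \<in> test_fun a b"
  unfolding test_fun_iff by (auto intro: smooth_const exI[of _ "{}"])

lemma test_fun_diff: "\<phi> \<in> test_fun a b \<Longrightarrow> \<psi> \<in> test_fun a b \<Longrightarrow> (\<lambda>x. \<phi> x - \<psi> x) \<in> test_fun a b"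
  using test_fun_add[OF _ test_fun_cmult[of \<psi> a b "-1"]] by simp

lemma test_fun_sum: "(\<And>i. i \<in> I \<Longrightarrow> \<phi> i \<in> test_fun a b) \<Longrightarrow> (\<lambda>x. \<Sum>i\<in>I. \<phi> i x) \<in> test_fun a b"
  by (induction I rule: infinite_finite_induct) (auto intro: test_fun_add test_fun_0)

lemma test_fun_deriv:
  assumes "\<phi> \<in> test_fun a b"
  shows "deriv \<phi> \<in> test_fun a b"
proof -
  obtain K where K: "compact K" "K \<subseteq> {a<..<b}" "\<forall>x. x \<notin> K \<longrightarrow> \<phi> x = 0" "smooth \<phi>"
    using assms unfolding test_fun_iff by blast
  have "deriv \<phi> x = 0" if "x \<notin> K" for x
  proof -
    have "open (- K)" using K(1) by (simp add: compact_imp_closed open_Compl)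
    then have "\<forall>\<^sub>F s in nhds x. \<phi> s = 0"
      using eventually_nhds_in_open[of "- K" x] that K(3) by (auto elim!: eventually_mono)
    then have "(\<phi> has_real_derivative 0) (at x) \<longleftrightarrow> ((\<lambda>s. 0) has_real_derivative 0) (at x)"
      by (intro DERIV_cong_ev) auto
    then show ?thesis by (auto intro: DERIV_imp_deriv)
  qed
  then show ?thesis using K smooth_deriv unfolding test_fun_iff by blast
qed

lemma test_fun_higher_deriv: "\<phi> \<in> test_fun a b \<Longrightarrow> (deriv ^^ k) \<phi> \<in> test_fun a b"
  by (induction k) (auto intro: test_fun_deriv)

lemma test_fun_zero: "\<phi> \<in> test_fun a b \<Longrightarrow> t \<notin> {a<..<b} \<Longrightarrow> \<phi> t = 0"
  unfolding test_fun_iff by auto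

lemma test_fun_DERIV: "\<phi> \<in> test_fun a b \<Longrightarrow> (\<phi> has_real_derivative deriv \<phi> x) (at x)"
  unfolding test_fun_iff by (blast intro: smooth_DERIV)

lemma test_fun_continuous: "\<phi> \<in> test_fun a b \<Longrightarrow> continuous_on S \<phi>"
  using test_fun_DERIV by (meson DERIV_isCont continuous_at_imp_continuous_on)

lemma pc_test_fun: "\<phi> \<in> test_fun a b \<Longrightarrow> pc c d \<phi>"
  by (intro pc_continuous test_fun_continuous)

lemma J_deriv_test_fun:
  assumes "\<phi> \<in> test_fun a b" "t \<in> {a..b}"
  shows "J a (deriv \<phi>) t = \<phi> t"
proof -
  have "(deriv \<phi> has_integral (\<phi> t - \<phi> a)) {a..t}"
    using assms(2) has_field_derivative_at_within[OF test_fun_DERIV[OF assms(1)]]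
    by (intro fundamental_theorem_of_calculus)
       (auto simp: has_real_derivative_iff_has_vector_derivative)
  then show ?thesis using test_fun_zero[OF assms(1), of a] by (simp add: J_def integral_unique)
qed

lemma Jn_deriv_test_fun:
  assumes "\<phi> \<in> test_fun a b" "t \<in> {a..b}"
  shows "Jn a k ((deriv ^^ (k + i)) \<phi>) t = (deriv ^^ i) \<phi> t"
  using assms(2)
proof (induction k arbitrary: t)
  case (Suc k)
  have "Jn a (Suc k) ((deriv ^^ (Suc k + i)) \<phi>) t = Jn a k (J a (deriv ((deriv ^^ (k + i)) \<phi>))) t"
    by (simp add: funpow_Suc_right[of _ "J a"] del: funpow.simps) simp
  also have "\<dots> = Jn a k ((deriv ^^ (k + i)) \<phi>) t"
    by (rule Jn_cong[of a b], rule J_deriv_test_fun[where b = b], rule test_fun_higher_deriv[OF assms(1)])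
       (use Suc.prems in auto)
  finally show ?case using Suc by simp
qed auto

text \<open>As \<open>n\<close> grows these functions tend to the indicator of the open interval
  from \<open>c\<close> to \<open>d\<close>, with values between 0 and 1. They take the place of a
  mollified indicator, so no convolution is involved.\<close>

lemma bump_power_test_fun:
  assumes "a < c" "d < b"
  shows "(\<lambda>t. 1 - (1 - bump c d t) ^ n) \<in> test_fun a b"
proof -
  have "smooth (\<lambda>t. 1 + (-1) * (1 + (-1) * bump c d t) ^ n)"
    by (intro smooth_add smooth_mult smooth_const smooth_power smooth_bump)
  moreover have "\<forall>t. t \<notin> {c..d} \<longrightarrow> 1 - (1 - bump c d t) ^ n = 0"
    using bump_bounds(4)[of _ c d] by auto
  ultimately show ?thesis using assms
    unfolding test_fun_iff by (intro conjI exI[of _ "{c..d}"]) auto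
qed

lemma bump_test_fun: "a < c \<Longrightarrow> d < b \<Longrightarrow> bump c d \<in> test_fun a b"
  using bump_power_test_fun[of a c d b 1] by simp

lemma bump_power_bounds:
  "0 \<le> 1 - (1 - bump c d t) ^ n" "1 - (1 - bump c d t) ^ n \<le> 1"
proof -
  have "0 \<le> 1 - bump c d t" "1 - bump c d t \<le> 1" using bump_bounds[of c d t] by auto
  then have "0 \<le> (1 - bump c d t) ^ n" "(1 - bump c d t) ^ n \<le> 1"
    by (simp, intro power_le_one, auto)
  then show "0 \<le> 1 - (1 - bump c d t) ^ n" "1 - (1 - bump c d t) ^ n \<le> 1" by auto
qed

lemma bump_power_tendsto:
  "(\<lambda>n. 1 - (1 - bump c d t) ^ n) \<longlonglongrightarrow> indicator {c<..<d} t"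
proof (cases "t \<in> {c<..<d}")
  case True
  have "(\<lambda>n. 1 - (1 - bump c d t) ^ n) \<longlonglongrightarrow> 1 - 0"
    using bump_bounds(2)[of c d t] bump_bounds(3)[OF True]
    by (intro tendsto_intros LIMSEQ_power_zero) auto
  then show ?thesis using True by simp
next
  case False
  then show ?thesis by (simp add: bump_bounds)
qed

lemma bump_power_integral_tendsto:
  assumes "set_integrable lebesgue {a..b} h"
  shows "(\<lambda>n. LINT t:{a..b}|lebesgue. h t * (1 - (1 - bump c d t) ^ n))
     \<longlonglongrightarrow> (LINT t:{a..b}|lebesgue. h t * indicator {c<..<d} t)"
proof -
  have meas: "(\<lambda>t. 1 - (1 - bump c d t) ^ n) \<in> borel_measurable lebesgue" for n
  proof -
    have "smooth (\<lambda>t. 1 + (-1) * (1 + (-1) * bump c d t) ^ n)"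
      by (intro smooth_add smooth_mult smooth_const smooth_power smooth_bump)
    then have "continuous_on UNIV (\<lambda>t. 1 + (-1) * (1 + (-1) * bump c d t) ^ n)"
      using smooth_DERIV by (meson DERIV_isCont continuous_at_imp_continuous_on)
    then show ?thesis by (auto intro!: borel_measurable_continuous_onI measurable_completion)
  qed
  have h: "integrable lebesgue (\<lambda>t. indicator {a..b} t *\<^sub>R h t)"
    using assms by (simp add: set_integrable_def)
  show ?thesis unfolding set_lebesgue_integral_def
  proof (rule integral_dominated_convergence[where w = "\<lambda>t. norm (indicator {a..b} t *\<^sub>R h t)"])
    show "(\<lambda>t. indicator {a..b} t *\<^sub>R (h t * indicator {c<..<d} t)) \<in> borel_measurable lebesgue"
      using borel_measurable_times[OF borel_measurable_integrable[OF h]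
          borel_measurable_indicator[of "{c<..<d}"]]
      by (simp add: mult.assoc)
    show "(\<lambda>t. indicator {a..b} t *\<^sub>R (h t * (1 - (1 - bump c d t) ^ n))) \<in> borel_measurable lebesgue" for n
      using borel_measurable_integrable[OF h] meas[of n]
        borel_measurable_times[of "\<lambda>t. indicator {a..b} t *\<^sub>R h t" lebesgue "\<lambda>t. 1 - (1 - bump c d t) ^ n"]
      by (simp add: mult.assoc)
    show "integrable lebesgue (\<lambda>t. norm (indicator {a..b} t *\<^sub>R h t))"
      using h by (rule integrable_norm)
    show "AE t in lebesgue. (\<lambda>n. indicator {a..b} t *\<^sub>R (h t * (1 - (1 - bump c d t) ^ n)))
        \<longlonglongrightarrow> indicator {a..b} t *\<^sub>R (h t * indicator {c<..<d} t)"
      by (intro AE_I2 tendsto_intros bump_power_tendsto)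
    show "AE t in lebesgue. norm (indicator {a..b} t *\<^sub>R (h t * (1 - (1 - bump c d t) ^ n)))
        \<le> norm (indicator {a..b} t *\<^sub>R h t)" for n
    proof (rule AE_I2)
      fix t
      have "\<bar>h t\<bar> * \<bar>1 - (1 - bump c d t) ^ n\<bar> \<le> \<bar>h t\<bar> * 1"
        using bump_power_bounds[where c = c and d = d and t = t and n = n] by (intro mult_left_mono) auto
      then show "norm (indicator {a..b} t *\<^sub>R (h t * (1 - (1 - bump c d t) ^ n)))
        \<le> norm (indicator {a..b} t *\<^sub>R h t)"
        by (auto simp: indicator_def abs_mult)
    qed
  qed
qed

subsection \<open>The fundamental lemma of the calculus of variations\<close>

text \<open>The positive and the negative part of \<open>H\<close> are densities of two measures
  that are finite and equal on all right half-lines; hence the measures coincide, and so do the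
  densities almost everywhere. The embedding \<open>ennreal\<close> cuts off negative values, so it
  yields these parts directly.\<close>

lemma AE_zero_of_vanishing_primitive:
  fixes H :: "real \<Rightarrow> real"
  assumes H: "integrable lborel H" and zero: "\<And>x. (LINT y:{x<..}|lborel. H y) = 0"
  shows "AE x in lborel. H x = 0"
proof -
  have meas[measurable]: "H \<in> borel_measurable borel" using H by auto
  let ?M = "density lborel (\<lambda>x. ennreal (H x))" and ?N = "density lborel (\<lambda>x. ennreal (- H x))"
  have *: "emeasure ?M {x<..} = emeasure ?N {x<..} \<and> emeasure ?M {x<..} < \<infinity>" for x
  proof -
    let ?f = "\<lambda>y. indicator {x<..} y *\<^sub>R H y"
    have f: "integrable lborel ?f" using H by (intro integrable_mult_indicator) auto
    have M: "emeasure ?M {x<..} = (\<integral>\<^sup>+y. ennreal (?f y) \<partial>lborel)"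
      by (auto simp: emeasure_density indicator_def intro!: nn_integral_cong)
    have N: "emeasure ?N {x<..} = (\<integral>\<^sup>+y. ennreal (- ?f y) \<partial>lborel)"
      by (auto simp: emeasure_density indicator_def intro!: nn_integral_cong)
    have fin: "(\<integral>\<^sup>+y. ennreal (?f y) \<partial>lborel) \<noteq> \<infinity>" "(\<integral>\<^sup>+y. ennreal (- ?f y) \<partial>lborel) \<noteq> \<infinity>"
      using f unfolding real_integrable_def by auto
    have "integral\<^sup>L lborel ?f = 0" using zero[of x] by (simp add: set_lebesgue_integral_def)
    then have "enn2real (\<integral>\<^sup>+y. ennreal (?f y) \<partial>lborel) = enn2real (\<integral>\<^sup>+y. ennreal (- ?f y) \<partial>lborel)"
      using real_lebesgue_integral_def[OF f] by simp
    moreover have "A = B" if "enn2real A = enn2real B" "A \<noteq> \<infinity>" "B \<noteq> \<infinity>" for A B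
      using that by (cases A; cases B) auto
    ultimately have "emeasure ?M {x<..} = emeasure ?N {x<..}"
      unfolding M N using fin by blast
    then show ?thesis using fin(1) M by (simp add: less_top)
  qed
  have "?M = ?N" 
    by (rule measure_eqI_lessThan[OF _ _ *[THEN conjunct2] *[THEN conjunct1]]) auto
  then have "AE x in lborel. ennreal (H x) = ennreal (- H x)"
    by (intro sigma_finite_measure.density_unique[OF sigma_finite_lborel]) auto
  then show ?thesis
  proof eventually_elim
    case (elim x)
    then show ?case by (cases "H x \<ge> 0") (auto simp: ennreal_neg ennreal_eq_0_iff)
  qed
qed

text \<open>Testing with powers of bump functions shows that the integral of \<open>h\<close> over
  every compact subinterval of the open interval vanishes. So the primitive is constant in the
  interior, by continuity constant up to the end points, and therefore 0.\<close>

lemma fundamental_lemma: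
  assumes "a < b" and h: "set_integrable lebesgue {a..b} h"
    and zero: "\<And>\<phi>. \<phi> \<in> test_fun a b \<Longrightarrow> (LINT t:{a..b}|lebesgue. h t * \<phi> t) = 0"
  shows "AE t in lebesgue. t \<in> {a..b} \<longrightarrow> h t = 0"
proof -
  have int: "h integrable_on {a..b}" using h by (rule set_lebesgue_integral_eq_integral)
  have inner: "integral {c..d} h = 0" if cd: "a < c" "d < b" for c d
  proof -
    have sub: "{c<..<d} \<subseteq> {a..b}" using cd by auto
    have "(\<lambda>n. 0) \<longlonglongrightarrow> (LINT t:{a..b}|lebesgue. h t * indicator {c<..<d} t)"
      using bump_power_integral_tendsto[OF h, of c d] zero[OF bump_power_test_fun[OF cd]] by simp
    then have "(LINT t:{a..b}|lebesgue. h t * indicator {c<..<d} t) = 0"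
      by (simp add: LIMSEQ_const_iff)
    moreover have "(LINT t:{a..b}|lebesgue. h t * indicator {c<..<d} t) = (LINT t:{c<..<d}|lebesgue. h t)"
      unfolding set_lebesgue_integral_def using sub
      by (intro Bochner_Integration.integral_cong) (auto simp: indicator_def)
    moreover have "set_integrable lebesgue {c<..<d} h"
      using h by (rule set_integrable_subset) (use sub in auto)
    ultimately show ?thesis
      by (simp add: set_lebesgue_integral_eq_integral integral_open_interval_real)
  qed
  define F where "F t = integral {a..t} h" for t
  have cont: "continuous_on {a..b} F"
    unfolding F_def[abs_def] using int by (rule indefinite_integral_continuous_1)
  define k where "k = F ((a + b) / 2)"
  have const: "F t = k" if "t \<in> {a<..<b}" for t
  proof -
    have comb: "integral {a..s} h + integral {s..r} h = integral {a..r} h" if "s \<le> r" "a \<le> s" "r \<le> b" for s r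
      using that int
      by (intro Henstock_Kurzweil_Integration.integral_combine) (auto intro: integrable_subinterval_real)
    define c where "c = (a + b) / 2"
    have c: "a < c" "c < b" using \<open>a < b\<close> by (auto simp: c_def)
    show ?thesis
    proof (cases "t \<le> c")
      case True
      then have "integral {t..c} h = 0" "integral {a..t} h + integral {t..c} h = integral {a..c} h"
        using that c by (auto intro!: comb inner)
      then show ?thesis by (simp add: F_def k_def c_def)
    next
      case False
      then have "integral {c..t} h = 0" "integral {a..c} h + integral {c..t} h = integral {a..t} h"
        using that c by (auto intro!: comb inner)
      then show ?thesis by (simp add: F_def k_def c_def)
    qed
  qed
  have "closure {a<..<b} = {a..b}" using \<open>a < b\<close> by simp
  then have const': "F t = k" if "t \<in> {a..b}" for t
    using cont const by (intro continuous_constant_on_closure[of "{a<..<b}" F k t]) (use that \<open>closure {a<..<b} = {a..b}\<close> in simp_all)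
  have "F a = 0" by (simp add: F_def)
  then have F0: "F t = 0" if "t \<in> {a..b}" for t
    using const'[of a] const'[OF that] \<open>a < b\<close> by simp
  \<comment> \<open>The comparison of measures on half-lines needs a Borel function, so
    \<open>h\<close>, extended by 0, is replaced by a Borel version \<open>H\<close>.\<close>
  let ?g = "\<lambda>t. indicator {a..b} t *\<^sub>R h t"
  have g: "integrable lebesgue ?g" using h by (simp add: set_integrable_def)
  then obtain H where H: "H \<in> borel_measurable lborel" "AE t in lborel. ?g t = H t"
    using completion_ex_borel_measurable_real by blast
  have H': "AE t in lebesgue. ?g t = H t" using H(2) by (rule AE_completion)
  have "integrable lebesgue H"
    by (rule integrable_cong_AE[THEN iffD1, OF borel_measurable_integrable[OF g]
          measurable_completion[OF H(1)] H' g])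
  then have Hint: "integrable lborel H" using H(1) by (simp add: integrable_completion)
  have "(LINT y:{x<..}|lborel. H y) = 0" for x
  proof -
    have "(LINT y:{x<..}|lborel. H y) = (LINT y|lebesgue. indicator {x<..} y *\<^sub>R H y)"
      unfolding set_lebesgue_integral_def using H(1) by (intro integral_completion[symmetric]) auto
    also have "\<dots> = (LINT y|lebesgue. indicator {x<..} y *\<^sub>R ?g y)"
    proof (rule integral_cong_AE)
      show "(\<lambda>y. indicator {x<..} y *\<^sub>R H y) \<in> borel_measurable lebesgue"
        using H(1) by (intro measurable_completion) auto
      show "(\<lambda>y. indicator {x<..} y *\<^sub>R ?g y) \<in> borel_measurable lebesgue"
        by (intro borel_measurable_scaleR[OF _ borel_measurable_integrable[OF g]]
            borel_measurable_indicator) auto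
      show "AE y in lebesgue. indicator {x<..} y *\<^sub>R H y = indicator {x<..} y *\<^sub>R ?g y"
        using H' by eventually_elim auto
    qed
    also have "\<dots> = (LINT y:{a..b} \<inter> {x<..}|lebesgue. h y)"
      unfolding set_lebesgue_integral_def
      by (intro Bochner_Integration.integral_cong) (auto simp: indicator_def)
    also have "\<dots> = integral ({a..b} \<inter> {x<..}) h"
      using h by (intro set_lebesgue_integral_eq_integral set_integrable_subset[OF h]) auto
    also have "\<dots> = 0"
    proof -
      consider "x < a" | "x \<ge> b" | "a \<le> x" "x < b" by linarith
      then show ?thesis
      proof cases
        case 1
        then have "{a..b} \<inter> {x<..} = {a..b}" by auto
        then show ?thesis using F0[of b] \<open>a < b\<close> by (simp add: F_def)
      next
        case 2
        then have "{a..b} \<inter> {x<..} = {}" by auto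
        then show ?thesis by simp
      next
        case 3
        then have "{a..b} \<inter> {x<..} = {x<..b}" by auto
        moreover have "integral {x<..b} h = integral {x..b} h"
          by (rule integral_subset_negligible[where S = "{x<..b}" and T = "{x..b}"])
             (use 3 in \<open>auto intro: negligible_subset[of "{x}"]\<close>)
        moreover have "integral {a..x} h + integral {x..b} h = integral {a..b} h"
          using 3 int by (intro Henstock_Kurzweil_Integration.integral_combine) auto
        ultimately show ?thesis using F0[of b] F0[of x] 3 by (simp add: F_def)
      qed
    qed
    finally show ?thesis .
  qed
  then have "AE t in lborel. H t = 0" by (rule AE_zero_of_vanishing_primitive[OF Hint])
  then have "AE t in lebesgue. H t = 0" by (rule AE_completion)
  with H' show ?thesis by eventually_elim auto
qed

lemma continuous_zero_of_AE_zero: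
  fixes g :: "real \<Rightarrow> real"
  assumes "a < b" "continuous_on {a..b} g" "AE t in lebesgue. t \<in> {a..b} \<longrightarrow> g t = 0" "t \<in> {a..b}"
  shows "g t = 0"
proof -
  have "pc a b g" using assms(2) by (rule pc_continuous)
  then have p: "pc a b (\<lambda>t. (g t)\<^sup>2)" by (rule pc_power2)
  have "(LINT t:{a..b}|lebesgue. (g t)\<^sup>2) = 0"
    unfolding set_lebesgue_integral_def
    by (rule integral_eq_zero_AE) (use assms(3) in \<open>auto elim!: eventually_mono simp: indicator_def split: if_splits\<close>)
  then have "integral {a..b} (\<lambda>t. (g t)\<^sup>2) = 0" using pc_lint[OF p] by simp
  then have "(g t)\<^sup>2 = 0"
    using integral_eq_0_iff[OF continuous_on_power[OF assms(2), of 2] assms(1)] assms(4) by auto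
  then show ?thesis by simp
qed

section \<open>Finite-dimensional duality\<close>

text \<open>
  This is the source of all constants that depend only on polynomial degrees: norm equivalences on
  spaces of polynomials and dual bases both follow from it. The term \<open>lin v r w\<close> stands for \<open>v + r w\<close>.
\<close>

lemma functional_in_span:
  fixes L :: "'i \<Rightarrow> 'v \<Rightarrow> real" and f :: "'v \<Rightarrow> real" and lin :: "'v \<Rightarrow> real \<Rightarrow> 'v \<Rightarrow> 'v"
  assumes "finite I"
    and S: "\<And>v r w. v \<in> S \<Longrightarrow> w \<in> S \<Longrightarrow> lin v r w \<in> S"
    and L: "\<And>i v r w. i \<in> I \<Longrightarrow> v \<in> S \<Longrightarrow> w \<in> S \<Longrightarrow> L i (lin v r w) = L i v + r * L i w"
    and f: "\<And>v r w. v \<in> S \<Longrightarrow> w \<in> S \<Longrightarrow> f (lin v r w) = f v + r * f w"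
    and ker: "\<And>v. v \<in> S \<Longrightarrow> (\<And>i. i \<in> I \<Longrightarrow> L i v = 0) \<Longrightarrow> f v = 0"
  shows "\<exists>k. \<forall>v\<in>S. f v = (\<Sum>i\<in>I. k i * L i v)"
  using assms
proof (induction I arbitrary: S)
  case (insert i I)
  let ?S = "{v \<in> S. L i v = 0}"
  have "\<exists>k. \<forall>v\<in>?S. f v = (\<Sum>j\<in>I. k j * L j v)"
  proof (rule insert.IH)
    show "f v = 0" if "v \<in> ?S" "\<And>j. j \<in> I \<Longrightarrow> L j v = 0" for v
      using insert.prems(4)[of v] that by auto
  qed (use insert.prems in auto)
  then obtain k where k: "\<And>v. v \<in> S \<Longrightarrow> L i v = 0 \<Longrightarrow> f v = (\<Sum>j\<in>I. k j * L j v)" by auto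
  define g where "g v = f v - (\<Sum>j\<in>I. k j * L j v)" for v
  show ?case
  proof (cases "\<exists>w\<in>S. L i w \<noteq> 0")
    case False
    then show ?thesis using k insert.hyps by (intro exI[of _ k]) auto
  next
    case True
    then obtain w where w: "w \<in> S" "L i w \<noteq> 0" by blast
    have "f v = (\<Sum>j\<in>insert i I. (k(i := g w / L i w)) j * L j v)" if v: "v \<in> S" for v
    proof -
      \<comment> \<open>Adding this multiple of \<open>w\<close> moves \<open>v\<close> into the
        kernel of \<open>L i\<close>, where the induction hypothesis holds; the defect
        \<open>g w\<close> along \<open>w\<close> then fixes the coefficient of
        \<open>L i\<close>.\<close>
      let ?r = "- (L i v / L i w)"
      have "L i (lin v ?r w) = 0" using insert.prems(2)[of i v w ?r] v w by simp
      then have "f (lin v ?r w) = (\<Sum>j\<in>I. k j * L j (lin v ?r w))"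
        using insert.prems(1) v w k by blast
      moreover have "(\<Sum>j\<in>I. k j * L j (lin v ?r w)) = (\<Sum>j\<in>I. k j * L j v) + ?r * (\<Sum>j\<in>I. k j * L j w)"
        using insert.prems(2) v w by (simp add: sum.distrib sum_distrib_left sum_subtractf sum_negf algebra_simps)
      moreover have "f (lin v ?r w) = f v + ?r * f w" using insert.prems(3) v w by blast
      ultimately have "f v = (\<Sum>j\<in>I. k j * L j v) + (L i v / L i w) * g w"
        by (simp add: g_def algebra_simps)
      moreover have "(\<Sum>j\<in>I. (k(i := g w / L i w)) j * L j v) = (\<Sum>j\<in>I. k j * L j v)"
        using insert.hyps by (intro sum.cong) auto
      ultimately show ?thesis using insert.hyps by (simp add: mult.commute)
    qed
    then show ?thesis by blast
  qed
qed auto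

lemma poly_eq_sum_coeff:
  assumes "degree (q :: real poly) \<le> n"
  shows "poly q t = (\<Sum>j\<le>n. coeff q j * t ^ j)"
proof -
  have "(\<Sum>j\<le>degree q. coeff q j * t ^ j) = (\<Sum>j\<le>n. coeff q j * t ^ j)"
    using assms by (intro sum.mono_neutral_left) (auto simp: coeff_eq_0)
  then show ?thesis by (simp add: poly_altdef)
qed

lemma degree_sum_monom: "degree (\<Sum>j\<le>n. monom (k j) j :: real poly) \<le> n"
  by (intro degree_sum_le) (auto intro: order_trans[OF degree_monom_le])

lemma poly_eq_0_on_interval:
  fixes q :: "real poly"
  assumes "c < d" "\<And>t. t \<in> {c<..<d} \<Longrightarrow> poly q t = 0"
  shows "q = 0"
proof (rule ccontr)
  assume "q \<noteq> 0"
  then have "finite {t. poly q t = 0}" by (rule poly_roots_finite)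
  then have "finite {c<..<d}" by (rule finite_subset[rotated]) (use assms in auto)
  then show False using assms(1) by (simp add: infinite_Ioo)
qed

lemma integral_zero_continuous:
  fixes a b :: real and g :: "real \<Rightarrow> real"
  assumes "a < b" "continuous_on {a..b} g" "\<And>t. t \<in> {a..b} \<Longrightarrow> g t \<ge> 0" "integral {a..b} g = 0"
    "t \<in> {a..b}"
  shows "g t = 0"
  using integral_eq_0_iff[OF assms(2,1,3)] assms(4,5) by blast

text \<open>If the moment of index \<open>j\<close> were a combination of the others on polynomials
  of degree at most \<open>m\<close>, the coefficients of this relation would form a polynomial
  orthogonal, with weight \<omega>, to all of them and so to itself, although its coefficient of
  index \<open>j\<close> is nonzero. The weight is 1 for polynomial projections and a bump function
  for dual bases of test functions.\<close>

lemma dual_polys: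
  assumes "a < b" "continuous_on {a..b} \<omega>" "\<And>t. t \<in> {a..b} \<Longrightarrow> \<omega> t \<ge> 0"
    "a \<le> c" "c < d" "d \<le> b" "\<And>t. t \<in> {c<..<d} \<Longrightarrow> \<omega> t > 0"
  obtains \<eta> :: "nat \<Rightarrow> real poly" where "\<And>j. degree (\<eta> j) \<le> m"
    "\<And>i j. i \<le> m \<Longrightarrow> j \<le> m \<Longrightarrow>
       integral {a..b} (\<lambda>t. \<omega> t * poly (\<eta> j) t * t ^ i) = (if i = j then 1 else 0)"
proof -
  define L where "L i q = integral {a..b} (\<lambda>t. \<omega> t * poly q t * t ^ i)" for i q
  have pc: "pc a b (\<lambda>t. \<omega> t * poly q t * t ^ i)" for q i
    using assms(2) by (intro pc_continuous continuous_intros)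
  have lin: "L i (v + smult r w) = L i v + r * L i w" for i v r w
  proof -
    have "(\<lambda>t. \<omega> t * poly (v + smult r w) t * t ^ i)
        = (\<lambda>t. \<omega> t * poly v t * t ^ i + r * (\<omega> t * poly w t * t ^ i))"
      by (auto simp: algebra_simps)
    then show ?thesis
      unfolding L_def using pc by (simp add: integral_add pc_integrable pc_cmult integral_mult_right)
  qed
  have "\<exists>q. degree q \<le> m \<and> (\<forall>i\<le>m. L i q = (if i = j then 1 else 0))" if j: "j \<le> m" for j
  proof -
    let ?S = "{q :: real poly. degree q \<le> m}"
    have "\<exists>q\<in>?S. (\<forall>i\<in>{..m} - {j}. L i q = 0) \<and> L j q \<noteq> 0"
    proof (rule ccontr)
      assume *: "\<not> ?thesis"
      have "\<exists>k. \<forall>q\<in>?S. L j q = (\<Sum>i\<in>{..m} - {j}. k i * L i q)"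
      proof (rule functional_in_span[where lin = "\<lambda>v r w. v + smult r w"])
        show "L j q = 0" if "q \<in> ?S" "\<And>i. i \<in> {..m} - {j} \<Longrightarrow> L i q = 0" for q
          using * that by blast
      qed (use lin in \<open>auto intro: degree_add_le order_trans[OF degree_smult_le]\<close>)
      then obtain k where k: "\<And>q. degree q \<le> m \<Longrightarrow> L j q = (\<Sum>i\<in>{..m} - {j}. k i * L i q)" by auto
      \<comment> \<open>The relation is written as one vanishing combination; the entry
        \<open>-1\<close> keeps the polynomial \<open>q\<close> built from it nonzero.\<close>
      define k' where "k' i = (if i = j then -1 else k i)" for i
      define q where "q = (\<Sum>i\<le>m. monom (k' i) i)"
      have degq: "degree q \<le> m" unfolding q_def by (rule degree_sum_monom)
      have "(\<Sum>i\<le>m. k' i * L i q) = - L j q + (\<Sum>i\<in>{..m} - {j}. k i * L i q)"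
        using j by (subst sum.remove[of _ j]) (auto simp: k'_def intro!: sum.cong)
      then have "(\<Sum>i\<le>m. k' i * L i q) = 0" using k[OF degq] by simp
      moreover have "(\<Sum>i\<le>m. k' i * L i q) = integral {a..b} (\<lambda>t. \<Sum>i\<le>m. k' i * (\<omega> t * poly q t * t ^ i))"
        unfolding L_def using pc
        by (subst integral_sum) (auto simp: integral_mult_right intro: pc_integrable[OF pc_cmult[OF pc]])
      moreover have "(\<lambda>t. \<Sum>i\<le>m. k' i * (\<omega> t * poly q t * t ^ i)) = (\<lambda>t. \<omega> t * (poly q t)\<^sup>2)"
      proof
        fix t
        have "poly q t = (\<Sum>i\<le>m. k' i * t ^ i)" by (simp add: q_def poly_sum poly_monom)
        then show "(\<Sum>i\<le>m. k' i * (\<omega> t * poly q t * t ^ i)) = \<omega> t * (poly q t)\<^sup>2"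
          by (simp add: power2_eq_square sum_distrib_left algebra_simps)
      qed
      ultimately have zero: "integral {a..b} (\<lambda>t. \<omega> t * (poly q t)\<^sup>2) = 0" by (simp only:)
      have z: "\<omega> t * (poly q t)\<^sup>2 = 0" if "t \<in> {a..b}" for t
      proof (rule integral_zero_continuous[OF assms(1) _ _ zero that])
        show "continuous_on {a..b} (\<lambda>t. \<omega> t * (poly q t)\<^sup>2)"
          by (intro continuous_intros assms(2))
        show "\<omega> s * (poly q s)\<^sup>2 \<ge> 0" if "s \<in> {a..b}" for s using assms(3)[OF that] by simp
      qed
      have "poly q t = 0" if "t \<in> {c<..<d}" for t
      proof -
        have "t \<in> {a..b}" using that assms(4-6) by auto
        then show ?thesis using z[of t] assms(7)[OF that] by simp
      qed
      then have "q = 0" using assms(5) by (rule poly_eq_0_on_interval[rotated])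
      moreover have "coeff q j = -1" using j
        by (simp add: q_def coeff_sum k'_def if_distrib[of "\<lambda>x. coeff x j"] sum.delta coeff_monom)
      ultimately show False by simp
    qed
    then obtain q where q: "degree q \<le> m" "\<forall>i\<in>{..m} - {j}. L i q = 0" "L j q \<noteq> 0" by auto
    have "L i (smult (1 / L j q) q) = (1 / L j q) * L i q" for i
      using lin[of i 0 "1 / L j q" q] by (simp add: L_def)
    then show ?thesis using q by (intro exI[of _ "smult (1 / L j q) q"]) auto
  qed
  then obtain \<eta> where "\<forall>j\<le>m. degree (\<eta> j) \<le> m \<and> (\<forall>i\<le>m. L i (\<eta> j) = (if i = j then 1 else 0))"
    by metis
  then show thesis by (intro that[of "\<lambda>j. if j \<le> m then \<eta> j else 0"]) (auto simp: L_def)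
qed

lemma pderiv_sum_poly: "pderiv (\<Sum>i\<in>I. f i) = (\<Sum>i\<in>I. pderiv (f i))"
  by (induction I rule: infinite_finite_induct) (auto simp: pderiv_add)

lemma poly_antiderivative:
  fixes q :: "real poly"
  obtains Q where "pderiv Q = q" "degree Q \<le> Suc (degree q)"
proof
  let ?Q = "\<Sum>i\<le>degree q. monom (coeff q i / real (Suc i)) (Suc i)"
  have "pderiv ?Q = (\<Sum>i\<le>degree q. monom (coeff q i) i)"
    by (simp add: pderiv_sum_poly pderiv_monom del: of_nat_Suc)
  then show "pderiv ?Q = q" using poly_as_sum_of_monoms[of q] by simp
  show "degree ?Q \<le> Suc (degree q)"
    by (intro degree_sum_le) (auto intro: order_trans[OF degree_monom_le])
qed

subsection \<open>Vanishing end data and orthogonality to polynomials\<close>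

definition orth :: "real \<Rightarrow> real \<Rightarrow> nat \<Rightarrow> (real \<Rightarrow> real) \<Rightarrow> bool" where
  "orth a b m w \<longleftrightarrow> (\<forall>q. degree q \<le> m \<longrightarrow> integral {a..b} (\<lambda>t. poly q t * w t) = 0)"

lemma orth_imp_J_zero: "orth a b m w \<Longrightarrow> J a w b = 0"
  unfolding orth_def by (drule spec[of _ 1]) (simp add: J_def)

text \<open>One integration by parts trades \<open>w\<close> for its primitive and \<open>q\<close>
  for its derivative, and every polynomial of degree at most \<open>m\<close> is the derivative of
  one of degree at most \<open>m + 1\<close>. The boundary conditions at \<open>b\<close> thereby
  become a linear constraint on the highest derivative that can be enforced by correcting
  moments.\<close>

lemma orth_iff_end_data:
  assumes "a \<le> b" "pc a b w"
  shows "orth a b m w \<longleftrightarrow> (\<forall>k. 1 \<le> k \<and> k \<le> Suc m \<longrightarrow> Jn a k w b = 0)"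
  using assms(2)
proof (induction m arbitrary: w)
  case 0
  have "orth a b 0 w \<longleftrightarrow> J a w b = 0"
  proof
    assume "orth a b 0 w"
    then show "J a w b = 0" by (rule orth_imp_J_zero)
  next
    assume w: "J a w b = 0"
    show "orth a b 0 w" unfolding orth_def
    proof (intro allI impI)
      fix q :: "real poly" assume "degree q \<le> 0"
      then obtain r where "q = [:r:]" by (metis degree_eq_zeroE le_zero_eq)
      then show "integral {a..b} (\<lambda>t. poly q t * w t) = 0" using w by (simp add: J_def integral_mult_right)
    qed
  qed
  moreover have "(\<forall>k. 1 \<le> k \<and> k \<le> Suc 0 \<longrightarrow> Jn a k w b = 0) \<longleftrightarrow> J a w b = 0"
    by (auto simp: le_Suc_eq)
  ultimately show ?case by simp
next
  case (Suc m)
  have parts: "integral {a..b} (\<lambda>t. poly q t * w t) = poly q b * J a w b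
      - integral {a..b} (\<lambda>t. poly (pderiv q) t * J a w t)" for q
    by (rule parts_pc[of a b w "poly (pderiv q)" "poly q" "{}"])
       (use assms(1) Suc.prems in \<open>auto intro!: continuous_intros poly_DERIV\<close>)
  have "orth a b (Suc m) w \<longleftrightarrow> J a w b = 0 \<and> orth a b m (J a w)"
  proof safe
    assume o: "orth a b (Suc m) w"
    then show J0: "J a w b = 0" by (rule orth_imp_J_zero)
    show "orth a b m (J a w)" unfolding orth_def
    proof (intro allI impI)
      fix q :: "real poly" assume q: "degree q \<le> m"
      obtain Q where "pderiv Q = q" "degree Q \<le> Suc (degree q)" using poly_antiderivative by blast
      then have "pderiv Q = q" "degree Q \<le> Suc m" using q by auto
      then show "integral {a..b} (\<lambda>t. poly q t * J a w t) = 0"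
        using parts[of Q] J0 o unfolding orth_def by auto
    qed
  next
    assume J0: "J a w b = 0" "orth a b m (J a w)"
    have "integral {a..b} (\<lambda>t. poly q t * w t) = 0" if "degree q \<le> Suc m" for q
    proof -
      have "degree (pderiv q) \<le> m" using that by (simp add: degree_pderiv)
      then show ?thesis using parts[of q] J0 unfolding orth_def by simp
    qed
    then show "orth a b (Suc m) w" unfolding orth_def by blast
  qed
  also have "\<dots> \<longleftrightarrow> J a w b = 0 \<and> (\<forall>k. 1 \<le> k \<and> k \<le> Suc m \<longrightarrow> Jn a (Suc k) w b = 0)"
    using Suc.IH[OF pc_J[OF Suc.prems]] by (simp add: funpow_Suc_right del: funpow.simps)
  also have "\<dots> \<longleftrightarrow> (\<forall>k. 1 \<le> k \<and> k \<le> Suc (Suc m) \<longrightarrow> Jn a k w b = 0)"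
    (is "?A \<longleftrightarrow> ?B")
  proof safe
    fix k assume "J a w b = 0" "\<forall>k. 1 \<le> k \<and> k \<le> Suc m \<longrightarrow> Jn a (Suc k) w b = 0"
      "1 \<le> k" "k \<le> Suc (Suc m)"
    then show "Jn a k w b = 0" by (cases k; cases "k = 1") auto
  next
    assume *: ?B
    show "J a w b = 0" using *[rule_format, of 1] by simp
    show "Jn a (Suc k) w b = 0" if "1 \<le> k" "k \<le> Suc m" for k using *[rule_format, of "Suc k"] that by simp
  qed
  finally show ?case .
qed

lemma orthI_monomials:
  assumes "pc a b w" "\<And>j. j \<le> m \<Longrightarrow> integral {a..b} (\<lambda>t. w t * t ^ j) = 0"
  shows "orth a b m w"
  unfolding orth_def
proof (intro allI impI)
  fix q :: "real poly" assume q: "degree q \<le> m"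
  have pcj: "pc a b (\<lambda>t. w t * t ^ j)" for j
    by (intro pc_mult assms(1) pc_continuous continuous_intros)
  have "integral {a..b} (\<lambda>t. poly q t * w t)
      = integral {a..b} (\<lambda>t. \<Sum>j\<le>m. coeff q j * (w t * t ^ j))"
    by (rule integral_cong) (simp add: poly_eq_sum_coeff[OF q] sum_distrib_left sum_distrib_right mult_ac)
  also have "\<dots> = (\<Sum>j\<le>m. coeff q j * integral {a..b} (\<lambda>t. w t * t ^ j))"
    by (subst integral_sum) (auto simp: integral_mult_right intro!: pc_integrable pc_cmult pcj)
  finally show "integral {a..b} (\<lambda>t. poly q t * w t) = 0" using assms(2) by simp
qed

text \<open>Each \<beta>-function cancels exactly one moment of \<open>D\<close>. With polynomials
  for \<beta> this is a projection; with test functions the correction preserves smoothness and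
  compact support.\<close>

lemma orth_dual_correction:
  assumes "pc a b D" "\<And>j. j \<le> m \<Longrightarrow> pc a b (\<beta> j)"
    "\<And>i j. i \<le> m \<Longrightarrow> j \<le> m \<Longrightarrow> integral {a..b} (\<lambda>t. \<beta> j t * t ^ i) = (if i = j then 1 else 0)"
  shows "orth a b m (\<lambda>t. D t - (\<Sum>j\<le>m. integral {a..b} (\<lambda>t. D t * t ^ j) * \<beta> j t))"
proof (rule orthI_monomials)
  define r where "r j = integral {a..b} (\<lambda>t. D t * t ^ j)" for j
  show "pc a b (\<lambda>t. D t - (\<Sum>j\<le>m. integral {a..b} (\<lambda>t. D t * t ^ j) * \<beta> j t))"
    using assms(1,2) by (intro pc_diff pc_sum pc_cmult) auto
  fix i assume i: "i \<le> m"
  have pow: "pc a b (\<lambda>t. t ^ i)" by (intro pc_continuous continuous_intros)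
  have p1: "pc a b (\<lambda>t. D t * t ^ i)" by (intro pc_mult assms(1) pow)
  have p2: "pc a b (\<lambda>t. r j * (\<beta> j t * t ^ i))" if "j \<le> m" for j
    by (intro pc_cmult pc_mult assms(2) pow that)
  have "integral {a..b} (\<lambda>t. (D t - (\<Sum>j\<le>m. r j * \<beta> j t)) * t ^ i)
      = integral {a..b} (\<lambda>t. D t * t ^ i - (\<Sum>j\<le>m. r j * (\<beta> j t * t ^ i)))"
    by (rule integral_cong) (simp add: algebra_simps sum_distrib_left)
  also have "\<dots> = r i - integral {a..b} (\<lambda>t. \<Sum>j\<le>m. r j * (\<beta> j t * t ^ i))"
    unfolding r_def[of i] using p1 p2 by (intro integral_diff pc_integrable pc_sum) auto
  also have "integral {a..b} (\<lambda>t. \<Sum>j\<le>m. r j * (\<beta> j t * t ^ i))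
      = (\<Sum>j\<le>m. integral {a..b} (\<lambda>t. r j * (\<beta> j t * t ^ i)))"
    using p2 by (intro integral_sum pc_integrable) auto
  also have "\<dots> = (\<Sum>j\<le>m. if j = i then r j else 0)"
    using assms(3)[OF i] by (intro sum.cong) (auto simp: integral_mult_right)
  also have "r i - \<dots> = 0" using i by simp
  finally show "integral {a..b} (\<lambda>t. (D t - (\<Sum>j\<le>m. integral {a..b} (\<lambda>t. D t * t ^ j) * \<beta> j t)) * t ^ i) = 0"
    by (simp add: r_def)
qed

lemma poly_projection:
  assumes "a < b" "pc a b D"
  obtains \<pi> where "degree \<pi> \<le> m" "orth a b m (\<lambda>t. D t - poly \<pi> t)"
proof -
  obtain \<eta> :: "nat \<Rightarrow> real poly" where \<eta>: "\<And>j. degree (\<eta> j) \<le> m" "\<And>i j. i \<le> m \<Longrightarrow> j \<le> m \<Longrightarrow>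
       integral {a..b} (\<lambda>t. 1 * poly (\<eta> j) t * t ^ i) = (if i = j then 1 else 0)"
    using dual_polys[of a b "\<lambda>_. 1" a b m] assms(1) by auto
  show thesis
  proof (rule that)
    let ?\<pi> = "\<Sum>j\<le>m. smult (integral {a..b} (\<lambda>t. D t * t ^ j)) (\<eta> j)"
    show "degree ?\<pi> \<le> m"
      by (intro degree_sum_le) (auto intro: order_trans[OF degree_smult_le] \<eta>)
    show "orth a b m (\<lambda>t. D t - poly ?\<pi> t)"
      using orth_dual_correction[OF assms(2), of m "\<lambda>j. poly (\<eta> j)"] \<eta>(2) by (simp add: poly_sum)
  qed
qed

section \<open>Weak derivatives of iterated integrals\<close>

lemma abs_integrable_pc_mult:
  "pc a b f \<Longrightarrow> g absolutely_integrable_on {a..b} \<Longrightarrow> (\<lambda>t. f t * g t) absolutely_integrable_on {a..b}"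
  by (rule absolutely_integrable_bounded_measurable_product_real[OF pc_measurable])
     (auto simp: pc_def)

lemma abs_integrable_mult_pc:
  "pc a b f \<Longrightarrow> g absolutely_integrable_on {a..b} \<Longrightarrow> (\<lambda>t. g t * f t) absolutely_integrable_on {a..b}"
  using abs_integrable_pc_mult[of a b f g] by (simp add: mult.commute)

lemma lint_cong_AE:
  fixes a b :: real and f g :: "real \<Rightarrow> real"
  assumes "f \<in> borel_measurable (lebesgue_on {a..b})" "g \<in> borel_measurable (lebesgue_on {a..b})"
    "AE t in lebesgue. t \<in> {a..b} \<longrightarrow> f t = g t"
  shows "(LINT t:{a..b}|lebesgue. f t) = (LINT t:{a..b}|lebesgue. g t)"
proof -
  have ind: "(\<lambda>t. indicator {a..b} t *\<^sub>R h t) \<in> borel_measurable lebesgue"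
    if "h \<in> borel_measurable (lebesgue_on {a..b})" for h :: "real \<Rightarrow> real"
    using that borel_measurable_restrict_space_iff[of "{a..b}" lebesgue h] by simp
  show ?thesis unfolding set_lebesgue_integral_def
    by (rule integral_cong_AE[OF ind[OF assms(1)] ind[OF assms(2)]])
       (use assms(3) in \<open>auto elim!: eventually_mono simp: indicator_def\<close>)
qed

lemma weak_deriv_unique:
  assumes "a < b" "is_weak_deriv a b k v g1" "is_weak_deriv a b k v g2"
  shows "AE t in lebesgue. t \<in> {a..b} \<longrightarrow> g1 t = g2 t"
proof -
  have int: "set_integrable lebesgue {a..b} g1" "set_integrable lebesgue {a..b} g2"
    using assms unfolding is_weak_deriv_def by auto
  have "AE t in lebesgue. t \<in> {a..b} \<longrightarrow> g1 t - g2 t = 0"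
  proof (rule fundamental_lemma[OF assms(1) set_integral_diff(1)[OF int]])
    fix \<phi> assume \<phi>: "\<phi> \<in> test_fun a b"
    have "(-1) ^ k * (LINT t:{a..b}|lebesgue. g1 t * \<phi> t) = (-1) ^ k * (LINT t:{a..b}|lebesgue. g2 t * \<phi> t)"
      using assms(2,3) \<phi> unfolding is_weak_deriv_def by fastforce
    then have eq: "(LINT t:{a..b}|lebesgue. g1 t * \<phi> t) = (LINT t:{a..b}|lebesgue. g2 t * \<phi> t)"
      by simp
    have "set_integrable lebesgue {a..b} (\<lambda>t. g1 t * \<phi> t)" "set_integrable lebesgue {a..b} (\<lambda>t. g2 t * \<phi> t)"
      by (intro abs_integrable_mult_pc[OF pc_test_fun[OF \<phi>]] int)+
    then have "(LINT t:{a..b}|lebesgue. g1 t * \<phi> t - g2 t * \<phi> t) = 0"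
      using eq by (subst set_integral_diff(2)) auto
    then show "(LINT t:{a..b}|lebesgue. (g1 t - g2 t) * \<phi> t) = 0" by (simp add: algebra_simps)
  qed
  then show ?thesis by simp
qed

lemma weak_deriv_AE:
  assumes "a < b" "is_weak_deriv a b k v g"
  shows "AE t in lebesgue. t \<in> {a..b} \<longrightarrow> weak_deriv a b k v t = g t"
    and "is_weak_deriv a b k v (weak_deriv a b k v)"
proof -
  show *: "is_weak_deriv a b k v (weak_deriv a b k v)"
    unfolding weak_deriv_def using assms(2) by (rule someI[where P = "is_weak_deriv a b k v"])
  show "AE t in lebesgue. t \<in> {a..b} \<longrightarrow> weak_deriv a b k v t = g t"
    by (rule weak_deriv_unique[OF assms(1) * assms(2)])
qed

lemma is_weak_deriv_measurable:
  "is_weak_deriv a b k v g \<Longrightarrow> g \<in> borel_measurable (lebesgue_on {a..b})"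
  unfolding is_weak_deriv_def by (auto intro: absolutely_integrable_imp_borel_measurable)

lemma is_weak_deriv_add:
  assumes "is_weak_deriv a b k v g" "is_weak_deriv a b k w h"
  shows "is_weak_deriv a b k (\<lambda>t. v t + r * w t) (\<lambda>t. g t + r * h t)"
  unfolding is_weak_deriv_def
proof (intro conjI ballI)
  have int: "set_integrable lebesgue {a..b} v" "set_integrable lebesgue {a..b} w"
    "set_integrable lebesgue {a..b} g" "set_integrable lebesgue {a..b} h"
    using assms unfolding is_weak_deriv_def by auto
  then show "set_integrable lebesgue {a..b} (\<lambda>t. v t + r * w t)"
    "set_integrable lebesgue {a..b} (\<lambda>t. g t + r * h t)"
    by (auto intro!: set_integral_add(1) set_integrable_mult_right)
  fix \<phi> assume \<phi>: "\<phi> \<in> test_fun a b"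
  have sum: "(LINT t:{a..b}|lebesgue. (x t + r * y t) * \<psi> t)
      = (LINT t:{a..b}|lebesgue. x t * \<psi> t) + r * (LINT t:{a..b}|lebesgue. y t * \<psi> t)"
    if "set_integrable lebesgue {a..b} x" "set_integrable lebesgue {a..b} y" "\<psi> \<in> test_fun a b" for x y \<psi>
  proof -
    have i: "set_integrable lebesgue {a..b} (\<lambda>t. x t * \<psi> t)" "set_integrable lebesgue {a..b} (\<lambda>t. y t * \<psi> t)"
      by (intro abs_integrable_mult_pc[OF pc_test_fun[OF that(3)]] that(1,2))+
    have "(LINT t:{a..b}|lebesgue. (x t + r * y t) * \<psi> t) = (LINT t:{a..b}|lebesgue. x t * \<psi> t + r * (y t * \<psi> t))"
      by (simp add: algebra_simps)
    then show ?thesis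
      using set_integral_add(2)[OF i(1) set_integrable_mult_right[OF i(2), of r]] by simp
  qed
  show "(LINT t:{a..b}|lebesgue. (v t + r * w t) * (deriv ^^ k) \<phi> t)
      = (-1) ^ k * (LINT t:{a..b}|lebesgue. (g t + r * h t) * \<phi> t)"
  proof -
    have "(LINT t:{a..b}|lebesgue. v t * (deriv ^^ k) \<phi> t) = (-1) ^ k * (LINT t:{a..b}|lebesgue. g t * \<phi> t)"
      "(LINT t:{a..b}|lebesgue. w t * (deriv ^^ k) \<phi> t) = (-1) ^ k * (LINT t:{a..b}|lebesgue. h t * \<phi> t)"
      using assms \<phi> unfolding is_weak_deriv_def by blast+
    then show ?thesis
      unfolding sum[OF int(1,2) test_fun_higher_deriv[OF \<phi>]] sum[OF int(3,4) \<phi>]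
      by (simp only: distrib_left mult_ac)
  qed
qed

text \<open>A function with vanishing derivatives at \<open>a\<close> is represented by its derivative of order \<open>n\<close>.\<close>

definition rep :: "real \<Rightarrow> real \<Rightarrow> nat \<Rightarrow> (real \<Rightarrow> real) \<Rightarrow> (real \<Rightarrow> real) \<Rightarrow> bool" where
  "rep a b n v g \<longleftrightarrow> pc a b g \<and> (\<forall>t\<in>{a..b}. v t = Jn a n g t)"

lemma rep_Jn: "pc a b g \<Longrightarrow> rep a b n (Jn a n g) g"
  by (simp add: rep_def)

lemma J_lin:
  assumes "pc a b f" "pc a b g" "t \<in> {a..b}"
  shows "J a (\<lambda>s. f s + r * g s) t = J a f t + r * J a g t"
proof -
  have "f integrable_on {a..t}" "(\<lambda>s. r * g s) integrable_on {a..t}"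
    using assms by (auto intro!: pc_integrable_subset pc_cmult)
  then show ?thesis by (simp add: J_def integral_add integral_mult_right)
qed

lemma Jn_lin:
  assumes "pc a b f" "pc a b g" "t \<in> {a..b}"
  shows "Jn a n (\<lambda>s. f s + r * g s) t = Jn a n f t + r * Jn a n g t"
  using assms(3)
proof (induction n arbitrary: t)
  case (Suc n)
  have "Jn a (Suc n) (\<lambda>s. f s + r * g s) t = J a (\<lambda>s. Jn a n f s + r * Jn a n g s) t"
    using Suc by (auto intro!: J_cong)
  also have "\<dots> = Jn a (Suc n) f t + r * Jn a (Suc n) g t"
    using Suc.prems assms by (simp add: J_lin[OF pc_Jn pc_Jn])
  finally show ?case .
qed auto

lemma rep_lin:
  "rep a b n v g \<Longrightarrow> rep a b n w h \<Longrightarrow> rep a b n (\<lambda>t. v t + r * w t) (\<lambda>t. g t + r * h t)"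
  unfolding rep_def using Jn_lin[of a b g h] by (auto intro: pc_add pc_cmult)

lemma rep_diff: "rep a b n v g \<Longrightarrow> rep a b n w h \<Longrightarrow> rep a b n (\<lambda>t. v t - w t) (\<lambda>t. g t - h t)"
  using rep_lin[of a b n v g w h "-1"] by simp

lemma Jn_diff:
  assumes "pc a b f" "pc a b g" "t \<in> {a..b}"
  shows "Jn a n (\<lambda>s. f s - g s) t = Jn a n f t - Jn a n g t"
  using Jn_lin[OF assms, of n "-1"] by simp

lemma rep_test_fun: "\<phi> \<in> test_fun a b \<Longrightarrow> rep a b n \<phi> ((deriv ^^ n) \<phi>)"
  unfolding rep_def using Jn_deriv_test_fun[of \<phi> a b _ n 0]
  by (auto intro: pc_test_fun[OF test_fun_higher_deriv])

text \<open>All primitives of order at most \<open>i\<close> of the \<open>i\<close>-th derivative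
  of a test function vanish at \<open>b\<close>, so integration by parts leaves no boundary term.
  The weak derivatives of a represented function are thus explicit iterated integrals.\<close>

lemma rep_weak:
  assumes "a < b" "rep a b n v g" "i \<le> n"
  shows "is_weak_deriv a b i v (Jn a (n - i) g)"
  unfolding is_weak_deriv_def
proof (intro conjI ballI)
  let ?G = "Jn a (n - i) g"
  have g: "pc a b g" and v: "\<And>t. t \<in> {a..b} \<Longrightarrow> v t = Jn a n g t" using assms unfolding rep_def by auto
  have G: "pc a b ?G" by (rule pc_Jn[OF g])
  have pv: "pc a b v" using v by (rule pc_cong[OF pc_Jn[OF g]])
  show "set_integrable lebesgue {a..b} v" "set_integrable lebesgue {a..b} ?G"
    using pv G by (auto intro: pc_abs_integrable)
  fix \<phi> assume \<phi>: "\<phi> \<in> test_fun a b"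
  let ?w = "(deriv ^^ i) \<phi>"
  have w: "pc a b ?w" "pc a b \<phi>" using \<phi> by (auto intro: pc_test_fun test_fun_higher_deriv)
  have zero: "Jn a k ?w b = 0" if "1 \<le> k" "k \<le> i" for k
    using Jn_deriv_test_fun[OF \<phi>, of b k "i - k"] that assms(1)
      test_fun_zero[OF test_fun_higher_deriv[OF \<phi>], of b] by auto
  have "integral {a..b} (\<lambda>t. v t * ?w t) = integral {a..b} (\<lambda>t. Jn a i ?G t * ?w t)"
  proof (rule integral_cong)
    fix t assume t: "t \<in> {a..b}"
    have "Jn a n g = Jn a i ?G" using assms(3) funpow_add[of i "n - i" "J a"] by simp
    then show "v t * ?w t = Jn a i ?G t * ?w t" using v[OF t] by simp
  qed
  also have "\<dots> = (-1) ^ i * integral {a..b} (\<lambda>t. ?G t * Jn a i ?w t)"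
  proof -
    have "(-1) ^ i * integral {a..b} (\<lambda>t. ?G t * Jn a i ?w t)
        = (-1) ^ i * (-1) ^ i * integral {a..b} (\<lambda>t. Jn a i ?G t * ?w t)"
      using parts_Jn[OF _ G w(1) zero] assms(1) by simp
    then show ?thesis by (simp add: power_mult_distrib[symmetric])
  qed
  also have "integral {a..b} (\<lambda>t. ?G t * Jn a i ?w t) = integral {a..b} (\<lambda>t. ?G t * \<phi> t)"
    using Jn_deriv_test_fun[OF \<phi>, of _ i 0] by (intro integral_cong) auto
  finally show "(LINT t:{a..b}|lebesgue. v t * ?w t) = (-1) ^ i * (LINT t:{a..b}|lebesgue. ?G t * \<phi> t)"
    by (simp add: pc_lint pc_mult pv G w)
qed

lemma rep_weak_deriv:
  assumes "a < b" "rep a b n v g" "i \<le> n"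
  shows "AE t in lebesgue. t \<in> {a..b} \<longrightarrow> weak_deriv a b i v t = Jn a (n - i) g t"
    and "weak_deriv a b i v \<in> borel_measurable (lebesgue_on {a..b})"
  using weak_deriv_AE[OF assms(1) rep_weak[OF assms]] is_weak_deriv_measurable by auto

lemma rep_pc: "rep a b n v g \<Longrightarrow> pc a b g"
  by (simp add: rep_def)

lemma rep_H_norm:
  assumes "a < b" "rep a b n v g"
  shows "H_norm a b n v = sqrt (\<Sum>i\<le>n. (nrm a b (Jn a (n - i) g))\<^sup>2)"
proof -
  note g = rep_pc[OF assms(2)]
  have "(LINT t:{a..b}|lebesgue. (weak_deriv a b i v t)\<^sup>2) = (nrm a b (Jn a (n - i) g))\<^sup>2" if "i \<le> n" for i
  proof -
    note wd = rep_weak_deriv[OF assms that]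
    have "(LINT t:{a..b}|lebesgue. (weak_deriv a b i v t)\<^sup>2) = (LINT t:{a..b}|lebesgue. (Jn a (n - i) g t)\<^sup>2)"
      by (rule lint_cong_AE)
         (use wd pc_measurable[OF pc_power2[OF pc_Jn[OF g]]] in \<open>auto elim!: eventually_mono\<close>)
    then show ?thesis using g by (simp add: pc_lint pc_power2 pc_Jn nrm_square)
  qed
  then show ?thesis by (simp add: H_norm_def)
qed

lemma rep_H_space:
  assumes "a < b" "rep a b n v g"
  shows "v \<in> H_space a b n"
  unfolding H_space_def
proof safe
  fix i assume i: "i \<le> n"
  have "Jn a (n - i) g \<in> L2_fun a b"
    unfolding L2_fun_def using rep_pc[OF assms(2)]
    by (auto intro!: pc_measurable pc_abs_integrable pc_power2 pc_Jn)
  then show "\<exists>g. is_weak_deriv a b i v g \<and> g \<in> L2_fun a b" using rep_weak[OF assms i] by blast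
qed

lemma rep_bilin:
  assumes "a < b" "rep a b (Suc m) v g" "rep a b (Suc m) w h"
    and c: "\<And>k. k \<le> Suc m \<Longrightarrow> continuous_on {a..b} (c k)"
  shows "bilin_form a b m c v w
    = (\<Sum>k\<le>Suc m. integral {a..b} (\<lambda>t. c k t * Jn a (Suc m - k) g t * Jn a (Suc m - k) h t))"
  unfolding bilin_form_def
proof (rule sum.cong)
  fix k assume "k \<in> {..Suc m}"
  then have k: "k \<le> Suc m" by simp
  note g = rep_weak_deriv[OF assms(1,2) k] and h = rep_weak_deriv[OF assms(1,3) k]
  have p: "pc a b (c k)" "pc a b (Jn a (Suc m - k) g)" "pc a b (Jn a (Suc m - k) h)"
    using c[OF k] rep_pc assms by (auto intro: pc_continuous pc_Jn)
  have "(LINT t:{a..b}|lebesgue. c k t * weak_deriv a b k v t * weak_deriv a b k w t)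
      = (LINT t:{a..b}|lebesgue. c k t * Jn a (Suc m - k) g t * Jn a (Suc m - k) h t)"
  proof (rule lint_cong_AE)
    show "(\<lambda>t. c k t * weak_deriv a b k v t * weak_deriv a b k w t) \<in> borel_measurable (lebesgue_on {a..b})"
      using g(2) h(2) pc_measurable[OF p(1)] by (intro borel_measurable_times)
    show "(\<lambda>t. c k t * Jn a (Suc m - k) g t * Jn a (Suc m - k) h t) \<in> borel_measurable (lebesgue_on {a..b})"
      using p by (intro pc_measurable pc_mult)
    show "AE t in lebesgue. t \<in> {a..b} \<longrightarrow> c k t * weak_deriv a b k v t * weak_deriv a b k w t
        = c k t * Jn a (Suc m - k) g t * Jn a (Suc m - k) h t"
      using g(1) h(1) by eventually_elim auto
  qed
  also have "\<dots> = integral {a..b} (\<lambda>t. c k t * Jn a (Suc m - k) g t * Jn a (Suc m - k) h t)"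
    using p by (intro pc_lint pc_mult)
  finally show "(LINT t:{a..b}|lebesgue. c k t * weak_deriv a b k v t * weak_deriv a b k w t) = \<dots>" .
qed simp

lemma nrm_Jn_le:
  assumes "a < b" "pc a b g"
  shows "nrm a b (Jn a k g) \<le> (b - a) ^ k * nrm a b g"
proof (cases k)
  case (Suc n)
  let ?A = "(b - a) ^ n * integral {a..b} (\<lambda>s. \<bar>g s\<bar>)"
  have "nrm a b (Jn a k g) \<le> nrm a b (\<lambda>t. ?A)"
  proof (rule nrm_le_off_finite[of _ _ _ _ "{}"])
    show "\<bar>Jn a k g t\<bar> \<le> ?A" if "t \<in> {a..b} - {}" for t
    proof -
      have "\<bar>Jn a k g t\<bar> \<le> (b - a) ^ n * J a (\<lambda>s. \<bar>g s\<bar>) t"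
        using Jn_abs_le[OF assms(2)] that Suc by simp
      also have "\<dots> \<le> (b - a) ^ n * J a (\<lambda>s. \<bar>g s\<bar>) b"
        using that assms by (intro mult_left_mono J_abs_mono) auto
      finally show ?thesis by (simp add: J_def)
    qed
  qed (use assms pc_Jn in auto)
  also have "\<dots> = ?A * sqrt (b - a)"
    using assms integral_nonneg_pc[OF pc_abs[OF assms(2)]]
    by (simp add: nrm_def real_sqrt_mult abs_mult)
  also have "\<dots> \<le> (b - a) ^ n * (sqrt (b - a) * nrm a b g) * sqrt (b - a)"
    using assms integral_abs_le_nrm[OF assms(2)] by (intro mult_right_mono mult_left_mono) auto
  also have "\<dots> = (b - a) ^ n * (sqrt (b - a) * sqrt (b - a)) * nrm a b g" by (simp only: mult_ac)
  also have "\<dots> = (b - a) ^ k * nrm a b g" using Suc assms(1) by simp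
  finally show ?thesis .
qed simp

definition sobolev_const :: "real \<Rightarrow> real \<Rightarrow> nat \<Rightarrow> real" where
  "sobolev_const a b n = sqrt (\<Sum>i\<le>n. ((b - a) ^ (n - i))\<^sup>2)"

lemma rep_H_norm_le:
  assumes "a < b" "rep a b n v g"
  shows "H_norm a b n v \<le> sobolev_const a b n * nrm a b g"
proof -
  note g = rep_pc[OF assms(2)]
  have "(\<Sum>i\<le>n. (nrm a b (Jn a (n - i) g))\<^sup>2) \<le> (\<Sum>i\<le>n. ((b - a) ^ (n - i) * nrm a b g)\<^sup>2)"
    using nrm_Jn_le[OF assms(1) g] g by (intro sum_mono power_mono) (auto intro: nrm_nonneg[OF pc_Jn])
  also have "\<dots> = (\<Sum>i\<le>n. ((b - a) ^ (n - i))\<^sup>2) * (nrm a b g)\<^sup>2"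
    by (simp add: power_mult_distrib sum_distrib_right)
  finally have "sqrt (\<Sum>i\<le>n. (nrm a b (Jn a (n - i) g))\<^sup>2)
      \<le> sqrt ((\<Sum>i\<le>n. ((b - a) ^ (n - i))\<^sup>2) * (nrm a b g)\<^sup>2)" by (rule real_sqrt_le_mono)
  then show ?thesis
    using g by (simp add: rep_H_norm[OF assms] sobolev_const_def real_sqrt_mult)
qed

lemma sobolev_const_nonneg: "sobolev_const a b n \<ge> 0"
  unfolding sobolev_const_def by (auto intro: sum_nonneg)

text \<open>For represented functions the Sobolev norm is the Euclidean norm of the vector of L2
  norms of iterated integrals, so Minkowski's inequality applies twice. Both differences are then
  bounded by the highest derivative alone.\<close>

lemma H_norm_triangle:
  assumes "a < b" "rep a b n v g" "rep a b n w h"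
  shows "\<bar>H_norm a b n v - H_norm a b n w\<bar> \<le> sobolev_const a b n * nrm a b (\<lambda>t. g t - h t)"
proof -
  have tri: "H_norm a b n v \<le> H_norm a b n w + H_norm a b n (\<lambda>t. v t - w t)"
    if v: "rep a b n v g" and w: "rep a b n w h" for v g w h
  proof -
    note d = rep_diff[OF v w]
    have "H_norm a b n v = L2_set (\<lambda>i. nrm a b (Jn a (n - i) g)) {..n}"
      by (simp add: rep_H_norm[OF assms(1) v] L2_set_def)
    also have "\<dots> \<le> L2_set (\<lambda>i. nrm a b (Jn a (n - i) h) + nrm a b (Jn a (n - i) (\<lambda>t. g t - h t))) {..n}"
    proof (rule L2_set_mono)
      fix i
      have "nrm a b (Jn a (n - i) g)
          = nrm a b (\<lambda>t. Jn a (n - i) h t + Jn a (n - i) (\<lambda>t. g t - h t) t)"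
        using rep_pc[OF v] rep_pc[OF w] by (intro nrm_cong) (simp add: Jn_diff)
      also have "\<dots> \<le> nrm a b (Jn a (n - i) h) + nrm a b (Jn a (n - i) (\<lambda>t. g t - h t))"
        using rep_pc[OF w] rep_pc[OF d] by (intro nrm_triangle pc_Jn)
      finally show "nrm a b (Jn a (n - i) g) \<le> \<dots>" .
    qed (use rep_pc[OF v] pc_Jn in auto)
    also have "\<dots> \<le> L2_set (\<lambda>i. nrm a b (Jn a (n - i) h)) {..n}
        + L2_set (\<lambda>i. nrm a b (Jn a (n - i) (\<lambda>t. g t - h t))) {..n}"
      by (rule L2_set_triangle_ineq)
    also have "\<dots> = H_norm a b n w + H_norm a b n (\<lambda>t. v t - w t)"
      by (simp add: rep_H_norm[OF assms(1) w] rep_H_norm[OF assms(1) d] L2_set_def)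
    finally show ?thesis .
  qed
  have eq: "nrm a b (\<lambda>t. h t - g t) = nrm a b (\<lambda>t. g t - h t)"
    unfolding nrm_def by (simp add: power2_commute)
  then show ?thesis
    using tri[OF assms(2,3)] tri[OF assms(3,2)]
      rep_H_norm_le[OF assms(1) rep_diff[OF assms(2,3)]]
      rep_H_norm_le[OF assms(1) rep_diff[OF assms(3,2)], unfolded eq] by linarith
qed

section \<open>Density of test functions\<close>

lemma integral_eq_zeroI:
  fixes f :: "real \<Rightarrow> real"
  shows "(\<And>t. t \<in> S \<Longrightarrow> f t = 0) \<Longrightarrow> integral S f = 0"
  using integral_cong[of S f "\<lambda>_. 0"] by simp

lemma test_fun_support:
  assumes "\<phi> \<in> test_fun a b" "a < b"
  obtains c d where "a < c" "c \<le> d" "d < b" "\<And>t. t \<notin> {c..d} \<Longrightarrow> \<phi> t = 0"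
proof -
  obtain K where K: "compact K" "K \<subseteq> {a<..<b}" "\<forall>x. x \<notin> K \<longrightarrow> \<phi> x = 0"
    using assms unfolding test_fun_iff by blast
  show thesis
  proof (cases "K = {}")
    case True
    then show ?thesis using K assms(2) by (intro that[of "(a + b) / 2" "(a + b) / 2"]) auto
  next
    case False
    obtain c where c: "c \<in> K" "\<And>t. t \<in> K \<Longrightarrow> c \<le> t"
      using compact_attains_inf[OF K(1) False] by blast
    obtain d where d: "d \<in> K" "\<And>t. t \<in> K \<Longrightarrow> t \<le> d"
      using compact_attains_sup[OF K(1) False] by blast
    show ?thesis
    proof (rule that[of c d])
      show "\<phi> t = 0" if "t \<notin> {c..d}" for t using that c(2) d(2) K(3) by auto
    qed (use c d K in auto)
  qed
qed

text \<open>A vanishing integral makes the primitive return to 0 to the right of the support, so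
  compact support survives integration.\<close>

lemma test_fun_primitive:
  assumes "\<psi> \<in> test_fun a b" "a < b" "J a \<psi> b = 0"
  shows "J a \<psi> \<in> test_fun a b" "deriv (J a \<psi>) = \<psi>"
proof -
  obtain c d where cd: "a < c" "c \<le> d" "d < b" and supp: "\<And>t. t \<notin> {c..d} \<Longrightarrow> \<psi> t = 0"
    using test_fun_support[OF assms(1,2)] by blast
  have pc: "pc r s \<psi>" for r s using assms(1) by (rule pc_test_fun)
  \<comment> \<open>Smoothness is required on the whole line, also at and to the left of
    \<open>a\<close>; there the starting point is first moved further left, where nothing is added
    to the integral.\<close>
  have shift: "J a \<psi> s = J r \<psi> s" if "r \<le> a" for r s
  proof (cases "s \<le> a")
    case True
    then have "integral {r..s} \<psi> = 0" "integral {a..s} \<psi> = 0"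
      using supp cd by (auto intro!: integral_eq_zeroI)
    then show ?thesis by (simp add: J_def)
  next
    case False
    have "integral {r..a} \<psi> = 0" using supp cd by (intro integral_eq_zeroI) auto
    moreover have "integral {r..a} \<psi> + integral {a..s} \<psi> = integral {r..s} \<psi>"
      using that False pc_integrable[OF pc]
      by (intro Henstock_Kurzweil_Integration.integral_combine) auto
    ultimately show ?thesis by (simp add: J_def)
  qed
  have D: "(J a \<psi> has_real_derivative \<psi> t) (at t)" for t
  proof -
    let ?r = "min a t - 1"
    have "J a \<psi> = J ?r \<psi>" by (rule ext) (rule shift, simp)
    moreover have "(J ?r \<psi> has_real_derivative \<psi> t) (at t)"
      using DERIV_isCont[OF test_fun_DERIV[OF assms(1)]] by (intro J_deriv[of _ "t + 1"] pc) auto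
    ultimately show ?thesis by simp
  qed
  then show der: "deriv (J a \<psi>) = \<psi>" by (auto intro: DERIV_imp_deriv)
  have "J a \<psi> t = 0" if "t \<notin> {c..d}" for t
  proof (cases "t < c")
    case True
    then have "integral {a..t} \<psi> = 0" using supp by (intro integral_eq_zeroI) auto
    then show ?thesis by (simp add: J_def)
  next
    case False
    have comb: "integral {a..d} \<psi> + integral {d..s} \<psi> = integral {a..s} \<psi>" if "d \<le> s" for s
      using that cd pc_integrable[OF pc]
      by (intro Henstock_Kurzweil_Integration.integral_combine) auto
    have zero: "integral {d..s} \<psi> = 0" if "d \<le> s" for s
    proof -
      have "integral {d..s} \<psi> = integral {d..s} (\<lambda>_. 0)"
        by (rule integral_spike[of "{d}"]) (use supp cd in auto)
      then show ?thesis by simp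
    qed
    have "J a \<psi> t = integral {a..d} \<psi>" using comb[of t] zero[of t] that False by (simp add: J_def)
    also have "\<dots> = J a \<psi> b" using comb[of b] zero[of b] cd by (simp add: J_def)
    finally show ?thesis using assms(3) by simp
  qed
  moreover have "smooth (J a \<psi>)" using assms(1) D unfolding test_fun_iff by (blast intro: smooth_primitive)
  ultimately show "J a \<psi> \<in> test_fun a b"
    unfolding test_fun_iff using cd by (intro conjI exI[of _ "{c..d}"]) auto
qed

lemma test_fun_Jn:
  assumes "\<psi> \<in> test_fun a b" "a < b" "\<And>k. 1 \<le> k \<Longrightarrow> k \<le> n \<Longrightarrow> Jn a k \<psi> b = 0"
  shows "Jn a n \<psi> \<in> test_fun a b \<and> (deriv ^^ n) (Jn a n \<psi>) = \<psi>"
  using assms(3)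
proof (induction n)
  case (Suc n)
  then have IH: "Jn a n \<psi> \<in> test_fun a b" "(deriv ^^ n) (Jn a n \<psi>) = \<psi>" by auto
  have "J a (Jn a n \<psi>) b = 0" using Suc.prems[of "Suc n"] by simp
  note P = test_fun_primitive[OF IH(1) assms(2) this]
  have "(deriv ^^ Suc n) (Jn a (Suc n) \<psi>) = (deriv ^^ n) (deriv (J a (Jn a n \<psi>)))"
    by (simp add: funpow_Suc_right[of n deriv] del: funpow.simps(2)) simp
  then show ?case using P IH by simp
qed (use assms in auto)

text \<open>A bump function supported in the middle third serves as the weight; multiplied by it,
  the dual polynomials become test functions.\<close>

lemma dual_test_funs:
  assumes "a < b"
  obtains \<beta> :: "nat \<Rightarrow> real \<Rightarrow> real" where "\<And>j. \<beta> j \<in> test_fun a b"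
    "\<And>i j. i \<le> m \<Longrightarrow> j \<le> m \<Longrightarrow> integral {a..b} (\<lambda>t. \<beta> j t * t ^ i) = (if i = j then 1 else 0)"
proof -
  define c d where "c = a + (b - a) / 3" and "d = a + (b - a) / 3 * 2"
  have cd: "a < c" "c < d" "d < b" using assms by (auto simp: c_def d_def field_simps)
  have T: "bump c d \<in> test_fun a b" using cd by (intro bump_test_fun) auto
  obtain \<eta> where \<eta>: "\<And>i j. i \<le> m \<Longrightarrow> j \<le> m \<Longrightarrow>
       integral {a..b} (\<lambda>t. bump c d t * poly (\<eta> j) t * t ^ i) = (if i = j then 1 else 0)"
    by (rule dual_polys[OF assms test_fun_continuous[OF T] bump_bounds(1) _ cd(2) _ bump_bounds(3)])
       (use cd in auto)
  show thesis
  proof (rule that[of "\<lambda>j t. poly (\<eta> j) t * bump c d t"])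
    show "(\<lambda>t. poly (\<eta> j) t * bump c d t) \<in> test_fun a b" for j
      by (intro test_fun_mult[OF T] smooth_poly)
    show "integral {a..b} (\<lambda>t. poly (\<eta> j) t * bump c d t * t ^ i) = (if i = j then 1 else 0)"
      if "i \<le> m" "j \<le> m" for i j
      using \<eta>[OF that] by (simp add: mult.commute)
  qed
qed

text \<open>Any test function, once its moments up to degree \<open>m\<close> are cancelled by the
  \<beta>-functions, is the derivative of order \<open>m + 1\<close> of a test function and so is
  annihilated by \<open>Q\<close>. Moving the correction to the other side of the pairing turns it
  into the polynomial whose coefficients are the pairings of \<open>Q\<close> with the
  \<beta>-functions; the fundamental lemma concludes.\<close>

lemma du_Bois_Reymond:
  assumes "a < b" "continuous_on {a..b} Q"
    and zero: "\<And>\<phi>. \<phi> \<in> test_fun a b \<Longrightarrow> integral {a..b} (\<lambda>t. Q t * (deriv ^^ Suc m) \<phi> t) = 0"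
  obtains \<pi> where "degree \<pi> \<le> m" "\<And>t. t \<in> {a..b} \<Longrightarrow> Q t = poly \<pi> t"
proof -
  obtain \<beta> where \<beta>: "\<And>j. \<beta> j \<in> test_fun a b"
    "\<And>i j. i \<le> m \<Longrightarrow> j \<le> m \<Longrightarrow> integral {a..b} (\<lambda>t. \<beta> j t * t ^ i) = (if i = j then 1 else 0)"
    using dual_test_funs[OF assms(1), of m] by blast
  define k where "k j = integral {a..b} (\<lambda>t. Q t * \<beta> j t)" for j
  define \<pi> where "\<pi> = (\<Sum>j\<le>m. monom (k j) j)"
  have Q: "pc a b Q" using assms(2) by (rule pc_continuous)
  have ort: "integral {a..b} (\<lambda>t. (Q t - poly \<pi> t) * \<psi> t) = 0" if \<psi>: "\<psi> \<in> test_fun a b" for \<psi>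
  proof -
    define r where "r j = integral {a..b} (\<lambda>t. \<psi> t * t ^ j)" for j
    define \<psi>' where "\<psi>' t = \<psi> t - (\<Sum>j\<le>m. r j * \<beta> j t)" for t
    have pow: "pc a b (\<lambda>t. t ^ j)" for j by (intro pc_continuous continuous_intros)
    have p: "pc a b \<psi>" "\<And>j. pc a b (\<beta> j)" using \<psi> \<beta>(1) by (auto intro: pc_test_fun)
    have T: "\<psi>' \<in> test_fun a b"
      unfolding \<psi>'_def[abs_def] by (intro test_fun_diff \<psi> test_fun_sum test_fun_cmult \<beta>(1))
    have "orth a b m \<psi>'"
      using orth_dual_correction[OF p(1) p(2) \<beta>(2)] by (simp add: \<psi>'_def[abs_def] r_def)
    then have ends: "\<And>i. 1 \<le> i \<Longrightarrow> i \<le> Suc m \<Longrightarrow> Jn a i \<psi>' b = 0"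
      using orth_iff_end_data[OF _ pc_test_fun[OF T], of a b m] assms(1) by auto
    have *: "Jn a (Suc m) \<psi>' \<in> test_fun a b \<and> (deriv ^^ Suc m) (Jn a (Suc m) \<psi>') = \<psi>'"
      by (rule test_fun_Jn[OF T assms(1) ends])
    have "integral {a..b} (\<lambda>t. Q t * \<psi>' t) = 0" using zero[OF *[THEN conjunct1]] unfolding *[THEN conjunct2] .
    moreover have "integral {a..b} (\<lambda>t. Q t * \<psi>' t)
        = integral {a..b} (\<lambda>t. Q t * \<psi> t - (\<Sum>j\<le>m. r j * (Q t * \<beta> j t)))"
      by (rule integral_cong) (simp add: \<psi>'_def right_diff_distrib sum_distrib_left mult_ac)
    moreover have "\<dots> = integral {a..b} (\<lambda>t. Q t * \<psi> t) - (\<Sum>j\<le>m. r j * k j)"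
      unfolding k_def using Q p
      by (simp add: integral_diff integral_sum pc_integrable pc_sum pc_cmult pc_mult integral_mult_right)
    moreover have "(\<Sum>j\<le>m. r j * k j) = integral {a..b} (\<lambda>t. \<Sum>j\<le>m. k j * (\<psi> t * t ^ j))"
      unfolding r_def using p pow
      by (simp add: integral_sum pc_integrable pc_cmult pc_mult integral_mult_right mult.commute)
    moreover have "\<dots> = integral {a..b} (\<lambda>t. poly \<pi> t * \<psi> t)"
      by (rule integral_cong) (simp add: \<pi>_def poly_sum poly_monom sum_distrib_left mult_ac)
    moreover have "integral {a..b} (\<lambda>t. (Q t - poly \<pi> t) * \<psi> t)
        = integral {a..b} (\<lambda>t. Q t * \<psi> t) - integral {a..b} (\<lambda>t. poly \<pi> t * \<psi> t)"
      using Q p by (simp add: left_diff_distrib integral_diff pc_integrable pc_mult)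
    ultimately show ?thesis by linarith
  qed
  have cont: "continuous_on {a..b} (\<lambda>t. Q t - poly \<pi> t)" using assms(2) by (intro continuous_intros)
  have "AE t in lebesgue. t \<in> {a..b} \<longrightarrow> Q t - poly \<pi> t = 0"
  proof (rule fundamental_lemma[OF assms(1)])
    show "set_integrable lebesgue {a..b} (\<lambda>t. Q t - poly \<pi> t)"
      by (intro pc_abs_integrable pc_continuous cont)
    show "(LINT t:{a..b}|lebesgue. (Q t - poly \<pi> t) * \<phi> t) = 0" if "\<phi> \<in> test_fun a b" for \<phi>
      using ort[OF that] pc_lint[OF pc_mult[OF pc_continuous[OF cont] pc_test_fun[OF that]]] by simp
  qed
  then have "Q t = poly \<pi> t" if "t \<in> {a..b}" for t
    using continuous_zero_of_AE_zero[OF assms(1) cont _ that] by simp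
  then show thesis using degree_sum_monom by (intro that[of \<pi>]) (auto simp: \<pi>_def)
qed

lemma cutoff_exists:
  assumes "a < b" "\<epsilon> > 0"
  obtains X where "X \<in> test_fun a b" "\<And>t. 0 \<le> X t" "\<And>t. X t \<le> 1"
    "integral {a..b} (\<lambda>t. 1 - X t) < \<epsilon>"
proof -
  \<comment> \<open>The strips of width \<delta> cut off at both ends have total length below
    \<epsilon> and leave a nonempty interval.\<close>
  define \<delta> where "\<delta> = min (\<epsilon> / 4) ((b - a) / 4)"
  have \<delta>: "\<delta> > 0" "2 * \<delta> < \<epsilon>" "2 * \<delta> < b - a" using assms by (auto simp: \<delta>_def min_def)
  define c d where "c = a + \<delta>" and "d = b - \<delta>"
  have cd: "a < c" "c < d" "d < b" using \<delta> by (auto simp: c_def d_def)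
  define Y where "Y n t = 1 - (1 - bump c d t) ^ n" for n t
  have T: "Y n \<in> test_fun a b" for n
    unfolding Y_def[abs_def] using cd by (intro bump_power_test_fun) auto
  have "set_integrable lebesgue {a..b} (\<lambda>t. 1 :: real)" by (intro pc_abs_integrable) simp
  from bump_power_integral_tendsto[OF this, of c d]
  have "(\<lambda>n. LINT t:{a..b}|lebesgue. Y n t) \<longlonglongrightarrow> (LINT t:{a..b}|lebesgue. indicator {c<..<d} t)"
    by (simp add: Y_def)
  moreover have "(LINT t:{a..b}|lebesgue. Y n t) = integral {a..b} (Y n)" for n
    by (intro pc_lint pc_test_fun[OF T])
  moreover have "(LINT t:{a..b}|lebesgue. indicator {c<..<d} t) = d - c"
  proof -
    have "(LINT t:{a..b}|lebesgue. indicator {c<..<d} t) = (LINT t|lebesgue. indicator {c<..<d} t :: real)"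
      unfolding set_lebesgue_integral_def using cd
      by (intro Bochner_Integration.integral_cong) (auto simp: indicator_def)
    then show ?thesis using cd by simp
  qed
  ultimately have "(\<lambda>n. integral {a..b} (Y n)) \<longlonglongrightarrow> d - c" by simp
  moreover have "d - c > b - a - \<epsilon>" using \<delta> by (simp add: c_def d_def)
  ultimately have "\<forall>\<^sub>F n in sequentially. integral {a..b} (Y n) > b - a - \<epsilon>"
    by (rule order_tendstoD(1))
  then obtain n where n: "integral {a..b} (Y n) > b - a - \<epsilon>"
    by (metis eventually_sequentially le_refl)
  have "integral {a..b} (\<lambda>t. 1 - Y n t) = (b - a) - integral {a..b} (Y n)"
    using assms(1) by (subst integral_diff) (auto intro: pc_integrable pc_test_fun[OF T])
  then show thesis
    using n bump_power_bounds[of c d] T by (intro that[of "Y n"]) (auto simp: Y_def)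
qed

text \<open>A Weierstrass polynomial times a cutoff is already smooth with compact support; half of
  \<epsilon> is spent on each of the two approximations.\<close>

lemma test_fun_dense:
  assumes "a < b" "continuous_on {a..b} g" "\<epsilon> > 0"
  obtains \<psi> where "\<psi> \<in> test_fun a b" "nrm a b (\<lambda>t. g t - \<psi> t) < \<epsilon>"
proof -
  define e where "e = \<epsilon> / (2 * sqrt (b - a))"
  have e: "e > 0" "e * sqrt (b - a) = \<epsilon> / 2" using assms by (auto simp: e_def)
  obtain P where P: "real_polynomial_function P" "\<And>t. t \<in> {a..b} \<Longrightarrow> \<bar>g t - P t\<bar> < e"
    using Stone_Weierstrass_real_polynomial_function[OF compact_Icc assms(2) e(1)] by blast
  then obtain k n where "P = (\<lambda>t. \<Sum>i\<le>n. k i * t ^ i)" using real_polynomial_function_iff_sum by auto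
  then obtain q :: "real poly" where q: "P = poly q"
    by (intro that[of "\<Sum>i\<le>n. monom (k i) i"]) (auto simp: poly_sum poly_monom)
  obtain B where B: "B \<ge> 0" "\<And>t. t \<in> {a..b} \<Longrightarrow> \<bar>poly q t\<bar> \<le> B"
    using pc_bound[OF pc_poly[of a b q]] by blast
  \<comment> \<open>As the cutoff has values in the unit interval, the square of
    \<open>1 - X\<close> is at most \<open>1 - X\<close>; an integral of \<open>1 - X\<close> below
    this \<delta> keeps the L2 error of the cutoff under \<open>\<epsilon> / 2\<close>, and the
    \<open>1\<close> added to \<open>B\<close> covers the case \<open>B = 0\<close>.\<close>
  define \<delta> where "\<delta> = (\<epsilon> / (2 * (B + 1)))\<^sup>2"
  have "\<delta> > 0" using assms(3) B(1) by (simp add: \<delta>_def)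
  then obtain X where X: "X \<in> test_fun a b" "\<And>t. 0 \<le> X t" "\<And>t. X t \<le> 1"
    "integral {a..b} (\<lambda>t. 1 - X t) < \<delta>"
    using cutoff_exists[OF assms(1)] by blast
  let ?\<psi> = "\<lambda>t. poly q t * X t"
  have pg: "pc a b g" using assms(2) by (rule pc_continuous)
  have pX: "pc a b X" using X(1) by (rule pc_test_fun)
  have "nrm a b (\<lambda>t. g t - ?\<psi> t) = nrm a b (\<lambda>t. (g t - poly q t) + poly q t * (1 - X t))"
    by (simp add: algebra_simps)
  also have "\<dots> \<le> nrm a b (\<lambda>t. g t - poly q t) + nrm a b (\<lambda>t. poly q t * (1 - X t))"
    using pg pX by (intro nrm_triangle pc_diff pc_mult) auto
  also have "nrm a b (\<lambda>t. g t - poly q t) \<le> nrm a b (\<lambda>t. e)"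
    using pg P(2) q by (intro nrm_le_off_finite[of _ _ _ _ "{}"] pc_diff) (auto intro: less_imp_le)
  also have "nrm a b (\<lambda>t. e) = \<epsilon> / 2"
    using e assms by (simp add: nrm_def real_sqrt_mult mult.commute)
  also have "nrm a b (\<lambda>t. poly q t * (1 - X t)) < \<epsilon> / 2"
  proof -
    have "integral {a..b} (\<lambda>t. (poly q t * (1 - X t))\<^sup>2) \<le> integral {a..b} (\<lambda>t. B\<^sup>2 * (1 - X t))"
    proof (rule integral_le)
      show "(poly q t * (1 - X t))\<^sup>2 \<le> B\<^sup>2 * (1 - X t)" if "t \<in> {a..b}" for t
      proof -
        have "(poly q t)\<^sup>2 \<le> B\<^sup>2" using B that by (simp add: abs_le_square_iff[symmetric])
        moreover have "(1 - X t)\<^sup>2 \<le> 1 - X t"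
          using X(2,3)[of t] mult_left_le[of "1 - X t" "1 - X t"] by (simp add: power2_eq_square)
        ultimately show ?thesis unfolding power_mult_distrib by (intro mult_mono) auto
      qed
    qed (use pX in \<open>auto intro!: pc_integrable pc_power2 pc_mult pc_diff\<close>)
    also have "\<dots> = B\<^sup>2 * integral {a..b} (\<lambda>t. 1 - X t)" by (rule integral_mult_right)
    also have "\<dots> \<le> B\<^sup>2 * \<delta>" using X(4) by (intro mult_left_mono) auto
    also have "\<dots> = (B * (\<epsilon> / (2 * (B + 1))))\<^sup>2" by (simp only: \<delta>_def power_mult_distrib)
    finally have "nrm a b (\<lambda>t. poly q t * (1 - X t)) \<le> sqrt ((B * (\<epsilon> / (2 * (B + 1))))\<^sup>2)"
      unfolding nrm_def by (rule real_sqrt_le_mono)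
    also have "\<dots> = B * (\<epsilon> / (2 * (B + 1)))" using B(1) assms(3) by simp
    also have "\<dots> < \<epsilon> / 2" using B(1) assms(3) by (simp add: field_simps)
    finally show ?thesis .
  qed
  finally have "nrm a b (\<lambda>t. g t - ?\<psi> t) < \<epsilon>" by simp
  then show thesis using test_fun_mult[OF X(1) smooth_poly] by (intro that[of ?\<psi>]) auto
qed

text \<open>It suffices to approximate \<open>g\<close> in L2 by test functions with vanishing
  moments, since their iterated integrals are again test functions. The moments of \<open>g\<close>
  vanish, so those of an approximation \<psi> are bounded by the error \<open>g - \<psi>\<close>,
  and cancelling them enlarges the error only by a fixed factor.\<close>

lemma rep_H0_space:
  assumes "a < b" "rep a b (Suc m) v g" "continuous_on {a..b} g" "orth a b m g"
  shows "v \<in> H0_space a b (Suc m)"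
proof -
  obtain \<beta> where \<beta>: "\<And>j. \<beta> j \<in> test_fun a b"
    "\<And>i j. i \<le> m \<Longrightarrow> j \<le> m \<Longrightarrow> integral {a..b} (\<lambda>t. \<beta> j t * t ^ i) = (if i = j then 1 else 0)"
    using dual_test_funs[OF assms(1), of m] by blast
  have p\<beta>: "pc a b (\<beta> j)" for j using \<beta>(1) by (rule pc_test_fun)
  have pg: "pc a b g" using assms(3) by (rule pc_continuous)
  \<comment> \<open>This factor is 1 for the approximation itself plus the norm of the moment
    correction.\<close>
  define M where "M = 1 + (\<Sum>j\<le>m. nrm a b (\<lambda>t. t ^ j) * nrm a b (\<beta> j))"
  have pow: "pc a b (\<lambda>t. t ^ j)" for j by (intro pc_continuous continuous_intros)
  have M: "M \<ge> 1" unfolding M_def using p\<beta> pow by (auto intro!: sum_nonneg mult_nonneg_nonneg)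
  have "\<exists>\<phi>\<in>test_fun a b. H_norm a b (Suc m) (\<lambda>x. v x - \<phi> x) < \<epsilon>" if "\<epsilon> > 0" for \<epsilon>
  proof -
    define \<delta> where "\<delta> = \<epsilon> / (M * (sobolev_const a b (Suc m) + 1))"
    have S: "sobolev_const a b (Suc m) + 1 > 0" using sobolev_const_nonneg[of a b "Suc m"] by linarith
    have "\<delta> > 0" using that M S by (simp add: \<delta>_def)
    then obtain \<psi> where \<psi>: "\<psi> \<in> test_fun a b" "nrm a b (\<lambda>t. g t - \<psi> t) < \<delta>"
      using test_fun_dense[OF assms(1,3)] by blast
    define r where "r j = integral {a..b} (\<lambda>t. \<psi> t * t ^ j)" for j
    define \<psi>' where "\<psi>' t = \<psi> t - (\<Sum>j\<le>m. r j * \<beta> j t)" for t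
    have p\<psi>: "pc a b \<psi>" using \<psi>(1) by (rule pc_test_fun)
    have T: "\<psi>' \<in> test_fun a b"
      unfolding \<psi>'_def[abs_def] by (intro test_fun_diff \<psi> test_fun_sum test_fun_cmult \<beta>(1))
    have "orth a b m \<psi>'"
      using orth_dual_correction[OF p\<psi> p\<beta> \<beta>(2)] by (simp add: \<psi>'_def[abs_def] r_def)
    then have ends: "\<And>i. 1 \<le> i \<Longrightarrow> i \<le> Suc m \<Longrightarrow> Jn a i \<psi>' b = 0"
      using orth_iff_end_data[OF _ pc_test_fun[OF T], of a b m] assms(1) by auto
    have *: "Jn a (Suc m) \<psi>' \<in> test_fun a b \<and> (deriv ^^ Suc m) (Jn a (Suc m) \<psi>') = \<psi>'"
      by (rule test_fun_Jn[OF T assms(1) ends])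
    have r: "\<bar>r j\<bar> \<le> nrm a b (\<lambda>t. g t - \<psi> t) * nrm a b (\<lambda>t. t ^ j)" if "j \<le> m" for j
    proof -
      have "integral {a..b} (\<lambda>t. g t * t ^ j) = 0"
        using assms(4)[unfolded orth_def, rule_format, of "monom 1 j"] that
        by (simp add: poly_monom degree_monom_eq mult.commute)
      then have "r j = - integral {a..b} (\<lambda>t. (g t - \<psi> t) * t ^ j)"
        unfolding r_def left_diff_distrib using pg p\<psi> pow
        by (subst integral_diff) (auto intro!: pc_integrable pc_mult)
      then show ?thesis using cauchy_schwarz[OF pc_diff[OF pg p\<psi>] pow[of j]] by simp
    qed
    have sumle: "nrm a b (\<lambda>t. \<Sum>j\<in>I. r j * \<beta> j t) \<le> (\<Sum>j\<in>I. \<bar>r j\<bar> * nrm a b (\<beta> j))" if "finite I" for I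
      using that
    proof (induction I)
      case empty
      then show ?case by (simp add: nrm_def)
    next
      case (insert i I)
      have "nrm a b (\<lambda>t. \<Sum>j\<in>insert i I. r j * \<beta> j t)
          = nrm a b (\<lambda>t. r i * \<beta> i t + (\<Sum>j\<in>I. r j * \<beta> j t))" using insert by simp
      also have "\<dots> \<le> nrm a b (\<lambda>t. r i * \<beta> i t) + nrm a b (\<lambda>t. \<Sum>j\<in>I. r j * \<beta> j t)"
        by (intro nrm_triangle pc_cmult pc_sum p\<beta>)
      also have "\<dots> \<le> (\<Sum>j\<in>insert i I. \<bar>r j\<bar> * nrm a b (\<beta> j))"
        using insert by (simp add: nrm_cmult)
      finally show ?case .
    qed
    have "nrm a b (\<lambda>t. g t - \<psi>' t) = nrm a b (\<lambda>t. (g t - \<psi> t) + (\<Sum>j\<le>m. r j * \<beta> j t))"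
      by (simp add: \<psi>'_def algebra_simps)
    also have "\<dots> \<le> nrm a b (\<lambda>t. g t - \<psi> t) + nrm a b (\<lambda>t. \<Sum>j\<le>m. r j * \<beta> j t)"
      by (intro nrm_triangle pc_diff pc_sum pc_cmult pg p\<psi> p\<beta>)
    also have "\<dots> \<le> nrm a b (\<lambda>t. g t - \<psi> t) + (\<Sum>j\<le>m. \<bar>r j\<bar> * nrm a b (\<beta> j))"
      using sumle by simp
    also have "\<dots> \<le> nrm a b (\<lambda>t. g t - \<psi> t)
        + (\<Sum>j\<le>m. (nrm a b (\<lambda>t. g t - \<psi> t) * nrm a b (\<lambda>t. t ^ j)) * nrm a b (\<beta> j))"
      using r p\<beta> by (intro add_left_mono sum_mono mult_right_mono) auto
    also have "\<dots> = M * nrm a b (\<lambda>t. g t - \<psi> t)"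
      by (simp add: M_def distrib_right distrib_left sum_distrib_right sum_distrib_left mult_ac)
    also have "\<dots> < M * \<delta>" using \<psi>(2) M by (intro mult_strict_left_mono) auto
    finally have le: "nrm a b (\<lambda>t. g t - \<psi>' t) \<le> M * \<delta>" by simp
    have "rep a b (Suc m) (Jn a (Suc m) \<psi>') \<psi>'" by (intro rep_Jn pc_test_fun[OF T])
    from rep_H_norm_le[OF assms(1) rep_diff[OF assms(2) this]]
    have "H_norm a b (Suc m) (\<lambda>t. v t - Jn a (Suc m) \<psi>' t)
        \<le> sobolev_const a b (Suc m) * nrm a b (\<lambda>t. g t - \<psi>' t)" .
    also have "\<dots> \<le> sobolev_const a b (Suc m) * (M * \<delta>)"
      using le sobolev_const_nonneg by (intro mult_left_mono)
    also have "\<dots> = sobolev_const a b (Suc m) / (sobolev_const a b (Suc m) + 1) * \<epsilon>"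
      using M S by (simp add: \<delta>_def)
    also have "\<dots> < \<epsilon>" using S that by (simp add: field_simps)
    finally show ?thesis using * by blast
  qed
  then show ?thesis using rep_H_space[OF assms(1,2)] unfolding H0_space_def by simp
qed

section \<open>Volterra equations\<close>

lemma J_power:
  assumes "a \<le> t"
  shows "J a (\<lambda>s. (s - a) ^ n) t = (t - a) ^ Suc n / real (Suc n)"
proof -
  have "((\<lambda>s. (s - a) ^ n) has_integral (t - a) ^ Suc n / real (Suc n) - (a - a) ^ Suc n / real (Suc n)) {a..t}"
    by (rule fundamental_theorem_of_calculus[OF assms])
       (auto simp: has_real_derivative_iff_has_vector_derivative[symmetric]
         intro!: derivative_eq_intros simp del: of_nat_Suc power_Suc)
  then show ?thesis by (simp add: J_def integral_unique)
qed

text \<open>Picard iteration. Because the bound on \<open>T\<close> involves the integral only up to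
  \<open>t\<close>, successive differences decay like \<open>(M (t - a)) ^ n / n!\<close>, so the
  iterates converge uniformly however large \<open>M * (b - a)\<close> is.\<close>

lemma volterra_exists:
  fixes T :: "(real \<Rightarrow> real) \<Rightarrow> real \<Rightarrow> real"
  assumes "a < b" and cont: "\<And>g. continuous_on {a..b} g \<Longrightarrow> continuous_on {a..b} (T g)"
    and lin: "\<And>f g t. continuous_on {a..b} f \<Longrightarrow> continuous_on {a..b} g \<Longrightarrow> t \<in> {a..b} \<Longrightarrow>
       T (\<lambda>s. f s - g s) t = T f t - T g t"
    and bound: "\<And>g t. continuous_on {a..b} g \<Longrightarrow> t \<in> {a..b} \<Longrightarrow> \<bar>T g t\<bar> \<le> M * J a (\<lambda>s. \<bar>g s\<bar>) t"
    and "M \<ge> 0" and h: "continuous_on {a..b} h"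
  obtains g where "continuous_on {a..b} g" "\<And>t. t \<in> {a..b} \<Longrightarrow> g t = h t + T g t"
proof -
  define S where "S = rec_nat (\<lambda>_. 0) (\<lambda>_ g t. h t + T g t)"
  have S0: "S 0 = (\<lambda>_. 0)" and SS: "S (Suc n) = (\<lambda>t. h t + T (S n) t)" for n by (auto simp: S_def)
  have Sc: "continuous_on {a..b} (S n)" for n
    by (induction n) (auto simp: S0 SS intro!: continuous_intros h cont)
  define d where "d n t = S (Suc n) t - S n t" for n t
  have dc: "continuous_on {a..b} (d n)" for n
    unfolding d_def[abs_def] by (intro continuous_intros Sc)
  have dS: "d (Suc n) t = T (d n) t" if "t \<in> {a..b}" for n t
    using lin[OF Sc[of "Suc n"] Sc[of n] that] by (simp add: d_def[abs_def] SS[of "Suc n"] SS[of n])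
  obtain B where B: "B \<ge> 0" "\<And>t. t \<in> {a..b} \<Longrightarrow> \<bar>d 0 t\<bar> \<le> B"
    using pc_bound[OF pc_continuous[OF dc[of 0]]] by blast
  have dle: "\<bar>d n t\<bar> \<le> B * (M ^ n * (t - a) ^ n / fact n)" if "t \<in> {a..b}" for n t
    using that
  proof (induction n arbitrary: t)
    case (Suc n)
    have "J a (\<lambda>s. \<bar>d n s\<bar>) t \<le> J a (\<lambda>s. B * M ^ n / fact n * (s - a) ^ n) t"
    proof (rule J_mono[of _ b])
      show "\<bar>d n s\<bar> \<le> B * M ^ n / fact n * (s - a) ^ n" if "s \<in> {a..t}" for s
        using Suc.IH[of s] that Suc.prems by simp
    qed (use Suc.prems dc in \<open>auto intro!: pc_continuous continuous_intros\<close>)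
    also have "\<dots> = B * M ^ n / fact n * ((t - a) ^ Suc n / real (Suc n))"
      using J_power[of a t n] Suc.prems by (simp add: J_def integral_mult_right)
    finally have "M * J a (\<lambda>s. \<bar>d n s\<bar>) t \<le> M * (B * M ^ n / fact n * ((t - a) ^ Suc n / real (Suc n)))"
      using assms(5) by (intro mult_left_mono)
    moreover have "\<bar>d (Suc n) t\<bar> \<le> M * J a (\<lambda>s. \<bar>d n s\<bar>) t"
      using bound[OF dc Suc.prems] dS[OF Suc.prems] by simp
    ultimately show ?case by (simp add: field_simps)
  qed (use B in auto)
  define E where "E n = B * ((M * (b - a)) ^ n / fact n)" for n
  have "summable E"
    unfolding E_def using summable_exp[of "M * (b - a)"] by (intro summable_mult) (simp add: field_simps)
  moreover have "norm (d n t) \<le> E n" if "t \<in> {a..b}" for n t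
  proof -
    have "B * (M ^ n * (t - a) ^ n / fact n) \<le> B * (M ^ n * (b - a) ^ n / fact n)"
      using that assms(5) B(1) by (intro mult_left_mono divide_right_mono power_mono) auto
    then show ?thesis using dle[OF that, of n] by (simp add: E_def power_mult_distrib)
  qed
  ultimately have "uniform_limit {a..b} (\<lambda>n t. \<Sum>i<n. d i t) (\<lambda>t. suminf (\<lambda>i. d i t)) sequentially"
    by (intro Weierstrass_m_test) auto
  moreover have "(\<Sum>i<n. d i t) = S n t" for n t
    using sum_lessThan_telescope[of "\<lambda>i. S i t" n] by (simp add: d_def S0)
  ultimately obtain g where lim: "uniform_limit {a..b} S g sequentially" by auto
  have gc: "continuous_on {a..b} g"
    by (rule uniform_limit_theorem[OF always_eventually lim]) (auto intro: Sc)
  have "g t = h t + T g t" if t: "t \<in> {a..b}" for t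
  proof -
    have "(\<lambda>n. T (S n) t) \<longlonglongrightarrow> T g t"
    proof (rule LIMSEQ_I)
      fix r :: real assume "r > 0"
      define e where "e = r / (M * (b - a) + 1)"
      have pos: "M * (b - a) + 1 > 0" using assms(1,5) by (smt (verit) mult_nonneg_nonneg)
      have "e > 0" using \<open>r > 0\<close> pos by (simp add: e_def)
      then obtain N where N: "\<And>n s. n \<ge> N \<Longrightarrow> s \<in> {a..b} \<Longrightarrow> dist (S n s) (g s) < e"
        using lim unfolding uniform_limit_sequentially_iff by blast
      have "norm (T (S n) t - T g t) < r" if "n \<ge> N" for n
      proof -
        have "\<bar>T (S n) t - T g t\<bar> \<le> M * J a (\<lambda>s. \<bar>S n s - g s\<bar>) t"
          using bound[OF continuous_on_diff[OF Sc gc] t] lin[OF Sc gc t] by simp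
        also have "\<dots> \<le> M * J a (\<lambda>s. e) t"
        proof (intro mult_left_mono J_mono[of _ b])
          show "\<bar>S n s - g s\<bar> \<le> e" if "s \<in> {a..t}" for s
            using N[OF \<open>n \<ge> N\<close>, of s] that t by (simp add: dist_real_def)
          show "pc a b (\<lambda>s. \<bar>S n s - g s\<bar>)"
            by (intro pc_abs pc_diff pc_continuous Sc gc)
        qed (use t assms(5) in auto)
        also have "\<dots> = M * (t - a) * e" using t by (simp add: J_def)
        also have "\<dots> \<le> M * (b - a) * e" using t assms(5) \<open>e > 0\<close> by (intro mult_right_mono mult_left_mono) auto
        also have "\<dots> < (M * (b - a) + 1) * e" using \<open>e > 0\<close> by (simp add: algebra_simps)
        also have "\<dots> = r" using pos by (simp add: e_def)
        finally show ?thesis by simp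
      qed
      then show "\<exists>N. \<forall>n\<ge>N. norm (T (S n) t - T g t) < r" by blast
    qed
    then have "(\<lambda>n. S (Suc n) t) \<longlonglongrightarrow> h t + T g t" unfolding SS by (intro tendsto_intros)
    moreover have "(\<lambda>n. S (Suc n) t) \<longlonglongrightarrow> g t"
      using tendsto_uniform_limitI[OF lim t] by (rule LIMSEQ_Suc)
    ultimately show ?thesis using LIMSEQ_unique by blast
  qed
  then show thesis using gc by (rule that[rotated])
qed

text \<open>The conclusion is for integrals of absolute values, since in its use the perturbation
  \<rho> is controlled in the mean and not pointwise.\<close>

lemma gronwall:
  assumes "a < b" "pc a b y" "pc a b \<rho>" "M \<ge> 0"
    "\<And>t. t \<in> {a..b} \<Longrightarrow> \<bar>y t\<bar> \<le> \<bar>\<rho> t\<bar> + M * J a (\<lambda>s. \<bar>y s\<bar>) t"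
  shows "J a (\<lambda>s. \<bar>y s\<bar>) b \<le> exp (M * (b - a)) * J a (\<lambda>s. \<bar>\<rho> s\<bar>) b"
proof -
  define Y where "Y = J a (\<lambda>s. \<bar>y s\<bar>)"
  define R where "R = J a (\<lambda>s. \<bar>\<rho> s\<bar>) b"
  have py: "pc a b (\<lambda>s. \<bar>y s\<bar>)" "pc a b (\<lambda>s. \<bar>\<rho> s\<bar>)" using assms by (auto intro: pc_abs)
  have Yc: "continuous_on {a..b} Y" unfolding Y_def using py(1) by (rule J_cont)
  have YZ: "Y t \<le> R + M * J a Y t" if t: "t \<in> {a..b}" for t
  proof -
    have "Y t \<le> J a (\<lambda>s. \<bar>\<rho> s\<bar> + M * Y s) t"
      unfolding Y_def using assms(5) t py
      by (intro J_mono[of _ b]) (auto intro!: pc_add pc_cmult pc_J)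
    also have "\<dots> = J a (\<lambda>s. \<bar>\<rho> s\<bar>) t + M * J a Y t"
      using J_lin[OF py(2) pc_continuous[OF Yc] t] .
    also have "J a (\<lambda>s. \<bar>\<rho> s\<bar>) t \<le> R"
      unfolding R_def using t assms by (intro J_abs_mono) auto
    finally show ?thesis by simp
  qed
  \<comment> \<open>The majorant of \<open>Y\<close> times the integrating factor: its derivative
    has the sign of \<open>Y t - (R + M * J a Y t)\<close>, up to the nonnegative factor
    \<open>M\<close>, so \<open>F\<close> does not increase.\<close>
  define F where "F t = (R + M * J a Y t) * exp (- M * (t - a))" for t
  have "F b \<le> F a"
  proof (rule DERIV_nonpos_imp_decreasing_open[of a b F])
    show "\<exists>r. (F has_real_derivative r) (at t) \<and> r \<le> 0" if "a < t" "t < b" for t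
    proof -
      have "(J a Y has_real_derivative Y t) (at t)"
        using that continuous_on_interior[OF Yc, of t] by (intro J_deriv[of a b] pc_continuous Yc) auto
      then have "(F has_real_derivative (M * (Y t - (R + M * J a Y t))) * exp (- M * (t - a))) (at t)"
        unfolding F_def by (auto intro!: derivative_eq_intros simp: algebra_simps)
      moreover have "(M * (Y t - (R + M * J a Y t))) * exp (- M * (t - a)) \<le> 0"
        using YZ[of t] that assms(4) by (intro mult_nonpos_nonneg mult_nonneg_nonpos) auto
      ultimately show ?thesis by blast
    qed
    show "continuous_on {a..b} F"
      unfolding F_def by (intro continuous_intros J_cont pc_continuous Yc)
  qed (use assms in auto)
  then have "(R + M * J a Y b) * exp (- M * (b - a)) \<le> R" by (simp add: F_def)
  then have "R + M * J a Y b \<le> R * exp (M * (b - a))"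
    by (simp add: exp_minus divide_inverse[symmetric] pos_divide_le_eq)
  then show ?thesis using YZ[of b] assms(1) by (simp add: Y_def R_def mult.commute)
qed

lemma J_lipschitz:
  assumes "pc a b f" "\<And>s. s \<in> {a..b} \<Longrightarrow> \<bar>f s\<bar> \<le> S" "s \<in> {a..b}" "t \<in> {a..b}"
  shows "\<bar>J a f t - J a f s\<bar> \<le> S * \<bar>t - s\<bar>"
proof -
  have *: "\<bar>J a f t - J a f s\<bar> \<le> S * (t - s)" if "s \<le> t" "s \<in> {a..b}" "t \<in> {a..b}" for s t
  proof -
    have "integral {a..s} f + integral {s..t} f = integral {a..t} f"
      using that assms(1) by (intro Henstock_Kurzweil_Integration.integral_combine) (auto intro: pc_integrable_subset)
    moreover have "norm (integral {s..t} f) \<le> S * (t - s)"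
    proof -
      have "norm (integral {s..t} f) \<le> S * measure lborel {s..t}"
      proof (rule has_integral_bound_real[of S "{}" f])
        show "0 \<le> S" using assms(2)[of s] that by simp
        show "(f has_integral integral {s..t} f) {s..t}"
          using pc_integrable_subset[OF assms(1), of s t] that by (auto intro: integrable_integral)
      qed (use that assms(2) in auto)
      then show ?thesis using that by simp
    qed
    ultimately show ?thesis by (simp add: J_def)
  qed
  show ?thesis
  proof (cases "s \<le> t")
    case True
    then show ?thesis using *[OF _ assms(3,4)] by simp
  next
    case False
    then show ?thesis using *[OF _ assms(4,3)] by (simp add: abs_minus_commute)
  qed
qed

lemma Jn_sup_le:
  assumes "a < b" "pc a b f" "\<And>s. s \<in> {a..b} \<Longrightarrow> \<bar>f s\<bar> \<le> S" "t \<in> {a..b}"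
  shows "\<bar>Jn a n f t\<bar> \<le> (b - a) ^ n * S"
  using assms(4)
proof (induction n arbitrary: t)
  case (Suc n)
  have S: "S \<ge> 0" using assms(3)[of a] assms(1) by simp
  have "\<bar>J a (Jn a n f) t - J a (Jn a n f) a\<bar> \<le> ((b - a) ^ n * S) * \<bar>t - a\<bar>"
    using Suc assms by (intro J_lipschitz[of a b] pc_Jn) auto
  also have "\<dots> \<le> ((b - a) ^ n * S) * (b - a)"
    using Suc.prems assms(1) S by (intro mult_left_mono mult_nonneg_nonneg) auto
  finally show ?case by (simp add: mult_ac)
qed (use assms in auto)

section \<open>The reduced operator and its stability\<close>

text \<open>Positivity is asked of the leading coefficient only. Lipschitz continuity of this
  coefficient is a separate hypothesis of those lemmas that freeze it on the elements of a
  partition.\<close>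

locale elliptic_form =
  fixes a b :: real and m :: nat and c :: "nat \<Rightarrow> real \<Rightarrow> real"
  assumes ab: "a < b"
    and c_cont: "\<And>k. k \<le> Suc m \<Longrightarrow> continuous_on {a..b} (c k)"
    and c_lead: "\<And>t. t \<in> {a..b} \<Longrightarrow> c (Suc m) t > 0"
begin

text \<open>
  With \<open>v\<close> and \<open>w\<close> the \<open>(m + 1)\<close>-fold primitives of \<open>g\<close> and \<open>h\<close>, integrate the lower order terms of
  the form by parts until they, too, are tested against \<open>h\<close>: the form becomes the integral of
  \<open>(red g) h\<close>, and \<open>red g\<close> is \<open>c (m + 1) g\<close> plus a Volterra operator.
\<close>

definition low_term :: "nat \<Rightarrow> (real \<Rightarrow> real) \<Rightarrow> real \<Rightarrow> real" where
  "low_term k g = Jn a (Suc m - k) (\<lambda>s. c k s * Jn a (Suc m - k) g s)"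

definition low :: "(real \<Rightarrow> real) \<Rightarrow> real \<Rightarrow> real" where
  "low g t = (\<Sum>k\<le>m. (-1) ^ (Suc m - k) * low_term k g t)"

definition red :: "(real \<Rightarrow> real) \<Rightarrow> real \<Rightarrow> real" where
  "red g t = c (Suc m) t * g t + low g t"

lemma pc_c: "k \<le> Suc m \<Longrightarrow> pc a b (c k)"
  using c_cont by (rule pc_continuous)

lemma pc_low_arg: "pc a b g \<Longrightarrow> k \<le> m \<Longrightarrow> pc a b (\<lambda>s. c k s * Jn a (Suc m - k) g s)"
  by (intro pc_mult pc_c pc_Jn) auto

lemma low_cont: "pc a b g \<Longrightarrow> continuous_on {a..b} (low g)"
  unfolding low_def[abs_def] low_term_def
  by (intro continuous_intros Jn_cont[OF pc_low_arg]) auto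

lemma pc_low: "pc a b g \<Longrightarrow> pc a b (low g)"
  by (rule pc_continuous[OF low_cont])

lemma pc_red: "pc a b g \<Longrightarrow> pc a b (red g)"
  unfolding red_def[abs_def] by (intro pc_add pc_mult pc_c pc_low) auto

lemma low_term_lin:
  assumes "pc a b f" "pc a b g" "t \<in> {a..b}" "k \<le> m"
  shows "low_term k (\<lambda>s. f s + r * g s) t = low_term k f t + r * low_term k g t"
proof -
  have "low_term k (\<lambda>s. f s + r * g s) t
      = Jn a (Suc m - k) (\<lambda>s. c k s * Jn a (Suc m - k) f s + r * (c k s * Jn a (Suc m - k) g s)) t"
    unfolding low_term_def using assms
    by (intro Jn_cong[of a b]) (auto simp: Jn_lin algebra_simps)
  then show ?thesis
    unfolding low_term_def
    using Jn_lin[OF pc_low_arg[OF assms(1,4)] pc_low_arg[OF assms(2,4)] assms(3)] by simp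
qed

lemma low_lin:
  assumes "pc a b f" "pc a b g" "t \<in> {a..b}"
  shows "low (\<lambda>s. f s + r * g s) t = low f t + r * low g t"
proof -
  have "low (\<lambda>s. f s + r * g s) t
      = (\<Sum>k\<le>m. (-1) ^ (Suc m - k) * low_term k f t + r * ((-1) ^ (Suc m - k) * low_term k g t))"
    unfolding low_def using low_term_lin[OF assms]
    by (intro sum.cong) (auto simp: algebra_simps)
  then show ?thesis by (simp add: low_def sum.distrib sum_distrib_left)
qed

lemma red_lin:
  assumes "pc a b f" "pc a b g" "t \<in> {a..b}"
  shows "red (\<lambda>s. f s + r * g s) t = red f t + r * red g t"
  using low_lin[OF assms] by (simp add: red_def algebra_simps)

lemma red_diff:
  assumes "pc a b f" "pc a b g" "t \<in> {a..b}"
  shows "red (\<lambda>s. f s - g s) t = red f t - red g t"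
  using red_lin[OF assms, of "-1"] by simp

lemma red_zero: "t \<in> {a..b} \<Longrightarrow> red (\<lambda>_. 0) t = 0"
  using red_diff[of "\<lambda>_. 0" "\<lambda>_. 0" t] by simp

lemma red_sum:
  assumes "finite I" "\<And>i. i \<in> I \<Longrightarrow> pc a b (f i)" "t \<in> {a..b}"
  shows "red (\<lambda>s. \<Sum>i\<in>I. r i * f i s) t = (\<Sum>i\<in>I. r i * red (f i) t)"
  using assms(1,2)
proof (induction I)
  case empty
  then show ?case using red_zero[OF assms(3)] by simp
next
  case (insert i I)
  have "red (\<lambda>s. (\<Sum>i\<in>I. r i * f i s) + r i * f i s) t = (\<Sum>i\<in>I. r i * red (f i) t) + r i * red (f i) t"
    using insert assms(3) by (subst red_lin) (auto intro!: pc_sum pc_cmult)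
  then show ?case using insert by (simp add: add.commute)
qed

lemma c_bound:
  obtains B where "B \<ge> 0" "\<And>k t. k \<le> Suc m \<Longrightarrow> t \<in> {a..b} \<Longrightarrow> \<bar>c k t\<bar> \<le> B"
proof -
  have "\<exists>B\<ge>0. \<forall>t\<in>{a..b}. \<bar>c k t\<bar> \<le> B" if "k \<le> Suc m" for k
    using pc_bound[OF pc_c[OF that]] by metis
  then obtain B where B: "\<And>k. k \<le> Suc m \<Longrightarrow> B k \<ge> 0 \<and> (\<forall>t\<in>{a..b}. \<bar>c k t\<bar> \<le> B k)" by metis
  show thesis
  proof (rule that[of "\<Sum>k\<le>Suc m. B k"])
    show "(\<Sum>k\<le>Suc m. B k) \<ge> 0" using B by (intro sum_nonneg) auto
    show "\<bar>c k t\<bar> \<le> (\<Sum>k\<le>Suc m. B k)" if k: "k \<le> Suc m" and t: "t \<in> {a..b}" for k t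
    proof -
      have "\<bar>c k t\<bar> \<le> B k" using B k t by blast
      also have "\<dots> \<le> (\<Sum>k\<le>Suc m. B k)" by (rule member_le_sum) (use B k in auto)
      finally show ?thesis .
    qed
  qed
qed

lemma c_lead_bound:
  obtains c0 where "c0 > 0" "\<And>t. t \<in> {a..b} \<Longrightarrow> c (Suc m) t \<ge> c0"
proof -
  have "{a..b} \<noteq> {}" using ab by simp
  then obtain s where "s \<in> {a..b}" "\<forall>t\<in>{a..b}. c (Suc m) s \<le> c (Suc m) t"
    using continuous_attains_inf[OF compact_Icc _ c_cont[of "Suc m"]] by auto
  then show thesis using c_lead by (intro that[of "c (Suc m) s"]) auto
qed

text \<open>The first estimate, with the integral up to \<open>t\<close>, is the Volterra property
  behind solvability and Gronwall's lemma. The second reflects that every lower order term ends with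
  an integration: \<open>low g\<close> is Lipschitz and can be frozen on an element at the cost of
  one step size.\<close>

lemma low_bounds:
  obtains M where "M \<ge> 0"
    "\<And>g t. pc a b g \<Longrightarrow> t \<in> {a..b} \<Longrightarrow> \<bar>low g t\<bar> \<le> M * J a (\<lambda>s. \<bar>g s\<bar>) t"
    "\<And>g s t. pc a b g \<Longrightarrow> s \<in> {a..b} \<Longrightarrow> t \<in> {a..b} \<Longrightarrow>
       \<bar>low g t - low g s\<bar> \<le> M * J a (\<lambda>s. \<bar>g s\<bar>) b * \<bar>t - s\<bar>"
proof -
  obtain B where B: "B \<ge> 0" "\<And>k t. k \<le> Suc m \<Longrightarrow> t \<in> {a..b} \<Longrightarrow> \<bar>c k t\<bar> \<le> B"
    using c_bound by blast
  let ?I = "\<lambda>g. J a (\<lambda>s. \<bar>g s\<bar>)"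
  \<comment> \<open>One power of \<open>b - a\<close> comes from the inner iterated integral and one
    from the outer; \<open>B\<close> bounds the coefficient between them.\<close>
  define q where "q k = (b - a) ^ (m - k) * (B * (b - a) ^ (m - k))" for k
  have q0: "q k \<ge> 0" for k using B(1) ab by (simp add: q_def)
  define M where "M = (\<Sum>k\<le>m. (b - a) * q k) + (\<Sum>k\<le>m. q k)"
  have M: "(\<Sum>k\<le>m. (b - a) * q k) \<le> M" "(\<Sum>k\<le>m. q k) \<le> M" "M \<ge> 0"
    using q0 ab by (auto simp: M_def intro!: sum_nonneg add_nonneg_nonneg)
  have I0: "?I g t \<ge> 0" if "pc a b g" "t \<in> {a..b}" for g t
    using J_abs_le[OF that] by linarith
  have arg: "\<bar>c k s * Jn a (Suc m - k) g s\<bar> \<le> B * (b - a) ^ (m - k) * ?I g t"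
    if "pc a b g" "k \<le> m" "s \<le> t" "s \<ge> a" "t \<in> {a..b}" for k g s t
  proof -
    have s: "s \<in> {a..b}" using that by auto
    have "\<bar>Jn a (Suc (m - k)) g s\<bar> \<le> (b - a) ^ (m - k) * ?I g s"
      using s by (intro Jn_abs_le that(1))
    also have "\<dots> \<le> (b - a) ^ (m - k) * ?I g t"
      using that ab by (intro mult_left_mono J_abs_mono) auto
    finally have "\<bar>c k s\<bar> * \<bar>Jn a (Suc m - k) g s\<bar> \<le> B * ((b - a) ^ (m - k) * ?I g t)"
      using B that(2) s by (intro mult_mono) (auto simp: Suc_diff_le)
    then show ?thesis by (simp add: abs_mult mult.assoc)
  qed
  have 1: "\<bar>low g t\<bar> \<le> M * ?I g t" if g: "pc a b g" and t: "t \<in> {a..b}" for g t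
  proof -
    have lt: "\<bar>low_term k g t\<bar> \<le> (b - a) * q k * ?I g t" if k: "k \<le> m" for k
    proof -
      let ?h = "\<lambda>s. c k s * Jn a (Suc m - k) g s"
      have "\<bar>low_term k g t\<bar> \<le> (b - a) ^ (m - k) * ?I ?h t"
        using Jn_abs_le[OF pc_low_arg[OF g k] t, of "m - k"] k by (simp add: low_term_def Suc_diff_le)
      also have "\<dots> \<le> (b - a) ^ (m - k) * J a (\<lambda>s. B * (b - a) ^ (m - k) * ?I g t) t"
        using t arg[OF g k] pc_low_arg[OF g k] ab
        by (intro mult_left_mono J_mono[of _ b] pc_abs) auto
      also have "\<dots> \<le> (b - a) ^ (m - k) * ((b - a) * (B * (b - a) ^ (m - k) * ?I g t))"
      proof (rule mult_left_mono)
        have "J a (\<lambda>s. B * (b - a) ^ (m - k) * ?I g t) t = (t - a) * (B * (b - a) ^ (m - k) * ?I g t)"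
          using t by (simp add: J_def)
        also have "\<dots> \<le> (b - a) * (B * (b - a) ^ (m - k) * ?I g t)"
          using t ab B(1) I0[OF g t] by (intro mult_right_mono) auto
        finally show "J a (\<lambda>s. B * (b - a) ^ (m - k) * ?I g t) t \<le> (b - a) * (B * (b - a) ^ (m - k) * ?I g t)" .
      qed (use ab in auto)
      finally show ?thesis by (simp add: q_def mult_ac)
    qed
    have "\<bar>low g t\<bar> \<le> (\<Sum>k\<le>m. \<bar>low_term k g t\<bar>)"
      unfolding low_def by (rule order_trans[OF sum_abs]) (simp add: abs_mult power_abs)
    also have "\<dots> \<le> (\<Sum>k\<le>m. (b - a) * q k * ?I g t)" using lt by (intro sum_mono) auto
    also have "\<dots> = (\<Sum>k\<le>m. (b - a) * q k) * ?I g t" by (simp add: sum_distrib_right)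
    also have "\<dots> \<le> M * ?I g t" using M I0[OF g t] by (intro mult_right_mono)
    finally show ?thesis .
  qed
  have 2: "\<bar>low g t - low g s\<bar> \<le> M * ?I g b * \<bar>t - s\<bar>"
    if g: "pc a b g" and s: "s \<in> {a..b}" and t: "t \<in> {a..b}" for g s t
  proof -
    have lt: "\<bar>low_term k g t - low_term k g s\<bar> \<le> q k * ?I g b * \<bar>t - s\<bar>" if k: "k \<le> m" for k
    proof -
      let ?h = "\<lambda>s. c k s * Jn a (Suc m - k) g s"
      have "\<bar>Jn a (m - k) ?h r\<bar> \<le> (b - a) ^ (m - k) * (B * (b - a) ^ (m - k) * ?I g b)"
        if "r \<in> {a..b}" for r
        using arg[OF g k, of _ b] ab that by (intro Jn_sup_le pc_low_arg g k) auto
      then have "\<bar>Jn a (m - k) ?h r\<bar> \<le> q k * ?I g b" if "r \<in> {a..b}" for r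
        using that by (simp add: q_def mult.assoc)
      from J_lipschitz[OF pc_Jn[OF pc_low_arg[OF g k]] this s t]
      show ?thesis using k by (simp add: low_term_def Suc_diff_le)
    qed
    have "low g t - low g s = (\<Sum>k\<le>m. (-1) ^ (Suc m - k) * (low_term k g t - low_term k g s))"
      by (simp add: low_def sum_subtractf right_diff_distrib)
    then have "\<bar>low g t - low g s\<bar> \<le> (\<Sum>k\<le>m. \<bar>low_term k g t - low_term k g s\<bar>)"
      by (simp only:) (rule order_trans[OF sum_abs], simp add: abs_mult power_abs)
    also have "\<dots> \<le> (\<Sum>k\<le>m. q k * ?I g b * \<bar>t - s\<bar>)" using lt by (intro sum_mono) auto
    also have "\<dots> = (\<Sum>k\<le>m. q k) * ?I g b * \<bar>t - s\<bar>" by (simp add: sum_distrib_right)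
    also have "\<dots> \<le> M * ?I g b * \<bar>t - s\<bar>"
      using M I0[OF g, of b] ab by (intro mult_right_mono) auto
    finally show ?thesis .
  qed
  show thesis using M(3) 1 2 by (rule that)
qed

lemma form_eq:
  assumes "rep a b (Suc m) v g" "rep a b (Suc m) w h" "orth a b m h"
  shows "bilin_form a b m c v w = integral {a..b} (\<lambda>t. red g t * h t)"
proof -
  have g: "pc a b g" and h: "pc a b h" using assms rep_pc by auto
  have ends: "Jn a i h b = 0" if "1 \<le> i" "i \<le> Suc m" for i
    using orth_iff_end_data[OF _ h, of m] assms(3) that ab by auto
  have lt: "pc a b (low_term k g)" if "k \<le> m" for k
    unfolding low_term_def using g that by (intro pc_Jn pc_low_arg)
  have summand: "integral {a..b} (\<lambda>t. c k t * Jn a (Suc m - k) g t * Jn a (Suc m - k) h t)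
      = integral {a..b} (\<lambda>t. (-1) ^ (Suc m - k) * low_term k g t * h t)" if k: "k \<le> m" for k
  proof -
    have "integral {a..b} (\<lambda>t. c k t * Jn a (Suc m - k) g t * Jn a (Suc m - k) h t)
        = (-1) ^ (Suc m - k) * integral {a..b} (\<lambda>t. low_term k g t * h t)"
      unfolding low_term_def using ab ends by (intro parts_Jn pc_low_arg g h k) auto
    then show ?thesis by (simp add: integral_mult_right[symmetric] mult.assoc del: integral_mult_right)
  qed
  have "bilin_form a b m c v w
      = (\<Sum>k\<le>m. integral {a..b} (\<lambda>t. (-1) ^ (Suc m - k) * low_term k g t * h t))
        + integral {a..b} (\<lambda>t. c (Suc m) t * g t * h t)"
    using rep_bilin[OF ab assms(1,2) c_cont] summand by simp
  also have "\<dots> = integral {a..b} (\<lambda>t. (\<Sum>k\<le>m. (-1) ^ (Suc m - k) * low_term k g t * h t) + c (Suc m) t * g t * h t)"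
  proof -
    have p: "pc a b (\<lambda>t. (-1) ^ (Suc m - k) * low_term k g t * h t)" if "k \<le> m" for k
      using lt[OF that] h by (intro pc_mult pc_const)
    have "integral {a..b} (\<lambda>t. \<Sum>k\<le>m. (-1) ^ (Suc m - k) * low_term k g t * h t)
        = (\<Sum>k\<le>m. integral {a..b} (\<lambda>t. (-1) ^ (Suc m - k) * low_term k g t * h t))"
      using p by (intro integral_sum pc_integrable) auto
    moreover have "pc a b (\<lambda>t. \<Sum>k\<le>m. (-1) ^ (Suc m - k) * low_term k g t * h t)"
      using p by (intro pc_sum) auto
    moreover have "pc a b (\<lambda>t. c (Suc m) t * g t * h t)"
      using g h by (intro pc_mult pc_c) auto
    ultimately show ?thesis by (simp add: integral_add pc_integrable)
  qed
  also have "\<dots> = integral {a..b} (\<lambda>t. red g t * h t)"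
    by (rule integral_cong) (simp add: red_def low_def sum_distrib_right sum_distrib_left algebra_simps)
  finally show ?thesis .
qed

text \<open>Division by the leading coefficient gives a Volterra equation of the second kind. No
  condition at \<open>b\<close> is imposed, so there is no solvability condition.\<close>

lemma red_solvable:
  assumes "continuous_on {a..b} f"
  obtains g where "continuous_on {a..b} g" "\<And>t. t \<in> {a..b} \<Longrightarrow> red g t = f t"
proof -
  obtain c0 where c0: "c0 > 0" "\<And>t. t \<in> {a..b} \<Longrightarrow> c (Suc m) t \<ge> c0" using c_lead_bound by blast
  obtain M where M: "M \<ge> 0" "\<And>g t. pc a b g \<Longrightarrow> t \<in> {a..b} \<Longrightarrow> \<bar>low g t\<bar> \<le> M * J a (\<lambda>s. \<bar>g s\<bar>) t"
    using low_bounds by metis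
  have ne: "c (Suc m) t \<noteq> 0" if "t \<in> {a..b}" for t using c_lead[OF that] by simp
  define T where "T g t = - (low g t / c (Suc m) t)" for g t
  obtain g where g: "continuous_on {a..b} g" "\<And>t. t \<in> {a..b} \<Longrightarrow> g t = f t / c (Suc m) t + T g t"
  proof (rule volterra_exists[of a b T "M / c0" "\<lambda>t. f t / c (Suc m) t"])
    show "continuous_on {a..b} (T g)" if "continuous_on {a..b} g" for g
      unfolding T_def[abs_def] using ne
      by (intro continuous_intros low_cont pc_continuous[OF that] c_cont) auto
    show "T (\<lambda>s. f s - g s) t = T f t - T g t"
      if "continuous_on {a..b} f" "continuous_on {a..b} g" "t \<in> {a..b}" for f g t
      using low_lin[OF pc_continuous[OF that(1)] pc_continuous[OF that(2)] that(3), of "-1"]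
      by (simp add: T_def diff_divide_distrib)
    show "\<bar>T g t\<bar> \<le> M / c0 * J a (\<lambda>s. \<bar>g s\<bar>) t" if "continuous_on {a..b} g" "t \<in> {a..b}" for g t
    proof -
      have "\<bar>T g t\<bar> = \<bar>low g t\<bar> / c (Suc m) t" using c_lead[OF that(2)] by (simp add: T_def)
      also have "\<dots> \<le> (M * J a (\<lambda>s. \<bar>g s\<bar>) t) / c0"
        using M(2)[OF pc_continuous[OF that(1)] that(2)] c0(1) c0(2)[OF that(2)]
        by (intro frac_le) (auto intro: order_trans[OF abs_ge_zero])
      finally show ?thesis by simp
    qed
    show "continuous_on {a..b} (\<lambda>t. f t / c (Suc m) t)"
      using ne by (intro continuous_intros assms c_cont) auto
  qed (use ab M c0 in auto)
  show thesis
  proof (rule that[OF g(1)])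
    fix t assume t: "t \<in> {a..b}"
    have "red g t = c (Suc m) t * (f t / c (Suc m) t + T g t) + low g t"
      unfolding red_def using g(2)[OF t] by simp
    then show "red g t = f t" using ne[OF t] by (simp add: T_def field_simps)
  qed
qed

text \<open>Again without conditions at \<open>b\<close>, hence no spectral obstruction. Gronwall's
  lemma first bounds the mean of \<open>y\<close>; inserted into the pointwise inequality
  \<open>pt\<close>, this gives the L2 bound.\<close>

lemma red_bounded_below:
  obtains C where "C \<ge> 0" "\<And>y. pc a b y \<Longrightarrow> J a (\<lambda>s. \<bar>y s\<bar>) b \<le> C * nrm a b (red y)"
    "\<And>y. pc a b y \<Longrightarrow> nrm a b y \<le> C * nrm a b (red y)"
proof -
  obtain c0 where c0: "c0 > 0" "\<And>t. t \<in> {a..b} \<Longrightarrow> c (Suc m) t \<ge> c0" using c_lead_bound by blast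
  obtain M where M: "M \<ge> 0" "\<And>g t. pc a b g \<Longrightarrow> t \<in> {a..b} \<Longrightarrow> \<bar>low g t\<bar> \<le> M * J a (\<lambda>s. \<bar>g s\<bar>) t"
    using low_bounds by metis
  \<comment> \<open>The exponential is the Gronwall factor; \<open>sqrt (b - a) / c0\<close>
    converts the mean of the scaled residual into an L2 norm.\<close>
  define E where "E = exp (M / c0 * (b - a)) * (sqrt (b - a) / c0)"
  define C where "C = E + (1 / c0 + M / c0 * E * sqrt (b - a))"
  have E: "E \<ge> 0" using c0 ab by (simp add: E_def)
  have C: "C \<ge> E" "C \<ge> 1 / c0 + M / c0 * E * sqrt (b - a)" using E M c0 ab by (auto simp: C_def)
  have pt: "\<bar>y t\<bar> \<le> \<bar>red y t / c0\<bar> + M / c0 * J a (\<lambda>s. \<bar>y s\<bar>) t"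
    if y: "pc a b y" and t: "t \<in> {a..b}" for y t
  proof -
    have "c0 * \<bar>y t\<bar> \<le> \<bar>c (Suc m) t\<bar> * \<bar>y t\<bar>"
      using c0(2)[OF t] by (intro mult_right_mono) auto
    also have "\<dots> = \<bar>red y t - low y t\<bar>" by (simp add: red_def abs_mult)
    also have "\<dots> \<le> \<bar>red y t\<bar> + M * J a (\<lambda>s. \<bar>y s\<bar>) t" using M(2)[OF y t] by linarith
    finally show ?thesis using c0(1) by (simp add: field_simps)
  qed
  have L1: "J a (\<lambda>s. \<bar>y s\<bar>) b \<le> E * nrm a b (red y)" if y: "pc a b y" for y
  proof -
    have "J a (\<lambda>s. \<bar>y s\<bar>) b \<le> exp (M / c0 * (b - a)) * J a (\<lambda>s. \<bar>red y s / c0\<bar>) b"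
      using pt[OF y] M(1) c0(1) pc_divide[OF pc_red[OF y], of "\<lambda>_. c0"]
      by (intro gronwall ab y) auto
    also have "J a (\<lambda>s. \<bar>red y s / c0\<bar>) b = J a (\<lambda>s. \<bar>red y s\<bar>) b / c0"
      using c0(1) by (simp add: J_def abs_divide)
    also have "\<dots> \<le> sqrt (b - a) * nrm a b (red y) / c0"
      using integral_abs_le_nrm[OF pc_red[OF y]] ab c0(1) by (simp add: J_def divide_right_mono)
    finally show ?thesis by (simp add: E_def mult_left_mono mult.assoc)
  qed
  have L2: "nrm a b y \<le> (1 / c0 + M / c0 * E * sqrt (b - a)) * nrm a b (red y)" if y: "pc a b y" for y
  proof -
    let ?R = "nrm a b (red y)"
    have R: "?R \<ge> 0" using pc_red[OF y] by simp
    have "nrm a b y \<le> nrm a b (\<lambda>t. 1 / c0 * \<bar>red y t\<bar> + M / c0 * (E * ?R))"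
    proof (rule nrm_le_off_finite[of _ _ _ _ "{}"])
      show "\<bar>y t\<bar> \<le> 1 / c0 * \<bar>red y t\<bar> + M / c0 * (E * ?R)" if "t \<in> {a..b} - {}" for t
      proof -
        have t: "t \<in> {a..b}" using that by simp
        have "M / c0 * J a (\<lambda>s. \<bar>y s\<bar>) t \<le> M / c0 * J a (\<lambda>s. \<bar>y s\<bar>) b"
          using t y M(1) c0(1) by (intro mult_left_mono J_abs_mono) auto
        also have "\<dots> \<le> M / c0 * (E * ?R)" using L1[OF y] M(1) c0(1) by (intro mult_left_mono) auto
        finally show ?thesis using pt[OF y t] c0(1) by simp
      qed
      show "pc a b (\<lambda>t. 1 / c0 * \<bar>red y t\<bar> + M / c0 * (E * ?R))"
        by (intro pc_add pc_cmult pc_abs pc_red y pc_const)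
    qed (use y in auto)
    also have "\<dots> \<le> nrm a b (\<lambda>t. 1 / c0 * \<bar>red y t\<bar>) + nrm a b (\<lambda>t. M / c0 * (E * ?R))"
      using y by (intro nrm_triangle pc_cmult pc_abs pc_red) auto
    also have "nrm a b (\<lambda>t. 1 / c0 * \<bar>red y t\<bar>) = 1 / c0 * ?R"
      using c0(1) nrm_cmult[of a b "1 / c0" "\<lambda>t. \<bar>red y t\<bar>"] by (simp add: nrm_def)
    also have "nrm a b (\<lambda>t. M / c0 * (E * ?R)) = M / c0 * (E * ?R) * sqrt (b - a)"
      using ab M(1) c0(1) E R by (simp add: nrm_def real_sqrt_mult abs_mult)
    finally show ?thesis by (simp add: algebra_simps)
  qed
  show thesis
  proof (rule that[of C])
    fix y assume y: "pc a b y"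
    have R: "nrm a b (red y) \<ge> 0" using pc_red[OF y] by simp
    show "J a (\<lambda>s. \<bar>y s\<bar>) b \<le> C * nrm a b (red y)"
      using L1[OF y] mult_right_mono[OF C(1) R] by linarith
    show "nrm a b y \<le> C * nrm a b (red y)"
      using L2[OF y] mult_right_mono[OF C(2) R] by linarith
  next
    show "C \<ge> 0" using E C by linarith
  qed
qed

text \<open>Let \<open>Z \<pi>\<close> solve the initial value problem with right-hand side \<pi>.
  Then \<open>g - Z \<pi>\<close> is controlled by the residual, and as \<open>g\<close> has no end
  data at \<open>b\<close>, the end data of \<open>Z \<pi>\<close> are controlled as well. By the
  assumed uniqueness these \<open>m + 1\<close> numbers determine \<pi>; in finite dimension they
  therefore bound its coefficients, and with them \<open>Z \<pi>\<close> and
  \<open>g\<close>.\<close>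

lemma stability:
  assumes unique: "\<And>g \<pi>. continuous_on {a..b} g \<Longrightarrow> orth a b m g \<Longrightarrow> degree \<pi> \<le> m \<Longrightarrow>
      (\<forall>t\<in>{a..b}. red g t = poly \<pi> t) \<Longrightarrow> (\<forall>t\<in>{a..b}. g t = 0)"
  obtains C where "C \<ge> 0" "\<And>g \<pi>. pc a b g \<Longrightarrow> orth a b m g \<Longrightarrow> degree \<pi> \<le> m \<Longrightarrow>
      nrm a b g \<le> C * nrm a b (\<lambda>t. red g t - poly \<pi> t)"
proof -
  have "\<exists>z. continuous_on {a..b} z \<and> (\<forall>t\<in>{a..b}. red z t = t ^ j)" for j :: nat
    using red_solvable[of "\<lambda>t. t ^ j"] continuous_on_power[OF continuous_on_id] by metis
  then obtain z where z: "\<And>j. continuous_on {a..b} (z j)" "\<And>j t. t \<in> {a..b} \<Longrightarrow> red (z j) t = t ^ j"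
    by metis
  have pz: "pc a b (z j)" for j using z(1) by (rule pc_continuous)
  define Z where "Z \<pi> t = (\<Sum>j\<le>m. coeff \<pi> j * z j t)" for \<pi> t
  have Zc: "continuous_on {a..b} (Z \<pi>)" for \<pi> unfolding Z_def[abs_def] by (intro continuous_intros z(1))
  have pZ: "pc a b (Z \<pi>)" for \<pi> using Zc by (rule pc_continuous)
  have rZ: "red (Z \<pi>) t = poly \<pi> t" if "degree \<pi> \<le> m" "t \<in> {a..b}" for \<pi> t
    using red_sum[of "{..m}" z t "coeff \<pi>"] pz that(2) z(2)[OF that(2)] poly_eq_sum_coeff[OF that(1)]
    by (simp add: Z_def[abs_def])
  define L where "L k \<pi> = Jn a k (Z \<pi>) b" for k \<pi>
  have Zlin: "Z (v + smult r w) = (\<lambda>t. Z v t + r * Z w t)" for v w r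
    by (rule ext) (simp add: Z_def distrib_right sum.distrib sum_distrib_left mult.assoc)
  have Llin: "L k (v + smult r w) = L k v + r * L k w" for k v w r
    unfolding L_def Zlin using ab by (intro Jn_lin[OF pZ pZ]) auto
  \<comment> \<open>If all end data vanish, then \<open>Z \<pi>\<close> is orthogonal to the
    polynomials of degree \<open>m\<close>, so uniqueness makes it 0, and \<pi>, being
    \<open>red (Z \<pi>)\<close>, is 0 too. Duality turns this injectivity into formulas for the
    coefficients.\<close>
  have "\<exists>\<kappa>. \<forall>\<pi>\<in>{\<pi>. degree \<pi> \<le> m}. coeff \<pi> j = (\<Sum>k\<in>{1..Suc m}. \<kappa> k * L k \<pi>)" for j
  proof (rule functional_in_span[where lin = "\<lambda>v r w. v + smult r w"])
    fix \<pi> assume "\<pi> \<in> {\<pi>. degree \<pi> \<le> m}" and L0: "\<And>k. k \<in> {1..Suc m} \<Longrightarrow> L k \<pi> = 0"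
    then have d: "degree \<pi> \<le> m" by simp
    have "orth a b m (Z \<pi>)"
      using L0 ab by (subst orth_iff_end_data) (auto simp: L_def intro: pZ)
    then have Z0: "Z \<pi> t = 0" if "t \<in> {a..b}" for t
      using unique[OF Zc _ d] rZ[OF d] that by blast
    have "poly \<pi> t = 0" if t: "t \<in> {a<..<b}" for t
    proof -
      have t': "t \<in> {a..b}" using t by simp
      have "\<bar>low (Z \<pi>) t\<bar> = 0"
      proof -
        have "low_term k (Z \<pi>) t = 0" if k: "k \<le> m" for k
        proof -
          have "Jn a (Suc m - k) (Z \<pi>) s = Jn a (Suc m - k) (\<lambda>_. 0) s" if "s \<in> {a..b}" for s
            using Z0 that by (intro Jn_cong[of a b]) auto
          moreover have J0: "Jn a n (\<lambda>_. 0) s = 0" if "s \<in> {a..b}" for n s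
            using Jn_sup_le[of a b "\<lambda>_. 0" 0 s n] ab that by simp
          ultimately have "low_term k (Z \<pi>) t = Jn a (Suc m - k) (\<lambda>_. 0) t"
            unfolding low_term_def using t' by (intro Jn_cong[of a b]) auto
          then show ?thesis using J0[OF t'] by simp
        qed
        then show ?thesis by (simp add: low_def)
      qed
      then show ?thesis using rZ[OF d t'] Z0[OF t'] by (simp add: red_def)
    qed
    then have "\<pi> = 0" using poly_eq_0_on_interval[OF ab] by blast
    then show "coeff \<pi> j = 0" by simp
  qed (use Llin in \<open>auto intro: degree_add_le order_trans[OF degree_smult_le]\<close>)
  then have "\<forall>j. \<exists>\<kappa>. \<forall>\<pi>\<in>{\<pi>. degree \<pi> \<le> m}. coeff \<pi> j = (\<Sum>k\<in>{1..Suc m}. \<kappa> k * L k \<pi>)" by blast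
  from choice[OF this] obtain \<kappa> where
    \<kappa>: "\<And>j \<pi>. degree \<pi> \<le> m \<Longrightarrow> coeff \<pi> j = (\<Sum>k\<in>{1..Suc m}. \<kappa> j k * L k \<pi>)" by blast
  obtain C0 where C0: "C0 \<ge> 0" "\<And>y. pc a b y \<Longrightarrow> J a (\<lambda>s. \<bar>y s\<bar>) b \<le> C0 * nrm a b (red y)"
    "\<And>y. pc a b y \<Longrightarrow> nrm a b y \<le> C0 * nrm a b (red y)"
    using red_bounded_below by blast
  \<comment> \<open>Each end datum of order \<open>k\<close> of \<open>y = g - Z \<pi>\<close> is at
    most \<open>(b - a) ^ (k - 1) * C0\<close> times the residual; \<kappa> passes this on to the
    coefficient of index \<open>j\<close>.\<close>
  define D where "D j = (\<Sum>k\<in>{1..Suc m}. \<bar>\<kappa> j k\<bar> * ((b - a) ^ (k - 1) * C0))" for j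
  have D0: "D j \<ge> 0" for j unfolding D_def using ab C0(1) by (intro sum_nonneg mult_nonneg_nonneg) auto
  define C where "C = C0 + (\<Sum>j\<le>m. D j * nrm a b (z j))"
  show thesis
  proof (rule that[of C])
    show "C \<ge> 0" unfolding C_def using C0(1) D0 pz by (intro add_nonneg_nonneg sum_nonneg mult_nonneg_nonneg) auto
    fix g \<pi> assume g: "pc a b g" "orth a b m g" and d: "degree (\<pi> :: real poly) \<le> m"
    define y where "y t = g t - Z \<pi> t" for t
    have y: "pc a b y" unfolding y_def[abs_def] using g(1) pZ by (rule pc_diff)
    define R where "R = nrm a b (\<lambda>t. red g t - poly \<pi> t)"
    have R: "nrm a b (red y) = R"
      unfolding R_def using red_diff[OF g(1) pZ[of \<pi>]] rZ[OF d]
      by (intro nrm_cong) (simp add: y_def[abs_def])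
    have Lk: "\<bar>L k \<pi>\<bar> \<le> (b - a) ^ (k - 1) * C0 * R" if k: "k \<in> {1..Suc m}" for k
    proof -
      have "Jn a k g b = 0" using orth_iff_end_data[OF _ g(1), of m] g(2) k ab by auto
      moreover have "Jn a k y b = Jn a k g b - L k \<pi>"
        unfolding y_def[abs_def] L_def using ab by (intro Jn_diff[OF g(1) pZ]) auto
      ultimately have "\<bar>L k \<pi>\<bar> = \<bar>Jn a k y b\<bar>" by simp
      also have "\<dots> \<le> (b - a) ^ (k - 1) * J a (\<lambda>s. \<bar>y s\<bar>) b"
        using Jn_abs_le[OF y, of b "k - 1"] ab k by (cases k) auto
      also have "\<dots> \<le> (b - a) ^ (k - 1) * (C0 * R)"
        using C0(2)[OF y] R ab by (intro mult_left_mono) auto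
      finally show ?thesis by (simp add: mult.assoc)
    qed
    have cf: "\<bar>coeff \<pi> j\<bar> \<le> D j * R" for j
    proof -
      have "\<bar>coeff \<pi> j\<bar> \<le> (\<Sum>k\<in>{1..Suc m}. \<bar>\<kappa> j k\<bar> * \<bar>L k \<pi>\<bar>)"
        unfolding \<kappa>[OF d] by (rule order_trans[OF sum_abs]) (simp add: abs_mult)
      also have "\<dots> \<le> (\<Sum>k\<in>{1..Suc m}. \<bar>\<kappa> j k\<bar> * ((b - a) ^ (k - 1) * C0 * R))"
        using Lk by (intro sum_mono mult_left_mono) auto
      finally show ?thesis by (simp only: D_def sum_distrib_right mult.assoc)
    qed
    have Zn: "nrm a b (\<lambda>t. \<Sum>j\<in>I. coeff \<pi> j * z j t) \<le> (\<Sum>j\<in>I. D j * R * nrm a b (z j))" if "finite I" for I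
      using that
    proof (induction I)
      case empty
      then show ?case by (simp add: nrm_def)
    next
      case (insert i I)
      have "nrm a b (\<lambda>t. \<Sum>j\<in>insert i I. coeff \<pi> j * z j t)
          = nrm a b (\<lambda>t. coeff \<pi> i * z i t + (\<Sum>j\<in>I. coeff \<pi> j * z j t))" using insert by simp
      also have "\<dots> \<le> nrm a b (\<lambda>t. coeff \<pi> i * z i t) + nrm a b (\<lambda>t. \<Sum>j\<in>I. coeff \<pi> j * z j t)"
        by (intro nrm_triangle pc_cmult pc_sum pz)
      also have "nrm a b (\<lambda>t. coeff \<pi> i * z i t) \<le> D i * R * nrm a b (z i)"
        unfolding nrm_cmult using cf pz by (intro mult_right_mono) auto
      finally show ?case using insert by simp
    qed
    have "nrm a b g = nrm a b (\<lambda>t. y t + Z \<pi> t)" by (simp add: y_def)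
    also have "\<dots> \<le> nrm a b y + nrm a b (Z \<pi>)" using y pZ by (rule nrm_triangle)
    also have "\<dots> \<le> C0 * R + (\<Sum>j\<le>m. D j * R * nrm a b (z j))"
      using C0(3)[OF y] R Zn[of "{..m}"] by (simp add: Z_def[abs_def])
    also have "\<dots> = C * R" by (simp add: C_def distrib_right distrib_left sum_distrib_right sum_distrib_left mult_ac)
    finally show "nrm a b g \<le> C * nrm a b (\<lambda>t. red g t - poly \<pi> t)" by (simp add: R_def)
  qed
qed

end

section \<open>Legendre polynomials and Hermite-Jacobi nodes\<close>

lemma integral_poly_pderiv:
  fixes l r :: real and P :: "real poly"
  assumes "l \<le> r"
  shows "integral {l..r} (poly (pderiv P)) = poly P r - poly P l"
  by (rule integral_unique, rule fundamental_theorem_of_calculus[OF assms])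
     (auto simp: has_real_derivative_iff_has_vector_derivative[symmetric]
       intro: has_field_derivative_at_within[OF poly_DERIV])

lemma poly_integrable: "poly (q :: real poly) integrable_on {l..r}"
  by (intro integrable_continuous_real continuous_intros)

lemma integral_poly_add:
  fixes l r :: real and p q :: "real poly"
  shows "integral {l..r} (poly (p + q)) = integral {l..r} (poly p) + integral {l..r} (poly q)"
  using integral_add[OF poly_integrable[of p] poly_integrable[of q]] by (simp add: poly_add[abs_def])

lemma integral_poly_smult:
  fixes l r :: real and q :: "real poly"
  shows "integral {l..r} (poly (smult k q)) = k * integral {l..r} (poly q)"
  using integral_mult_right[of "{l..r}" k "poly q"] by (simp add: poly_smult[abs_def])

lemma integral_poly_0 [simp]: "integral {l..r :: real} (poly (0 :: real poly)) = 0"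
  using integral_poly_smult[of l r 0 0] by simp

lemma poly_parts_n:
  fixes F q :: "real poly"
  assumes "l \<le> r" "\<And>i. i < n \<Longrightarrow> poly ((pderiv ^^ i) F) l = 0 \<and> poly ((pderiv ^^ i) F) r = 0"
  shows "integral {l..r} (poly ((pderiv ^^ n) F * q)) = (-1) ^ n * integral {l..r} (poly (F * (pderiv ^^ n) q))"
  using assms(2)
proof (induction n arbitrary: q)
  case (Suc n)
  let ?G = "(pderiv ^^ n) F"
  have "pderiv ?G * q = pderiv (?G * q) + smult (-1) (?G * pderiv q)"
    by (simp add: pderiv_mult mult.commute)
  then have "integral {l..r} (poly (pderiv ?G * q))
      = poly (?G * q) r - poly (?G * q) l + (-1) * integral {l..r} (poly (?G * pderiv q))"
    using assms(1) by (simp only: integral_poly_add integral_poly_smult integral_poly_pderiv)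
  moreover have "poly (?G * q) r = 0" "poly (?G * q) l = 0" using Suc.prems[of n] by auto
  moreover have "integral {l..r} (poly (?G * pderiv q))
      = (-1) ^ n * integral {l..r} (poly (F * (pderiv ^^ n) (pderiv q)))"
    using Suc.prems by (intro Suc.IH) auto
  moreover have "(pderiv ^^ n) (pderiv q) = (pderiv ^^ Suc n) q" "pderiv ?G = (pderiv ^^ Suc n) F"
    by (simp_all add: funpow_swap1)
  ultimately show ?case by (simp del: poly_mult funpow.simps)
qed simp

text \<open>Each differentiation lowers the power of \<open>w\<close> by at most one. For
  \<open>w = endw\<close> this supplies the vanishing boundary terms in all integrations by parts
  below.\<close>

lemma higher_pderiv_power_mult:
  fixes w s :: "real poly"
  assumes "i \<le> n"
  shows "\<exists>s'. (pderiv ^^ i) (w ^ n * s) = w ^ (n - i) * s'"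
  using assms
proof (induction i)
  case (Suc i)
  then obtain s' where "(pderiv ^^ i) (w ^ n * s) = w ^ (n - i) * s'" by auto
  moreover define k where "k = n - Suc i"
  ultimately have "(pderiv ^^ i) (w ^ n * s) = w ^ Suc k * s'" using Suc.prems by (simp add: Suc_diff_Suc)
  then have "(pderiv ^^ Suc i) (w ^ n * s) = pderiv (w ^ Suc k * s')" by simp
  also have "\<dots> = w ^ k * (smult (of_nat (Suc k)) (pderiv w * s') + w * pderiv s')"
    unfolding pderiv_mult pderiv_power_Suc by (simp add: algebra_simps)
  finally have "(pderiv ^^ Suc i) (w ^ n * s)
      = w ^ (n - Suc i) * (smult (of_nat (Suc k)) (pderiv w * s') + w * pderiv s')"
    by (simp only: k_def)
  then show ?case by blast
qed auto

abbreviation endw :: "real poly" where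
  "endw \<equiv> [:-1, 0, 1:]"

lemma endw_power_ends:
  assumes "i < n"
  shows "poly ((pderiv ^^ i) (endw ^ n * s)) (-1) = 0 \<and> poly ((pderiv ^^ i) (endw ^ n * s)) 1 = 0"
  using higher_pderiv_power_mult[of i n endw s] assms by auto

lemma higher_pderiv_eq_0:
  "degree (q :: real poly) < n \<Longrightarrow> (pderiv ^^ n) q = 0"
proof (induction n arbitrary: q)
  case (Suc n)
  then show ?case
  proof (cases "degree q = 0")
    case True
    then have "pderiv q = 0" by (simp add: pderiv_eq_0_iff)
    then show ?thesis by (simp add: funpow_Suc_right del: funpow.simps)
  next
    case False
    then have "(pderiv ^^ n) (pderiv q) = 0" using Suc by (intro Suc.IH) (simp add: degree_pderiv)
    then show ?thesis by (simp add: funpow_Suc_right del: funpow.simps)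
  qed
qed simp

lemma degree_higher_pderiv: "degree ((pderiv ^^ n) (q :: real poly)) = degree q - n"
  by (induction n) (auto simp: degree_pderiv)

lemma higher_pderiv_nonzero:
  fixes q :: "real poly"
  assumes "q \<noteq> 0" "k \<le> degree q"
  shows "(pderiv ^^ k) q \<noteq> 0"
proof
  assume "(pderiv ^^ k) q = 0"
  then have "pochhammer (of_nat (Suc (degree q - k))) k * coeff q (degree q - k + k) = 0"
    by (metis coeff_0 coeff_higher_pderiv)
  then show False using assms by (auto simp: pochhammer_eq_0_iff)
qed

lemma degree_endw_power: "degree (endw ^ n) = 2 * n"
  by (simp add: degree_power_eq)

lemma degree_legendre: "degree (legendre_poly n) = n"
  by (simp add: legendre_poly_def degree_higher_pderiv degree_endw_power)

lemma legendre_orth: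
  assumes "degree q < n"
  shows "integral {-1..1} (poly (legendre_poly n * q)) = 0"
proof -
  have "integral {-1..1} (poly ((pderiv ^^ n) (endw ^ n) * q))
      = (-1) ^ n * integral {-1..1} (poly (endw ^ n * (pderiv ^^ n) q))"
    using endw_power_ends[of _ n 1] by (intro poly_parts_n) auto
  then show ?thesis
    using higher_pderiv_eq_0[OF assms] by (simp add: legendre_poly_def integral_poly_smult del: poly_smult)
qed

text \<open>
  The derivative of order \<open>m + 1\<close> of the nodal polynomial is, up to a factor, the Legendre polynomial
  of degree \<open>p - m\<close>; only the resulting orthogonality is needed.
\<close>

definition nodal :: "nat \<Rightarrow> nat \<Rightarrow> real poly" where
  "nodal p m = endw ^ Suc m * (pderiv ^^ Suc m) (legendre_poly (p - m))"

text \<open>With \<open>D\<close> for differentiation, the operator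
  \<open>D ^ (m + 1) (x\<^sup>2 - 1) ^ (m + 1) D ^ (m + 1)\<close> is symmetric up to sign and does
  not raise degrees. Applied to the Legendre polynomial it gives the left factor; moved over to
  \<open>q\<close> it yields a polynomial of degree below \<open>p - m\<close>, to which the
  Legendre polynomial is orthogonal. If \<open>q\<close> has degree at most \<open>m\<close>, the
  first integrations by parts already annihilate it.\<close>

lemma nodal_orth:
  assumes "degree q < p - m"
  shows "integral {-1..1} (poly ((pderiv ^^ Suc m) (nodal p m) * q)) = 0"
proof (cases "degree q < Suc m")
  case True
  then show ?thesis
    using poly_parts_n[of "-1" 1 "Suc m" "nodal p m" q] endw_power_ends[of _ "Suc m"]
      higher_pderiv_eq_0[OF True] by (simp add: nodal_def del: funpow.simps power_Suc)
next
  case False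
  let ?L = "legendre_poly (p - m)" and ?d = "(pderiv ^^ Suc m) q"
  let ?F = "endw ^ Suc m * ?d"
  have "degree ((pderiv ^^ Suc m) ?F) \<le> (2 * Suc m + (degree q - Suc m)) - Suc m"
    unfolding degree_higher_pderiv[of "Suc m" ?F]
    using degree_mult_le[of "endw ^ Suc m" ?d] degree_endw_power[of "Suc m"] degree_higher_pderiv[of "Suc m" q]
    by (intro diff_le_mono) (simp del: power_Suc funpow.simps)
  also have "\<dots> = degree q" using False by simp
  finally have deg: "degree ((pderiv ^^ Suc m) ?F) < p - m" using assms by simp
  have "integral {-1..1} (poly ((pderiv ^^ Suc m) (nodal p m) * q))
      = (-1) ^ Suc m * integral {-1..1} (poly (nodal p m * ?d))"
    using endw_power_ends[of _ "Suc m"] unfolding nodal_def by (intro poly_parts_n) auto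
  also have "nodal p m * ?d = ?F * (pderiv ^^ Suc m) ?L" by (simp add: nodal_def mult_ac del: power_Suc funpow.simps)
  also have "(-1) ^ Suc m * integral {-1..1} (poly (?F * (pderiv ^^ Suc m) ?L))
      = integral {-1..1} (poly ((pderiv ^^ Suc m) ?F * ?L))"
    using endw_power_ends[of _ "Suc m" ?d] by (intro poly_parts_n[symmetric]) auto
  also have "\<dots> = 0" using legendre_orth[OF deg] by (simp only: mult.commute)
  finally show ?thesis .
qed

text \<open>The degree is exactly one more than that of the interpolant, so a multiple of the nodal
  polynomial can cancel the term of degree \<open>p + 1\<close> of a Taylor polynomial without
  changing interpolation data.\<close>

lemma nodal_degree:
  assumes "p \<ge> 2 * m + 1"
  shows "degree (nodal p m) = Suc p" "nodal p m \<noteq> 0"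
proof -
  let ?L = "(pderiv ^^ Suc m) (legendre_poly (p - m))"
  have "legendre_poly (p - m) \<noteq> 0" using degree_legendre[of "p - m"] assms by auto
  then have L: "?L \<noteq> 0" using assms by (intro higher_pderiv_nonzero) (auto simp: degree_legendre)
  have e: "endw ^ Suc m \<noteq> 0" by (rule power_not_zero) simp
  show "nodal p m \<noteq> 0" unfolding nodal_def using L e by (simp only: mult_eq_0_iff) simp
  have "degree (nodal p m) = 2 * Suc m + (p - m - Suc m)"
    unfolding nodal_def degree_mult_eq[OF e L] degree_endw_power degree_higher_pderiv degree_legendre ..
  then show "degree (nodal p m) = Suc p" using assms by simp
qed

section \<open>Location of the Hermite-Jacobi nodes and unisolvence of the interpolation
  conditions\<close>

lemma rolle_roots:
  fixes f :: "real poly"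
  assumes "finite A" "card A = Suc k" "\<And>x. x \<in> A \<Longrightarrow> poly f x = 0"
  shows "\<exists>B. finite B \<and> card B = k \<and> (\<forall>y\<in>B. poly (pderiv f) y = 0 \<and> (\<exists>x\<in>A. \<exists>z\<in>A. x < y \<and> y < z))"
  using assms
proof (induction k arbitrary: A)
  case 0
  then show ?case by (intro exI[of _ "{}"]) auto
next
  case (Suc k)
  define M where "M = Max A"
  have ne: "A \<noteq> {}" using Suc.prems by auto
  have M: "M \<in> A" using Suc.prems ne by (simp add: M_def)
  define A' where "A' = A - {M}"
  have A': "finite A'" "card A' = Suc k" using Suc.prems M by (auto simp: A'_def)
  then obtain B where B: "finite B" "card B = k"
    "\<forall>y\<in>B. poly (pderiv f) y = 0 \<and> (\<exists>x\<in>A'. \<exists>z\<in>A'. x < y \<and> y < z)"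
    using Suc.IH[OF A'] Suc.prems(3) unfolding A'_def by blast
  define M' where "M' = Max A'"
  have "A' \<noteq> {}" using A' by auto
  then have M': "M' \<in> A'" "\<And>z. z \<in> A' \<Longrightarrow> z \<le> M'" using A' by (auto simp: M'_def)
  have "M' \<le> M" using M'(1) Suc.prems(1) by (auto simp: A'_def M_def)
  then have lt: "M' < M" using M'(1) by (auto simp: A'_def less_le)
  have "poly f M' = poly f M" using Suc.prems(3) M M'(1) by (simp add: A'_def)
  then obtain y where y: "M' < y" "y < M" "(poly f has_real_derivative 0) (at y)"
    using Rolle[OF lt, of "poly f"] poly_DERIV[of f] continuous_on_poly[OF continuous_on_id]
    unfolding real_differentiable_def by blast
  then have "poly (pderiv f) y = 0" using DERIV_unique poly_DERIV by blast
  moreover have "y \<notin> B" using B(3) M'(2) y(1) by force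
  ultimately show ?case using B y M M'(1)
    by (intro exI[of _ "insert y B"]) (auto simp: A'_def)
qed

text \<open>Rolle's theorem for the derivatives of \<open>endw ^ n\<close>. Up to order
  \<open>n\<close> each derivative gains an interior root, because both end points are still roots
  of the one before; beyond order \<open>n\<close>, where the Legendre polynomial starts, every
  differentiation loses one.\<close>

lemma legendre_deriv_roots:
  assumes "j \<le> n"
  obtains A where "finite A" "card A = n - j" "A \<subseteq> {-1<..<1}"
    "\<And>x. x \<in> A \<Longrightarrow> poly ((pderiv ^^ j) (legendre_poly n)) x = 0"
proof -
  have up: "\<exists>A. finite A \<and> card A = i \<and> A \<subseteq> {-1<..<1} \<and> (\<forall>x\<in>A. poly ((pderiv ^^ i) (endw ^ n)) x = 0)"
    if "i \<le> n" for i
    using that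
  proof (induction i)
    case 0
    then show ?case by (intro exI[of _ "{}"]) auto
  next
    case (Suc i)
    then obtain A where A: "finite A" "card A = i" "A \<subseteq> {-1<..<1}"
      "\<forall>x\<in>A. poly ((pderiv ^^ i) (endw ^ n)) x = 0" by auto
    let ?A = "insert (-1) (insert 1 A)"
    have fA: "finite ?A" "card ?A = Suc (Suc i)" using A by (auto simp: card_insert_if)
    have zA: "poly ((pderiv ^^ i) (endw ^ n)) x = 0" if "x \<in> ?A" for x
      using that A(4) endw_power_ends[of i n 1] Suc.prems by auto
    from rolle_roots[OF fA zA] obtain B where B: "finite B" "card B = Suc i"
      "\<forall>y\<in>B. poly (pderiv ((pderiv ^^ i) (endw ^ n))) y = 0 \<and> (\<exists>x\<in>?A. \<exists>z\<in>?A. x < y \<and> y < z)"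
      by blast
    have "?A \<subseteq> {-1..1}" using A(3) by auto
    then have "B \<subseteq> {-1<..<1}" using B(3) by force
    then show ?case using B by (intro exI[of _ B]) auto
  qed
  have "\<exists>A. finite A \<and> card A = n - j \<and> A \<subseteq> {-1<..<1} \<and> (\<forall>x\<in>A. poly ((pderiv ^^ (j + n)) (endw ^ n)) x = 0)"
    using assms
  proof (induction j)
    case 0
    then show ?case using up[of n] by simp
  next
    case (Suc j)
    then obtain A where A: "finite A" "card A = Suc (n - Suc j)" "A \<subseteq> {-1<..<1}"
      "\<And>x. x \<in> A \<Longrightarrow> poly ((pderiv ^^ (j + n)) (endw ^ n)) x = 0" by (auto simp: Suc_diff_Suc)
    from rolle_roots[OF A(1,2,4)] obtain B where B: "finite B" "card B = n - Suc j"
      "\<forall>y\<in>B. poly (pderiv ((pderiv ^^ (j + n)) (endw ^ n))) y = 0 \<and> (\<exists>x\<in>A. \<exists>z\<in>A. x < y \<and> y < z)"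
      by blast
    then have "B \<subseteq> {-1<..<1}" using A(3) by force
    then show ?case using B by (intro exI[of _ B]) auto
  qed
  then obtain A where "finite A" "card A = n - j" "A \<subseteq> {-1<..<1}"
    "\<forall>x\<in>A. poly ((pderiv ^^ (j + n)) (endw ^ n)) x = 0" by blast
  then show thesis
    by (intro that[of A]) (auto simp: legendre_poly_def higher_pderiv_smult funpow_add)
qed

lemma order_from_derivs:
  fixes r :: "real poly"
  assumes "\<And>i. i \<le> k \<Longrightarrow> poly ((pderiv ^^ i) r) x = 0"
  shows "[:-x, 1:] ^ Suc k dvd r"
  using assms
proof (induction k arbitrary: r)
  case 0
  then show ?case by (simp add: poly_eq_0_iff_dvd)
next
  case (Suc k)
  have "poly ((pderiv ^^ i) (pderiv r)) x = 0" if "i \<le> k" for i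
    using Suc.prems[of "Suc i"] that by (simp add: funpow_Suc_right del: funpow.simps)
  then have dvd: "[:-x, 1:] ^ Suc k dvd pderiv r" by (rule Suc.IH)
  have rx: "poly r x = 0" using Suc.prems[of 0] by simp
  show ?case
  proof (cases "pderiv r = 0")
    case True
    then obtain s where "r = [:s:]" by (metis degree_eq_zeroE pderiv_eq_0_iff)
    then show ?thesis using rx by simp
  next
    case False
    then have "r \<noteq> 0" by auto
    have "order x r = Suc (order x (pderiv r))" using \<open>r \<noteq> 0\<close> rx by (rule order_pderiv)
    moreover have "Suc k \<le> order x (pderiv r)" using dvd False order_divides[of x "Suc k" "pderiv r"] by blast
    ultimately show ?thesis using \<open>r \<noteq> 0\<close> by (subst order_divides) simp
  qed
qed

text \<open>The end conditions split off both linear factors to the power \<open>m + 1\<close>. The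
  cofactor vanishes on \<open>A\<close>, but its degree is at most \<open>p - 2 * m - 2\<close>,
  below the number of points of \<open>A\<close>.\<close>

lemma hermite_unisolvent:
  fixes r :: "real poly"
  assumes "degree r \<le> p" "p \<ge> 2 * m + 1" "finite A" "card A = p - 2 * m - 1" "A \<subseteq> {-1<..<1}"
    and ends: "\<And>k. k \<le> m \<Longrightarrow> poly ((pderiv ^^ k) r) (-1) = 0"
      "\<And>k. k \<le> m \<Longrightarrow> poly ((pderiv ^^ k) r) 1 = 0"
    and nodes: "\<And>x. x \<in> A \<Longrightarrow> poly r x = 0"
  shows "r = 0"
proof (rule ccontr)
  assume r: "r \<noteq> 0"
  obtain s where s: "r = [:-1, 1:] ^ Suc m * s" using order_from_derivs[OF ends(2), of m] by (auto elim: dvdE)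
  have s0: "s \<noteq> 0" using r s by auto
  have "[:-(-1), 1:] ^ Suc m dvd r" using order_from_derivs[OF ends(1), of m] by simp
  then have "Suc m \<le> order (-1) r" using r order_divides[of "-1" "Suc m" r] by blast
  also have "order (-1) r = order (-1) ([:-1, 1 :: real:] ^ Suc m) + order (-1) s"
    unfolding s by (rule order_mult) (use s r in simp)
  also have "order (-1) ([:-1, 1 :: real:] ^ Suc m) = 0" by (rule order_0I) simp
  finally have "[:1, 1:] ^ Suc m dvd s" using order_divides[of "-1" "Suc m" s] by simp
  then obtain q where q: "s = [:1, 1:] ^ Suc m * q" by (auto elim: dvdE)
  have q0: "q \<noteq> 0" using q s0 by auto
  have "degree r = Suc m + (Suc m + degree q)"
    unfolding s q using q0 by (simp add: degree_mult_eq degree_power_eq del: power_Suc)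
  then have "degree q < card A" using assms by simp
  moreover have "A \<subseteq> {x. poly q x = 0}"
  proof
    fix x assume x: "x \<in> A"
    then have "x - 1 \<noteq> 0" "x + 1 \<noteq> 0" using assms(5) by auto
    then show "x \<in> {x. poly q x = 0}"
      using nodes[OF x] unfolding s q by (simp add: add.commute del: power_Suc)
  qed
  then have "card A \<le> degree q"
    using card_poly_roots_bound[OF q0] card_mono[OF poly_roots_finite[OF q0]] by (meson le_trans)
  ultimately show False by simp
qed

section \<open>The interpolation error\<close>

lemma poly_deriv_bound_from_coeffs:
  obtains D where "D \<ge> 0"
    "\<And>(r :: real poly) i x K. degree r \<le> n \<Longrightarrow> (\<And>j. \<bar>coeff r j\<bar> \<le> K) \<Longrightarrow> i \<le> M \<Longrightarrow> x \<in> {-1..1} \<Longrightarrow>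
       \<bar>poly ((pderiv ^^ i) r) x\<bar> \<le> D * K"
proof -
  have "\<exists>B\<ge>0. \<forall>x\<in>{-1..1}. \<bar>poly ((pderiv ^^ i) (monom 1 j)) x\<bar> \<le> (B :: real)" for i j
    using pc_bound[OF pc_poly[of "-1" 1 "(pderiv ^^ i) (monom 1 j)"]] by metis
  then obtain B where B: "\<And>i j. B i j \<ge> 0"
    "\<And>i j x. x \<in> {-1..1} \<Longrightarrow> \<bar>poly ((pderiv ^^ i) (monom 1 j)) x\<bar> \<le> (B i j :: real)"
    by metis
  define D where "D = (\<Sum>i\<le>M. \<Sum>j\<le>n. B i j)"
  show thesis
  proof (rule that[of D])
    show "D \<ge> 0" unfolding D_def using B(1) by (intro sum_nonneg)
    fix r :: "real poly" and i :: nat and x K :: real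
    assume r: "degree r \<le> n" "\<And>j. \<bar>coeff r j\<bar> \<le> K" and i: "i \<le> M" and x: "x \<in> {-1..1}"
    have K: "K \<ge> 0" using r(2)[of 0] by linarith
    have "r = (\<Sum>j\<le>n. smult (coeff r j) (monom 1 j))"
      using poly_as_sum_of_monoms'[OF r(1)] by (simp add: smult_monom)
    then have "(pderiv ^^ i) r = (\<Sum>j\<le>n. smult (coeff r j) ((pderiv ^^ i) (monom 1 j)))"
      by (metis (no_types, lifting) higher_pderiv_smult higher_pderiv_sum sum.cong)
    then have "\<bar>poly ((pderiv ^^ i) r) x\<bar> = \<bar>\<Sum>j\<le>n. coeff r j * poly ((pderiv ^^ i) (monom 1 j)) x\<bar>"
      by (simp add: poly_sum)
    also have "\<dots> \<le> (\<Sum>j\<le>n. \<bar>coeff r j\<bar> * \<bar>poly ((pderiv ^^ i) (monom 1 j)) x\<bar>)"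
      by (rule order_trans[OF sum_abs]) (simp add: abs_mult)
    also have "\<dots> \<le> (\<Sum>j\<le>n. K * B i j)"
      using r(2) B(2)[OF x] K by (intro sum_mono mult_mono) auto
    also have "\<dots> = K * (\<Sum>j\<le>n. B i j)" by (simp add: sum_distrib_left)
    also have "\<dots> \<le> K * D"
      unfolding D_def using i B(1) K
      by (intro mult_left_mono member_le_sum[of i _ "\<lambda>i. \<Sum>j\<le>n. B i j"] sum_nonneg) auto
    finally show "\<bar>poly ((pderiv ^^ i) r) x\<bar> \<le> D * K" by (simp add: mult.commute)
  qed
qed

lemma higher_pderiv_diff:
  fixes f g :: "real poly"
  shows "(pderiv ^^ n) (f - g) = (pderiv ^^ n) f - (pderiv ^^ n) g"
  by (induction n) (simp_all add: pderiv_diff)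

text \<open>Unisolvence and finite-dimensional duality express each coefficient as a fixed
  combination of the interpolation data. The bound reaches the derivative of order
  \<open>m + 1\<close>, one order beyond the data, as the energy norm requires.\<close>

lemma hermite_bound:
  assumes "p \<ge> 2 * m + 1" "finite A" "card A = p - 2 * m - 1" "A \<subseteq> {-1<..<1}"
  obtains K where "K \<ge> 0"
    "\<And>(r :: real poly) \<delta> i x. degree r \<le> p \<Longrightarrow>
      (\<And>k. k \<le> m \<Longrightarrow> \<bar>poly ((pderiv ^^ k) r) (-1)\<bar> \<le> \<delta> \<and> \<bar>poly ((pderiv ^^ k) r) 1\<bar> \<le> \<delta>) \<Longrightarrow>
      (\<And>x. x \<in> A \<Longrightarrow> \<bar>poly r x\<bar> \<le> \<delta>) \<Longrightarrow> i \<le> Suc m \<Longrightarrow> x \<in> {-1..1} \<Longrightarrow>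
      \<bar>poly ((pderiv ^^ i) r) x\<bar> \<le> K * \<delta>"
proof -
  \<comment> \<open>A pair \<open>(k, x)\<close> stands for the derivative of order \<open>k\<close>
    at \<open>x\<close>: Hermite data at both ends, values at the interior nodes.\<close>
  define I where "I = {..m} \<times> {-1, 1 :: real} \<union> {0} \<times> A"
  have I: "finite I" using assms(2) by (simp add: I_def)
  define L where "L = (\<lambda>(k, x :: real) (r :: real poly). poly ((pderiv ^^ k) r) x)"
  let ?S = "{r :: real poly. degree r \<le> p}"
  have "\<exists>\<kappa>. \<forall>r\<in>?S. coeff r j = (\<Sum>i\<in>I. \<kappa> i * L i r)" for j
  proof (rule functional_in_span[where lin = "\<lambda>v r w. v + smult r w", OF I])
    fix r assume r: "r \<in> ?S" and z: "\<And>i. i \<in> I \<Longrightarrow> L i r = 0"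
    have "r = 0"
    proof (rule hermite_unisolvent[OF _ assms])
      show "poly ((pderiv ^^ k) r) (-1) = 0" "poly ((pderiv ^^ k) r) 1 = 0" if "k \<le> m" for k
        using z[of "(k, -1)"] z[of "(k, 1)"] that by (auto simp: I_def L_def)
      show "poly r x = 0" if "x \<in> A" for x using z[of "(0, x)"] that by (auto simp: I_def L_def)
    qed (use r in auto)
    then show "coeff r j = 0" by simp
  qed (auto simp: L_def higher_pderiv_add higher_pderiv_smult
      intro: degree_add_le order_trans[OF degree_smult_le])
  then have "\<forall>j. \<exists>\<kappa>. \<forall>r\<in>?S. coeff r j = (\<Sum>i\<in>I. \<kappa> i * L i r)" by blast
  from choice[OF this] obtain \<kappa> where \<kappa>: "\<And>j r. r \<in> ?S \<Longrightarrow> coeff r j = (\<Sum>i\<in>I. \<kappa> j i * L i r)" by blast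
  define K0 where "K0 = (\<Sum>j\<le>p. \<Sum>i\<in>I. \<bar>\<kappa> j i\<bar>)"
  obtain D where D: "D \<ge> 0"
    "\<And>(r :: real poly) i x K. degree r \<le> p \<Longrightarrow> (\<And>j. \<bar>coeff r j\<bar> \<le> K) \<Longrightarrow> i \<le> Suc m \<Longrightarrow> x \<in> {-1..1} \<Longrightarrow>
       \<bar>poly ((pderiv ^^ i) r) x\<bar> \<le> D * K"
    using poly_deriv_bound_from_coeffs[of p "Suc m"] by blast
  show thesis
  proof (rule that[of "D * K0"])
    show "D * K0 \<ge> 0" unfolding K0_def using D(1) by (intro mult_nonneg_nonneg sum_nonneg) auto
    fix r :: "real poly" and \<delta> x :: real and i :: nat
    assume r: "degree r \<le> p"
      and ends: "\<And>k. k \<le> m \<Longrightarrow> \<bar>poly ((pderiv ^^ k) r) (-1)\<bar> \<le> \<delta> \<and> \<bar>poly ((pderiv ^^ k) r) 1\<bar> \<le> \<delta>"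
      and nodes: "\<And>x. x \<in> A \<Longrightarrow> \<bar>poly r x\<bar> \<le> \<delta>" and i: "i \<le> Suc m" and x: "x \<in> {-1..1}"
    have \<delta>: "\<delta> \<ge> 0" using ends[of 0] by auto
    have L: "\<bar>L i r\<bar> \<le> \<delta>" if "i \<in> I" for i using that ends nodes by (auto simp: I_def L_def)
    have "\<bar>coeff r j\<bar> \<le> K0 * \<delta>" for j
    proof (cases "j \<le> p")
      case True
      have "\<bar>coeff r j\<bar> \<le> (\<Sum>i\<in>I. \<bar>\<kappa> j i\<bar> * \<bar>L i r\<bar>)"
        using \<kappa>[of r j] r by (simp add: order_trans[OF sum_abs] abs_mult)
      also have "\<dots> \<le> (\<Sum>i\<in>I. \<bar>\<kappa> j i\<bar> * \<delta>)" using L by (intro sum_mono mult_left_mono) auto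
      also have "\<dots> = (\<Sum>i\<in>I. \<bar>\<kappa> j i\<bar>) * \<delta>" by (simp add: sum_distrib_right)
      also have "\<dots> \<le> K0 * \<delta>"
        unfolding K0_def using True \<delta>
        by (intro mult_right_mono member_le_sum[of j _ "\<lambda>j. \<Sum>i\<in>I. \<bar>\<kappa> j i\<bar>"] sum_nonneg) auto
      finally show ?thesis .
    next
      case False
      then have "coeff r j = 0" using r by (simp add: coeff_eq_0)
      moreover have "K0 \<ge> 0" unfolding K0_def by (intro sum_nonneg) auto
      ultimately show ?thesis using \<delta> by simp
    qed
    from D(2)[OF r this i x] show "\<bar>poly ((pderiv ^^ i) r) x\<bar> \<le> D * K0 * \<delta>" by (simp add: mult.assoc)
  qed
qed

text \<open>Descending induction on the order: starting from the zero at \<open>l\<close>, each mean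
  value estimate gains a factor \<open>r - l\<close>. Factorials in the constant are given
  away.\<close>

lemma taylor_remainder_bound:
  fixes d :: "nat \<Rightarrow> real \<Rightarrow> real"
  assumes "l < r"
    and D: "\<And>i t. i < n \<Longrightarrow> t \<in> {l..r} \<Longrightarrow> (d i has_real_derivative d (Suc i) t) (at t within {l..r})"
    and z: "\<And>i. i < n \<Longrightarrow> d i l = 0"
    and M: "\<And>t. t \<in> {l..r} \<Longrightarrow> \<bar>d n t\<bar> \<le> M"
  shows "i \<le> n \<Longrightarrow> t \<in> {l..r} \<Longrightarrow> \<bar>d i t\<bar> \<le> M * (r - l) ^ (n - i)"
proof (induction "n - i" arbitrary: i t)
  case 0
  then show ?case using M by simp
next
  case (Suc k)
  then have i: "i < n" by simp
  have le: "\<bar>d (Suc i) s\<bar> \<le> M * (r - l) ^ (n - Suc i)" if "s \<in> {l..r}" for s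
    using Suc i that by (intro Suc.hyps(1)) auto
  have "norm (d i t - d i l) \<le> (M * (r - l) ^ (n - Suc i)) * norm (t - l)"
    by (rule field_differentiable_bound[of "{l..r}" "d i" "d (Suc i)"])
       (use D[OF i] le Suc.prems assms(1) in auto)
  also have "\<dots> \<le> (M * (r - l) ^ (n - Suc i)) * (r - l)"
    using Suc.prems order_trans[OF abs_ge_zero le[OF Suc.prems(2)]] by (intro mult_left_mono) auto
  also have "\<dots> = M * (r - l) ^ (n - i)" using i by (simp add: Suc_diff_Suc[symmetric] mult_ac)
  finally show ?case using z[OF i] by simp
qed

lemma higher_pderiv_pcompose_affine:
  fixes q :: "real poly"
  shows "(pderiv ^^ k) (pcompose q [:\<mu>, \<eta>:]) = smult (\<eta> ^ k) (pcompose ((pderiv ^^ k) q) [:\<mu>, \<eta>:])"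
  by (induction k) (simp_all add: pderiv_smult pderiv_pcompose pderiv_pCons mult.commute)

lemma integral_poly_affine:
  fixes Q :: "real poly"
  assumes "h > 0"
  shows "integral {\<mu> - h..\<mu> + h} (poly Q) = h * integral {-1..1} (poly (pcompose Q [:\<mu>, h:]))"
proof -
  obtain P where P: "pderiv P = Q" using poly_antiderivative by blast
  have "pderiv (smult (1 / h) (pcompose P [:\<mu>, h:])) = pcompose Q [:\<mu>, h:]"
    using assms P by (simp add: pderiv_smult pderiv_pcompose pderiv_pCons)
  then have "integral {-1..1} (poly (pcompose Q [:\<mu>, h:]))
      = poly (smult (1 / h) (pcompose P [:\<mu>, h:])) 1 - poly (smult (1 / h) (pcompose P [:\<mu>, h:])) (-1)"
    using integral_poly_pderiv[of "-1" 1 "smult (1 / h) (pcompose P [:\<mu>, h:])"] by simp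
  also have "\<dots> = (poly P (\<mu> + h) - poly P (\<mu> - h)) / h" by (simp add: poly_pcompose diff_divide_distrib)
  finally show ?thesis
    using assms integral_poly_pderiv[of "\<mu> - h" "\<mu> + h" P] P by simp
qed

text \<open>
  On one element the interpolation error is a multiple of the nodal polynomial plus terms of higher
  order, because the Taylor polynomial of degree \<open>p + 1\<close> differs from its interpolant by such a
  multiple. \<open>E\<close> is the derivative of order \<open>m + 1\<close> of this multiple.
\<close>

lemma interpolation_error:
  assumes p: "p \<ge> 2 * m + 1" and "M \<ge> 0" "h0 > 0"
  obtains C where "C \<ge> 0"
    "\<And>l r d q. l < r \<Longrightarrow> r - l \<le> h0 \<Longrightarrow>
      (\<And>i t. i < p + 2 \<Longrightarrow> t \<in> {l..r} \<Longrightarrow> (d i has_real_derivative d (Suc i) t) (at t within {l..r})) \<Longrightarrow>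
      (\<And>t. t \<in> {l..r} \<Longrightarrow> \<bar>d (p + 2) t\<bar> \<le> M) \<Longrightarrow> \<bar>d (p + 1) l\<bar> \<le> M \<Longrightarrow> degree q \<le> p \<Longrightarrow>
      (\<And>k. k \<le> m \<Longrightarrow> poly ((pderiv ^^ k) q) l = d k l \<and> poly ((pderiv ^^ k) q) r = d k r) \<Longrightarrow>
      (\<And>\<mu>. \<mu> \<in> HJ_nodes p m \<Longrightarrow> poly q ((l + r) / 2 + (r - l) * \<mu> / 2) = d 0 ((l + r) / 2 + (r - l) * \<mu> / 2)) \<Longrightarrow>
      (\<forall>k\<le>m. \<forall>t\<in>{l..r}. \<bar>d k t - poly ((pderiv ^^ k) q) t\<bar> \<le> C * (r - l) ^ (p + 1 - k)) \<and>
      (\<exists>E. (\<forall>t\<in>{l..r}. \<bar>d (Suc m) t - poly ((pderiv ^^ Suc m) q) t - poly E t\<bar> \<le> C * (r - l) ^ (p + 1 - m)) \<and>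
           (\<forall>t\<in>{l..r}. \<bar>poly E t\<bar> \<le> C * (r - l) ^ (p - m)) \<and>
           (\<forall>s. degree s < p - m \<longrightarrow> integral {l..r} (poly (E * s)) = 0))"
proof -
  have "Suc m \<le> p - m" using p by simp
  then obtain A where A: "finite A" "card A = p - m - Suc m" "A \<subseteq> {-1<..<1}"
    "\<And>x. x \<in> A \<Longrightarrow> poly ((pderiv ^^ Suc m) (legendre_poly (p - m))) x = 0"
    using legendre_deriv_roots by blast
  have cardA: "card A = p - 2 * m - 1" using A(2) by simp
  have AHJ: "A \<subseteq> HJ_nodes p m" using A(4) by (auto simp: HJ_nodes_def)
  obtain K where K: "K \<ge> 0"
    "\<And>(r :: real poly) \<delta> i x. degree r \<le> p \<Longrightarrow>
      (\<And>k. k \<le> m \<Longrightarrow> \<bar>poly ((pderiv ^^ k) r) (-1)\<bar> \<le> \<delta> \<and> \<bar>poly ((pderiv ^^ k) r) 1\<bar> \<le> \<delta>) \<Longrightarrow>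
      (\<And>x. x \<in> A \<Longrightarrow> \<bar>poly r x\<bar> \<le> \<delta>) \<Longrightarrow> i \<le> Suc m \<Longrightarrow> x \<in> {-1..1} \<Longrightarrow>
      \<bar>poly ((pderiv ^^ i) r) x\<bar> \<le> K * \<delta>"
    using hermite_bound[OF p A(1) cardA A(3)] by blast
  define \<omega> where "\<omega> = nodal p m"
  \<comment> \<open>The nodal polynomial has degree \<open>p + 1\<close>, so this derivative is a
    nonzero constant; evaluating it at \<open>-1\<close> is a mere choice.\<close>
  define \<kappa> where "\<kappa> = poly ((pderiv ^^ Suc p) \<omega>) (-1)"
  have \<omega>: "degree \<omega> = Suc p" "\<omega> \<noteq> 0" using nodal_degree[OF p] by (auto simp: \<omega>_def)
  have top: "poly ((pderiv ^^ Suc p) f) x = fact (Suc p) * coeff f (Suc p)" if "degree f \<le> Suc p" for f :: "real poly" and x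
  proof -
    have "degree ((pderiv ^^ Suc p) f) = 0" using that by (simp add: degree_higher_pderiv del: funpow.simps)
    then obtain s where s: "(pderiv ^^ Suc p) f = [:s:]" by (rule degree_eq_zeroE)
    then have "s = coeff ((pderiv ^^ Suc p) f) 0" by simp
    also have "\<dots> = fact (Suc p) * coeff f (Suc p)"
      unfolding coeff_higher_pderiv by (simp add: pochhammer_fact[symmetric])
    finally show ?thesis using s by simp
  qed
  have \<kappa>: "\<kappa> \<noteq> 0"
    using top[of \<omega> "-1"] \<omega> by (simp add: \<kappa>_def) (metis \<omega> leading_coeff_0_iff)
  have "\<exists>B\<ge>0. \<forall>x\<in>{-1..1}. \<bar>poly ((pderiv ^^ i) \<omega>) x\<bar> \<le> (B :: real)" for i
    using pc_bound[OF pc_poly[of "-1" 1 "(pderiv ^^ i) \<omega>"]] by metis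
  then obtain Bw where Bw: "\<And>i. Bw i \<ge> 0" "\<And>i x. x \<in> {-1..1} \<Longrightarrow> \<bar>poly ((pderiv ^^ i) \<omega>) x\<bar> \<le> (Bw i :: real)"
    by metis
  define B where "B = (\<Sum>i\<le>Suc m. Bw i)"
  have B: "\<bar>poly ((pderiv ^^ i) \<omega>) x\<bar> \<le> B" if "x \<in> {-1..1}" "i \<le> Suc m" for i x
    using Bw(2)[OF that(1), of i] member_le_sum[of i "{..Suc m}" Bw] that(2) Bw(1) by (force simp: B_def)
  have B0: "B \<ge> 0" unfolding B_def using Bw(1) by (intro sum_nonneg)
  define G where "G = M / \<bar>\<kappa>\<bar>"
  have G0: "G \<ge> 0" using assms(2) by (simp add: G_def)
  define P2 where "P2 = (2 :: real) ^ Suc m"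
  have P2: "2 ^ k \<le> P2" if "k \<le> Suc m" for k unfolding P2_def using that by (intro power_increasing) auto
  have P20: "P2 \<ge> 0" by (simp add: P2_def)
  define C1 where "C1 = M + P2 * (K * M)"
  have C10: "C1 \<ge> 0" using assms(2) K(1) P20 by (simp add: C1_def)
  \<comment> \<open>For \<open>k \<le> m\<close> the remainder is of order \<open>p + 2 - k\<close>,
    and its surplus power of the step is bounded by \<open>h0\<close>; for \<open>k = m + 1\<close>
    it already has the required order.\<close>
  define C where "C = C1 * (h0 + 1) + P2 * (G * B)"
  have C0: "C \<ge> 0" "C \<ge> C1" "C \<ge> C1 * h0 + P2 * (G * B)" "C \<ge> P2 * (G * B)"
    using C10 P20 G0 B0 assms(3) by (auto simp: C_def distrib_left)
  show thesis
  proof (rule that[OF C0(1)])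
    fix l r :: real and d :: "nat \<Rightarrow> real \<Rightarrow> real" and q :: "real poly"
    assume lr: "l < r" "r - l \<le> h0"
      and D: "\<And>i t. i < p + 2 \<Longrightarrow> t \<in> {l..r} \<Longrightarrow> (d i has_real_derivative d (Suc i) t) (at t within {l..r})"
      and dM: "\<And>t. t \<in> {l..r} \<Longrightarrow> \<bar>d (p + 2) t\<bar> \<le> M" "\<bar>d (p + 1) l\<bar> \<le> M"
      and q: "degree q \<le> p"
      and ends: "\<And>k. k \<le> m \<Longrightarrow> poly ((pderiv ^^ k) q) l = d k l \<and> poly ((pderiv ^^ k) q) r = d k r"
      and nodes: "\<And>\<mu>. \<mu> \<in> HJ_nodes p m \<Longrightarrow>
        poly q ((l + r) / 2 + (r - l) * \<mu> / 2) = d 0 ((l + r) / 2 + (r - l) * \<mu> / 2)"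
    define h where "h = r - l"
    define e where "e = h / 2"
    define mid where "mid = (l + r) / 2"
    have h: "h > 0" "h \<le> h0" "e > 0" using lr by (auto simp: h_def e_def)
    have le: "l = mid - e" "r = mid + e" by (simp_all add: mid_def e_def h_def field_simps)
    \<comment> \<open>The Taylor polynomial of \<open>d 0\<close> at the left node, of degree
      \<open>p + 1\<close>, so that its remainder is two orders beyond the degree of the
      interpolant.\<close>
    define T where "T = (\<Sum>j\<le>Suc p. smult (d j l / fact j) ([:-l, 1:] ^ j))"
    have degT: "degree T \<le> Suc p"
      unfolding T_def by (intro degree_sum_le) (auto intro!: order_trans[OF degree_smult_le] simp: degree_power_eq)
    have Tl: "poly ((pderiv ^^ i) T) l = d i l" if "i \<le> Suc p" for i
    proof -
      have pw: "poly ((pderiv ^^ i) ([:-l, 1:] ^ j)) l = (if i = j then fact j else 0)" for j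
      proof -
        have "[:-l, 1:] ^ j = pcompose (monom 1 j) [:-l, 1:]"
          by (induction j) (simp_all add: monom_Suc pcompose_pCons pcompose_1)
        then have "poly ((pderiv ^^ i) ([:-l, 1:] ^ j)) l = poly ((pderiv ^^ i) (monom 1 j)) 0"
          by (simp add: higher_pderiv_pcompose_affine poly_pcompose)
        also have "\<dots> = coeff ((pderiv ^^ i) (monom 1 j)) 0" by (simp add: poly_0_coeff_0)
        also have "\<dots> = (if i = j then fact j else 0)"
          unfolding coeff_higher_pderiv by (simp add: pochhammer_fact[symmetric])
        finally show ?thesis .
      qed
      have "poly ((pderiv ^^ i) T) l = (\<Sum>j\<le>Suc p. d j l / fact j * poly ((pderiv ^^ i) ([:-l, 1:] ^ j)) l)"
        unfolding T_def higher_pderiv_sum poly_sum higher_pderiv_smult poly_smult ..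
      also have "\<dots> = (\<Sum>j\<le>Suc p. if i = j then d j l else 0)"
        unfolding pw by (intro sum.cong) auto
      also have "\<dots> = d i l" using that by simp
      finally show ?thesis .
    qed
    define \<rho> where "\<rho> i t = d i t - poly ((pderiv ^^ i) T) t" for i t
    have \<rho>: "\<bar>\<rho> i t\<bar> \<le> M * h ^ (p + 2 - i)" if "i \<le> p + 2" "t \<in> {l..r}" for i t
      unfolding h_def
    proof (rule taylor_remainder_bound[OF lr(1) _ _ _ that])
      show "(\<rho> i has_real_derivative \<rho> (Suc i) t) (at t within {l..r})" if "i < p + 2" "t \<in> {l..r}" for i t
        unfolding \<rho>_def using D[OF that]
        by (auto intro!: derivative_eq_intros has_field_derivative_at_within[OF poly_DERIV])
      show "\<rho> i l = 0" if "i < p + 2" for i using Tl[of i] that by (simp add: \<rho>_def)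
      show "\<bar>\<rho> (p + 2) t\<bar> \<le> M" if "t \<in> {l..r}" for t
        using dM(1)[OF that] higher_pderiv_eq_0[of T "p + 2"] degT by (simp add: \<rho>_def del: funpow.simps)
    qed
    define aff where "aff f = pcompose f [:mid, e:]" for f :: "real poly"
    have aff_deriv: "poly ((pderiv ^^ k) (aff f)) x = e ^ k * poly ((pderiv ^^ k) f) (mid + e * x)" for k f x
      by (simp add: aff_def higher_pderiv_pcompose_affine poly_pcompose mult.commute)
    \<comment> \<open>On the reference interval the derivative of order \<open>p + 1\<close> of
      \<open>aff T\<close> is \<open>e ^ Suc p * d (Suc p) l\<close>; this \<gamma> makes the
      multiple of \<omega> match it.\<close>
    define \<gamma> where "\<gamma> = e ^ Suc p * d (Suc p) l / \<kappa>"
    have \<gamma>: "\<bar>\<gamma>\<bar> \<le> h ^ Suc p * G"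
    proof -
      have "\<bar>\<gamma>\<bar> = e ^ Suc p * (\<bar>d (Suc p) l\<bar> / \<bar>\<kappa>\<bar>)" using h by (simp add: \<gamma>_def abs_mult)
      also have "\<dots> \<le> h ^ Suc p * G"
        unfolding G_def using dM(2) h \<kappa>
        by (intro mult_mono power_mono divide_right_mono) (auto simp: e_def)
      finally show ?thesis .
    qed
    \<comment> \<open>The difference of \<open>q\<close> and the interpolant of \<open>T\<close>, on
      the reference interval. Its leading terms cancel by the choice of \<gamma>, and its
      interpolation data are only those of the Taylor remainder, since \<omega> contributes
      none.\<close>
    define R where "R = aff q - aff T + smult \<gamma> \<omega>"
    have deg_aff: "degree (aff f) = degree f" for f
      using h by (simp add: aff_def degree_pcompose)
    have degR': "degree R \<le> Suc p"
      unfolding R_def using deg_aff[of q] deg_aff[of T] q degT \<omega>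
      by (intro degree_add_le degree_diff_le order_trans[OF degree_smult_le]) auto
    have "coeff R (Suc p) = 0"
    proof -
      have "poly ((pderiv ^^ Suc p) R) (-1) = poly ((pderiv ^^ Suc p) (aff q)) (-1)
          - poly ((pderiv ^^ Suc p) (aff T)) (-1) + \<gamma> * \<kappa>"
        unfolding R_def higher_pderiv_add higher_pderiv_diff higher_pderiv_smult \<kappa>_def by simp
      also have "\<dots> = 0"
        using Tl[of "Suc p"] higher_pderiv_eq_0[of q "Suc p"] q \<kappa> le
        by (simp add: aff_deriv \<gamma>_def del: funpow.simps power_Suc)
      finally show ?thesis using top[OF degR', of "-1"] by simp
    qed
    then have degR: "degree R \<le> p"
      using degR' by (metis leading_coeff_0_iff le_Suc_eq degree_0 le0)
    have Rd: "poly ((pderiv ^^ k) R) x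
        = e ^ k * (poly ((pderiv ^^ k) q) (mid + e * x) - poly ((pderiv ^^ k) T) (mid + e * x))
          + \<gamma> * poly ((pderiv ^^ k) \<omega>) x" for k x
      unfolding R_def higher_pderiv_add higher_pderiv_diff higher_pderiv_smult
      by (simp add: aff_deriv algebra_simps)
    have elt: "e ^ k * (M * h ^ (p + 2 - k)) \<le> M * h ^ (p + 2)" if "k \<le> p + 2" for k
    proof -
      have "e ^ k * (M * h ^ (p + 2 - k)) \<le> h ^ k * (M * h ^ (p + 2 - k))"
        using h assms(2) by (intro mult_right_mono power_mono) (auto simp: e_def)
      also have "\<dots> = M * h ^ (k + (p + 2 - k))" by (simp add: power_add)
      finally show ?thesis using that by simp
    qed
    have Rb: "\<bar>poly ((pderiv ^^ i) R) x\<bar> \<le> K * (M * h ^ (p + 2))" if "i \<le> Suc m" "x \<in> {-1..1}" for i x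
    proof (rule K(2)[OF degR _ _ that])
      fix k assume k: "k \<le> m"
      have w: "poly ((pderiv ^^ k) \<omega>) (-1) = 0" "poly ((pderiv ^^ k) \<omega>) 1 = 0"
        using endw_power_ends[of k "Suc m" "(pderiv ^^ Suc m) (legendre_poly (p - m))"] k
        unfolding \<omega>_def nodal_def by (auto simp del: funpow.simps power_Suc)
      have "poly ((pderiv ^^ k) R) (-1) = e ^ k * \<rho> k l" "poly ((pderiv ^^ k) R) 1 = e ^ k * \<rho> k r"
        using ends[OF k] le w by (auto simp: Rd \<rho>_def)
      moreover have "e ^ k * \<bar>\<rho> k t\<bar> \<le> M * h ^ (p + 2)" if "t \<in> {l..r}" for t
        using order_trans[OF mult_left_mono[OF \<rho>] elt, of k t] that k p h by simp
      ultimately show "\<bar>poly ((pderiv ^^ k) R) (-1)\<bar> \<le> M * h ^ (p + 2) \<and> \<bar>poly ((pderiv ^^ k) R) 1\<bar> \<le> M * h ^ (p + 2)"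
        using lr(1) h by (simp add: abs_mult)
    next
      fix x assume x: "x \<in> A"
      have "poly \<omega> x = 0" using A(4)[OF x] by (simp add: \<omega>_def nodal_def del: funpow.simps)
      moreover have "poly q (mid + e * x) = d 0 (mid + e * x)"
        using nodes[of x] x AHJ by (auto simp: mid_def e_def h_def)
      moreover have "mid + e * x \<in> {l..r}"
      proof -
        have "x \<le> 1" "-1 \<le> x" using x A(3) by auto
        then have "e * x \<le> e" "- e \<le> e * x"
          using mult_left_mono[of x 1 e] mult_left_mono[of "-1" x e] h by auto
        then show ?thesis using le by auto
      qed
      ultimately show "\<bar>poly R x\<bar> \<le> M * h ^ (p + 2)"
        using \<rho>[of 0 "mid + e * x"] Rd[of 0 x] by (simp add: \<rho>_def)
    qed
    define inv where "inv t = (t - mid) / e" for t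
    have inv: "mid + e * inv t = t" "t \<in> {l..r} \<Longrightarrow> inv t \<in> {-1..1}" for t
      using h le by (auto simp: inv_def field_simps)
    have err: "d k t - poly ((pderiv ^^ k) q) t
        = \<rho> k t - poly ((pderiv ^^ k) R) (inv t) / e ^ k + \<gamma> * poly ((pderiv ^^ k) \<omega>) (inv t) / e ^ k" for k t
      using h by (simp add: Rd inv(1) \<rho>_def field_simps)
    have small: "\<bar>\<rho> k t - poly ((pderiv ^^ k) R) (inv t) / e ^ k\<bar> \<le> C1 * h ^ (p + 2 - k)"
      if k: "k \<le> Suc m" and t: "t \<in> {l..r}" for k t
    proof -
      have kp: "k \<le> p + 2" using k p by simp
      have "\<bar>poly ((pderiv ^^ k) R) (inv t) / e ^ k\<bar> \<le> K * (M * h ^ (p + 2)) / e ^ k"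
        using Rb[OF k inv(2)[OF t]] h by (simp add: divide_right_mono)
      also have "\<dots> = 2 ^ k * (K * M) * (h ^ (p + 2) / h ^ k)"
        by (simp add: e_def power_divide)
      also have "h ^ (p + 2) / h ^ k = h ^ (p + 2 - k)" using h kp by (simp add: power_diff)
      also have "2 ^ k * (K * M) * h ^ (p + 2 - k) \<le> P2 * (K * M) * h ^ (p + 2 - k)"
        using P2[OF k] K(1) assms(2) h by (intro mult_right_mono) auto
      finally have "\<bar>poly ((pderiv ^^ k) R) (inv t) / e ^ k\<bar> \<le> P2 * (K * M) * h ^ (p + 2 - k)" .
      moreover have "C1 * h ^ (p + 2 - k) = M * h ^ (p + 2 - k) + P2 * (K * M) * h ^ (p + 2 - k)"
        by (simp add: C1_def distrib_right)
      ultimately show ?thesis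
        using \<rho>[OF kp t] abs_triangle_ineq4[of "\<rho> k t" "poly ((pderiv ^^ k) R) (inv t) / e ^ k"] by linarith
    qed
    have main: "\<bar>\<gamma> * poly ((pderiv ^^ k) \<omega>) (inv t) / e ^ k\<bar> \<le> P2 * (G * B) * h ^ (p + 1 - k)"
      if k: "k \<le> Suc m" and t: "t \<in> {l..r}" for k t
    proof -
      have "\<bar>\<gamma> * poly ((pderiv ^^ k) \<omega>) (inv t) / e ^ k\<bar> = \<bar>\<gamma>\<bar> * \<bar>poly ((pderiv ^^ k) \<omega>) (inv t)\<bar> / e ^ k"
        using h by (simp add: abs_mult)
      also have "\<dots> \<le> (h ^ Suc p * G) * B / e ^ k"
        using \<gamma> B[OF inv(2)[OF t] k] h G0 by (intro divide_right_mono mult_mono) auto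
      also have "\<dots> = 2 ^ k * (G * B) * (h ^ (p + 1) / h ^ k)" by (simp add: e_def power_divide)
      also have "h ^ (p + 1) / h ^ k = h ^ (p + 1 - k)" using h k p by (intro power_diff[symmetric]) auto
      also have "2 ^ k * (G * B) * h ^ (p + 1 - k) \<le> P2 * (G * B) * h ^ (p + 1 - k)"
        using P2[OF k] G0 B0 h by (intro mult_right_mono) auto
      finally show ?thesis .
    qed
    \<comment> \<open>The leading part of the error, \<gamma> times \<omega>, differentiated
      \<open>m + 1\<close> times and pulled back to the element; the power of \<open>e\<close> comes
      from the chain rule.\<close>
    define E where "E = smult (\<gamma> / e ^ Suc m) (pcompose ((pderiv ^^ Suc m) \<omega>) [:- mid / e, 1 / e:])"
    have E: "poly E t = \<gamma> * poly ((pderiv ^^ Suc m) \<omega>) (inv t) / e ^ Suc m" for t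
      by (simp add: E_def poly_pcompose inv_def diff_divide_distrib del: funpow.simps power_Suc)
    show "(\<forall>k\<le>m. \<forall>t\<in>{l..r}. \<bar>d k t - poly ((pderiv ^^ k) q) t\<bar> \<le> C * (r - l) ^ (p + 1 - k)) \<and>
      (\<exists>E. (\<forall>t\<in>{l..r}. \<bar>d (Suc m) t - poly ((pderiv ^^ Suc m) q) t - poly E t\<bar> \<le> C * (r - l) ^ (p + 1 - m)) \<and>
           (\<forall>t\<in>{l..r}. \<bar>poly E t\<bar> \<le> C * (r - l) ^ (p - m)) \<and>
           (\<forall>s. degree s < p - m \<longrightarrow> integral {l..r} (poly (E * s)) = 0))"
      unfolding h_def[symmetric]
    proof (intro conjI exI[of _ E] allI impI ballI)
      fix k t assume k: "k \<le> m" and t: "t \<in> {l..r}"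
      have "h ^ (p + 2 - k) = h * h ^ (p + 1 - k)" using k p by (simp add: Suc_diff_le)
      also have "\<dots> \<le> h0 * h ^ (p + 1 - k)" using h by (intro mult_right_mono) auto
      finally have "C1 * h ^ (p + 2 - k) \<le> C1 * (h0 * h ^ (p + 1 - k))" using C10 by (rule mult_left_mono)
      moreover have "(C1 * h0 + P2 * (G * B)) * h ^ (p + 1 - k)
          = C1 * (h0 * h ^ (p + 1 - k)) + P2 * (G * B) * h ^ (p + 1 - k)" by (simp add: distrib_right)
      moreover have "k \<le> Suc m" using k by simp
      ultimately have "\<bar>d k t - poly ((pderiv ^^ k) q) t\<bar> \<le> (C1 * h0 + P2 * (G * B)) * h ^ (p + 1 - k)"
        unfolding err using small[of k t] main[of k t] t by linarith
      also have "\<dots> \<le> C * h ^ (p + 1 - k)" using C0(3) h by (intro mult_right_mono) auto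
      finally show "\<bar>d k t - poly ((pderiv ^^ k) q) t\<bar> \<le> C * h ^ (p + 1 - k)" .
    next
      fix t assume t: "t \<in> {l..r}"
      have "\<bar>d (Suc m) t - poly ((pderiv ^^ Suc m) q) t - poly E t\<bar> \<le> C1 * h ^ (p + 2 - Suc m)"
        unfolding err E using small[of "Suc m" t] t by simp
      also have "\<dots> \<le> C * h ^ (p + 2 - Suc m)" using C0(2) h by (intro mult_right_mono) auto
      finally show "\<bar>d (Suc m) t - poly ((pderiv ^^ Suc m) q) t - poly E t\<bar> \<le> C * h ^ (p + 1 - m)" by simp
      have "\<bar>poly E t\<bar> \<le> P2 * (G * B) * h ^ (p + 1 - Suc m)"
        unfolding E using main[of "Suc m" t] t by simp
      also have "\<dots> \<le> C * h ^ (p + 1 - Suc m)" using C0(4) h by (intro mult_right_mono) auto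
      finally show "\<bar>poly E t\<bar> \<le> C * h ^ (p - m)" by simp
    next
      fix s :: "real poly" assume s: "degree s < p - m"
      have id: "pcompose (pcompose f [:- mid / e, 1 / e:]) [:mid, e:] = f" for f :: "real poly"
      proof -
        have "pcompose [:- mid / e, 1 / e:] [:mid, e:] = [:0, 1:]" using h by (simp add: pcompose_pCons)
        then show ?thesis by (simp add: pcompose_assoc[symmetric] pcompose_idR)
      qed
      have "integral {l..r} (poly (E * s)) = e * integral {-1..1} (poly (aff (E * s)))"
        unfolding le(1) le(2) aff_def using h by (intro integral_poly_affine)
      also have "aff (E * s) = smult (\<gamma> / e ^ Suc m) ((pderiv ^^ Suc m) \<omega> * aff s)"
        by (simp only: aff_def E_def pcompose_mult pcompose_smult id mult_smult_left)
      also have "integral {-1..1} (poly \<dots>) = 0"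
        using nodal_orth[of "aff s" p m] s deg_aff[of s]
        by (simp add: integral_poly_smult \<omega>_def del: funpow.simps power_Suc poly_smult)
      finally show "integral {l..r} (poly (E * s)) = 0" by (simp only: mult_zero_right)
    qed
  qed
qed

section \<open>Uniqueness for the reduced equation\<close>

lemma test_fun_H0_space:
  assumes "a < b" "\<phi> \<in> test_fun a b"
  shows "\<phi> \<in> H0_space a b n"
proof -
  note r = rep_test_fun[OF assms(2), of n]
  have "H_norm a b n (\<lambda>x. \<phi> x - \<phi> x) < \<epsilon>" if "\<epsilon> > 0" for \<epsilon>
    using rep_H_norm_le[OF assms(1) rep_diff[OF r r]] that by (simp add: nrm_def)
  then show ?thesis using rep_H_space[OF assms(1) r] assms(2) unfolding H0_space_def by blast
qed

lemma Jn_zero_imp_zero: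
  assumes "a < b" "continuous_on {a..b} g" "\<And>t. t \<in> {a..b} \<Longrightarrow> Jn a n g t = 0" "t \<in> {a..b}"
  shows "g t = 0"
  using assms(3,4)
proof (induction n arbitrary: t)
  case (Suc n)
  have c: "continuous_on {a..b} (Jn a n g)"
    using Jn_cont[OF pc_continuous[OF assms(2)], of n] assms(2) by (cases n) auto
  have "Jn a n g s = 0" if s: "s \<in> {a..b}" for s
  proof -
    have "(J a (Jn a n g) has_real_derivative Jn a n g s) (at s within {a..b})"
      using c s by (rule J_deriv_within)
    moreover have "((\<lambda>_. 0) has_real_derivative 0) (at s within {a..b})" by simp
    then have "(J a (Jn a n g) has_real_derivative 0) (at s within {a..b})"
      by (rule has_field_derivative_transform_within[OF _ zero_less_one s]) (use Suc.prems(1) in auto)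
    ultimately show ?thesis
      using vector_derivative_unique_within_closed_interval[OF assms(1), of s] s
      by (auto simp: has_real_derivative_iff_has_vector_derivative)
  qed
  then show ?case by (rule Suc.IH[OF _ Suc.prems(2)])
qed auto

text \<open>The choice in \<open>weak_deriv\<close> need not pick the square integrable
  representative granted by \<open>H_space\<close>, but the two agree off a null set, which
  preserves square integrability.\<close>

lemma H_space_weak_deriv:
  assumes "a < b" "v \<in> H_space a b n" "k \<le> n"
  shows "is_weak_deriv a b k v (weak_deriv a b k v)"
    "(\<lambda>t. weak_deriv a b k v t) absolutely_integrable_on {a..b}"
    "(\<lambda>t. (weak_deriv a b k v t)\<^sup>2) absolutely_integrable_on {a..b}"
proof -
  obtain g where g: "is_weak_deriv a b k v g" "g \<in> L2_fun a b"
    using assms(2,3) unfolding H_space_def by blast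
  note wd = weak_deriv_AE[OF assms(1) g(1)]
  show w: "is_weak_deriv a b k v (weak_deriv a b k v)" by (rule wd(2))
  then show "weak_deriv a b k v absolutely_integrable_on {a..b}" unfolding is_weak_deriv_def by simp
  obtain N where N: "{t \<in> space lebesgue. \<not> (t \<in> {a..b} \<longrightarrow> weak_deriv a b k v t = g t)} \<subseteq> N"
    "emeasure lebesgue N = 0" "N \<in> sets lebesgue"
    using AE_E[OF wd(1)] by blast
  have "(\<lambda>t. (g t)\<^sup>2) absolutely_integrable_on {a..b}" using g(2) by (simp add: L2_fun_def)
  moreover have "negligible N" using N(2,3) by (simp add: negligible_iff_null_sets null_setsI)
  ultimately show "(\<lambda>t. (weak_deriv a b k v t)\<^sup>2) absolutely_integrable_on {a..b}"
    by (rule absolutely_integrable_spike) (use N(1) in auto)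
qed

lemma AE_weak_deriv_diff:
  assumes "a < b" "is_weak_deriv a b k v g" "is_weak_deriv a b k w h"
  shows "AE t in lebesgue. t \<in> {a..b} \<longrightarrow> weak_deriv a b k (\<lambda>t. v t - w t) t = g t - h t"
  using weak_deriv_AE(1)[OF assms(1) is_weak_deriv_add[OF assms(2,3), of "-1"]] by simp

lemma H_space_diff_rep:
  assumes "a < b" "v \<in> H_space a b n" "rep a b n w h"
  shows "(\<lambda>t. v t - w t) \<in> H_space a b n"
  unfolding H_space_def
proof safe
  fix k assume k: "k \<le> n"
  note v = H_space_weak_deriv[OF assms(1,2) k]
  let ?h = "Jn a (n - k) h"
  have h: "pc a b ?h" using rep_pc[OF assms(3)] by (rule pc_Jn)
  have "is_weak_deriv a b k (\<lambda>t. v t - w t) (\<lambda>t. weak_deriv a b k v t - ?h t)"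
    using is_weak_deriv_add[OF v(1) rep_weak[OF assms(1,3) k], of "-1"] by simp
  moreover have "(\<lambda>t. weak_deriv a b k v t - ?h t) \<in> L2_fun a b"
    unfolding L2_fun_def
  proof safe
    show "(\<lambda>t. weak_deriv a b k v t - ?h t) \<in> borel_measurable (lebesgue_on {a..b})"
      using is_weak_deriv_measurable[OF v(1)] pc_measurable[OF h] by (rule borel_measurable_diff)
    have "(\<lambda>t. ((weak_deriv a b k v t)\<^sup>2 - 2 * (weak_deriv a b k v t * ?h t)) + (?h t)\<^sup>2) absolutely_integrable_on {a..b}"
      by (intro set_integral_add(1) set_integral_diff(1) v(3) pc_abs_integrable pc_power2 h
          set_integrable_mult_right abs_integrable_mult_pc[OF h v(2)])
    then show "set_integrable lebesgue {a..b} (\<lambda>t. (weak_deriv a b k v t - ?h t)\<^sup>2)"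
      by (simp add: power2_diff mult.assoc algebra_simps)
  qed
  ultimately show "\<exists>g. is_weak_deriv a b k (\<lambda>t. v t - w t) g \<and> g \<in> L2_fun a b" by blast
qed

text \<open>
  Young's inequality in place of Cauchy-Schwarz: \<open>\<bar>y\<bar> \<le> (y\<^sup>2 / s + s) / 2\<close> with \<open>s\<close> exceeding the norm.
\<close>

lemma lint_bound_of_small_square:
  assumes "a < b" "pc a b f" "\<And>t. t \<in> {a..b} \<Longrightarrow> \<bar>f t\<bar> \<le> P" "P \<ge> 0"
    "y absolutely_integrable_on {a..b}" "(\<lambda>t. (y t)\<^sup>2) absolutely_integrable_on {a..b}"
    "s > 0" "(LINT t:{a..b}|lebesgue. (y t)\<^sup>2) \<le> s\<^sup>2"
  shows "\<bar>LINT t:{a..b}|lebesgue. f t * y t\<bar> \<le> P * (s * (1 + (b - a)) / 2)"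
proof -
  have fy: "(\<lambda>t. f t * y t) absolutely_integrable_on {a..b}"
    using assms(2,5) by (rule abs_integrable_pc_mult)
  have "norm (integral {a..b} (\<lambda>t. f t * y t)) \<le> integral {a..b} (\<lambda>t. P * (1 / (2 * s) * (y t)\<^sup>2 + s / 2))"
  proof (rule integral_norm_bound_integral)
    show "(\<lambda>t. f t * y t) integrable_on {a..b}" using fy by (rule set_lebesgue_integral_eq_integral)
    show "(\<lambda>t. P * (1 / (2 * s) * (y t)\<^sup>2 + s / 2)) integrable_on {a..b}"
      using set_lebesgue_integral_eq_integral(1)[OF assms(6)]
      by (intro integrable_on_mult_right integrable_add integrable_const_ivl)
    show "norm (f t * y t) \<le> P * (1 / (2 * s) * (y t)\<^sup>2 + s / 2)" if "t \<in> {a..b}" for t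
    proof -
      have "0 \<le> (\<bar>y t\<bar> - s)\<^sup>2" by simp
      also have "(\<bar>y t\<bar> - s)\<^sup>2 = (y t)\<^sup>2 - 2 * s * \<bar>y t\<bar> + s\<^sup>2" by (simp add: power2_diff)
      finally have "\<bar>y t\<bar> \<le> 1 / (2 * s) * (y t)\<^sup>2 + s / 2"
        using assms(7) by (simp add: field_simps power2_eq_square)
      then show ?thesis using assms(3)[OF that] assms(4) by (simp add: abs_mult mult_mono)
    qed
  qed
  also have "\<dots> = P * (1 / (2 * s) * integral {a..b} (\<lambda>t. (y t)\<^sup>2) + s / 2 * (b - a))"
  proof -
    have "integral {a..b} (\<lambda>t. 1 / (2 * s) * (y t)\<^sup>2 + s / 2)
        = integral {a..b} (\<lambda>t. 1 / (2 * s) * (y t)\<^sup>2) + integral {a..b} (\<lambda>t. s / 2)"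
      using set_lebesgue_integral_eq_integral(1)[OF assms(6)]
      by (intro integral_add integrable_on_mult_right integrable_const_ivl)
    moreover have "integral {a..b} (\<lambda>t. s / 2) = s / 2 * (b - a)" using assms(1) by simp
    ultimately show ?thesis by (simp only: integral_mult_right)
  qed
  also have "\<dots> \<le> P * (1 / (2 * s) * s\<^sup>2 + s / 2 * (b - a))"
    using assms(4,7,8) set_lebesgue_integral_eq_integral(2)[OF assms(6)]
    by (intro mult_left_mono add_right_mono) auto
  also have "\<dots> = P * (s * (1 + (b - a)) / 2)" using assms(7) by (simp add: power2_eq_square field_simps)
  finally show ?thesis using set_lebesgue_integral_eq_integral(2)[OF fy] by simp
qed

section \<open>The form with one represented argument and one general Sobolev function\<close>

context elliptic_form
begin

text \<open>The uniqueness hypothesis tests with all of \<open>H0_space\<close>, whose members need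
  not have a \<open>pc\<close> representative. So only the left argument is made explicit, and its
  factors are bounded.\<close>

lemma bilin_rep_left:
  assumes "rep a b (Suc m) z g" "v \<in> H_space a b (Suc m)"
  shows "bilin_form a b m c z v
    = (\<Sum>k\<le>Suc m. LINT t:{a..b}|lebesgue. (c k t * Jn a (Suc m - k) g t) * weak_deriv a b k v t)"
  unfolding bilin_form_def
proof (rule sum.cong)
  fix k assume "k \<in> {..Suc m}"
  then have k: "k \<le> Suc m" by simp
  note g = rep_weak_deriv[OF ab assms(1) k]
  note v = is_weak_deriv_measurable[OF H_space_weak_deriv(1)[OF ab assms(2) k]]
  note cm = pc_measurable[OF pc_c[OF k]]
  note gm = pc_measurable[OF pc_Jn[OF rep_pc[OF assms(1)], of "Suc m - k"]]
  show "(LINT t:{a..b}|lebesgue. c k t * weak_deriv a b k z t * weak_deriv a b k v t)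
      = (LINT t:{a..b}|lebesgue. (c k t * Jn a (Suc m - k) g t) * weak_deriv a b k v t)"
    by (rule lint_cong_AE)
       (use g v cm gm in \<open>auto intro!: borel_measurable_times elim!: eventually_mono\<close>)
qed simp

lemma bilin_lin_left:
  assumes "rep a b (Suc m) y f" "rep a b (Suc m) z g" "v \<in> H_space a b (Suc m)"
  shows "bilin_form a b m c (\<lambda>t. y t + z t) v = bilin_form a b m c y v + bilin_form a b m c z v"
proof -
  have r: "rep a b (Suc m) (\<lambda>t. y t + z t) (\<lambda>t. f t + 1 * g t)"
    using rep_lin[OF assms(1,2), of 1] by simp
  have fg: "pc a b f" "pc a b g" using assms rep_pc by auto
  have "(LINT t:{a..b}|lebesgue. (c k t * Jn a (Suc m - k) (\<lambda>t. f t + 1 * g t) t) * weak_deriv a b k v t)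
      = (LINT t:{a..b}|lebesgue. (c k t * Jn a (Suc m - k) f t) * weak_deriv a b k v t)
        + (LINT t:{a..b}|lebesgue. (c k t * Jn a (Suc m - k) g t) * weak_deriv a b k v t)" if k: "k \<le> Suc m" for k
  proof -
    have i: "(\<lambda>t. (c k t * Jn a (Suc m - k) h t) * weak_deriv a b k v t) absolutely_integrable_on {a..b}"
      if "pc a b h" for h
      using that by (intro abs_integrable_pc_mult pc_mult pc_c k pc_Jn H_space_weak_deriv(2)[OF ab assms(3) k])
    have "(LINT t:{a..b}|lebesgue. (c k t * Jn a (Suc m - k) (\<lambda>t. f t + 1 * g t) t) * weak_deriv a b k v t)
        = (LINT t:{a..b}|lebesgue. (c k t * Jn a (Suc m - k) f t) * weak_deriv a b k v t
            + (c k t * Jn a (Suc m - k) g t) * weak_deriv a b k v t)"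
      by (rule set_lebesgue_integral_cong) (auto simp: Jn_lin[OF fg, where r = 1, simplified] algebra_simps)
    then show ?thesis using set_integral_add(2)[OF i[OF fg(1)] i[OF fg(2)]] by simp
  qed
  then show ?thesis
    unfolding bilin_rep_left[OF r assms(3)] bilin_rep_left[OF assms(1,3)] bilin_rep_left[OF assms(2,3)]
    by (simp add: sum.distrib)
qed

text \<open>Continuity and density: replacing \<open>v\<close> by its difference to a test function
  changes nothing, and the form is then at most a fixed multiple of the Sobolev norm of this
  difference.\<close>

lemma bilin_zero_on_H0:
  assumes z: "rep a b (Suc m) z g" and v: "v \<in> H0_space a b (Suc m)"
    and zero: "\<And>\<phi>. \<phi> \<in> test_fun a b \<Longrightarrow> bilin_form a b m c z \<phi> = 0"
  shows "bilin_form a b m c z v = 0"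
proof -
  note g = rep_pc[OF z]
  have vH: "v \<in> H_space a b (Suc m)" using v by (simp add: H0_space_def)
  have "\<exists>B\<ge>0. \<forall>t\<in>{a..b}. \<bar>c k t * Jn a (Suc m - k) g t\<bar> \<le> B" if "k \<le> Suc m" for k
    using pc_bound[OF pc_mult[OF pc_c[OF that] pc_Jn[OF g]]] by metis
  then obtain P where P: "\<And>k. k \<le> Suc m \<Longrightarrow> P k \<ge> 0 \<and> (\<forall>t\<in>{a..b}. \<bar>c k t * Jn a (Suc m - k) g t\<bar> \<le> P k)"
    by metis
  \<comment> \<open>The sum of the bounds \<open>P k\<close> on the explicit factors, each with the
    constant that the estimate of a small square contributes.\<close>
  define Q where "Q = (\<Sum>k\<le>Suc m. P k * ((1 + (b - a)) / 2))"
  have Q: "Q \<ge> 0" unfolding Q_def using P ab by (intro sum_nonneg mult_nonneg_nonneg) auto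
  have le: "\<bar>bilin_form a b m c z v\<bar> \<le> Q * \<epsilon>" if e: "\<epsilon> > 0" for \<epsilon>
  proof -
    obtain \<phi> where \<phi>: "\<phi> \<in> test_fun a b" "H_norm a b (Suc m) (\<lambda>x. v x - \<phi> x) < \<epsilon>"
      using v e unfolding H0_space_def by blast
    note r = rep_test_fun[OF \<phi>(1), of "Suc m"]
    have \<phi>H: "\<phi> \<in> H_space a b (Suc m)" using ab r by (rule rep_H_space)
    let ?y = "\<lambda>x. v x - \<phi> x"
    have yH: "?y \<in> H_space a b (Suc m)" by (rule H_space_diff_rep[OF ab vH r])
    let ?I = "\<lambda>k w. LINT t:{a..b}|lebesgue. (c k t * Jn a (Suc m - k) g t) * weak_deriv a b k w t"
    have diff: "?I k ?y = ?I k v - ?I k \<phi>" if k: "k \<le> Suc m" for k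
    proof -
      have p: "pc a b (\<lambda>t. c k t * Jn a (Suc m - k) g t)" by (intro pc_mult pc_c k pc_Jn g)
      note wv = H_space_weak_deriv[OF ab vH k] and w\<phi> = H_space_weak_deriv[OF ab \<phi>H k]
        and wy = H_space_weak_deriv[OF ab yH k]
      have "?I k ?y = (LINT t:{a..b}|lebesgue. (c k t * Jn a (Suc m - k) g t) * weak_deriv a b k v t
          - (c k t * Jn a (Suc m - k) g t) * weak_deriv a b k \<phi> t)"
      proof (rule lint_cong_AE)
        show "AE t in lebesgue. t \<in> {a..b} \<longrightarrow> (c k t * Jn a (Suc m - k) g t) * weak_deriv a b k ?y t
          = (c k t * Jn a (Suc m - k) g t) * weak_deriv a b k v t
            - (c k t * Jn a (Suc m - k) g t) * weak_deriv a b k \<phi> t"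
          using AE_weak_deriv_diff[OF ab wv(1) w\<phi>(1)]
          by eventually_elim (auto simp: right_diff_distrib)
      qed (use pc_measurable[OF p] is_weak_deriv_measurable[OF wv(1)] is_weak_deriv_measurable[OF w\<phi>(1)]
            is_weak_deriv_measurable[OF wy(1)] in \<open>auto intro!: borel_measurable_diff borel_measurable_times\<close>)
      also have "\<dots> = ?I k v - ?I k \<phi>"
        using abs_integrable_pc_mult[OF p wv(2)] abs_integrable_pc_mult[OF p w\<phi>(2)]
        by (rule set_integral_diff(2))
      finally show ?thesis .
    qed
    have "bilin_form a b m c z ?y = bilin_form a b m c z v - bilin_form a b m c z \<phi>"
      unfolding bilin_rep_left[OF z yH] bilin_rep_left[OF z vH] bilin_rep_left[OF z \<phi>H]
      using diff by (simp add: sum_subtractf)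
    then have "bilin_form a b m c z v = bilin_form a b m c z ?y" using zero[OF \<phi>(1)] by simp
    then have "\<bar>bilin_form a b m c z v\<bar> \<le> (\<Sum>k\<le>Suc m. \<bar>?I k ?y\<bar>)"
      unfolding bilin_rep_left[OF z yH] by (simp only: sum_abs)
    also have "\<dots> \<le> (\<Sum>k\<le>Suc m. P k * (\<epsilon> * (1 + (b - a)) / 2))"
    proof (rule sum_mono)
      fix k assume "k \<in> {..Suc m}"
      then have k: "k \<le> Suc m" by simp
      note wy = H_space_weak_deriv[OF ab yH k]
      have nonneg: "(LINT t:{a..b}|lebesgue. (weak_deriv a b i ?y t)\<^sup>2) \<ge> 0" for i
        unfolding set_lebesgue_integral_def by (rule Bochner_Integration.integral_nonneg) auto
      have "sqrt (\<Sum>i\<le>Suc m. LINT t:{a..b}|lebesgue. (weak_deriv a b i ?y t)\<^sup>2) < \<epsilon>"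
        using \<phi>(2) by (simp add: H_norm_def)
      then have "(\<Sum>i\<le>Suc m. LINT t:{a..b}|lebesgue. (weak_deriv a b i ?y t)\<^sup>2) < \<epsilon>\<^sup>2"
        using real_le_rsqrt[of \<epsilon>] by (rule_tac ccontr) (simp only: not_less, fastforce)
      moreover have "(LINT t:{a..b}|lebesgue. (weak_deriv a b k ?y t)\<^sup>2)
          \<le> (\<Sum>i\<le>Suc m. LINT t:{a..b}|lebesgue. (weak_deriv a b i ?y t)\<^sup>2)"
        by (rule member_le_sum) (use k nonneg in auto)
      ultimately have sq: "(LINT t:{a..b}|lebesgue. (weak_deriv a b k ?y t)\<^sup>2) \<le> \<epsilon>\<^sup>2" by linarith
      show "\<bar>?I k ?y\<bar> \<le> P k * (\<epsilon> * (1 + (b - a)) / 2)"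
        by (rule lint_bound_of_small_square[OF ab _ _ _ wy(2,3) e sq])
           (use P[OF k] in \<open>auto intro!: pc_mult pc_c k pc_Jn g\<close>)
    qed
    also have "\<dots> = Q * \<epsilon>" by (simp only: Q_def sum_distrib_right) (simp add: algebra_simps)
    finally show ?thesis by simp
  qed
  have "\<bar>bilin_form a b m c z v\<bar> \<le> 0"
  proof (rule field_le_epsilon)
    fix e :: real assume "e > 0"
    then have "\<bar>bilin_form a b m c z v\<bar> \<le> Q * (e / (Q + 1))" using Q by (intro le) auto
    also have "\<dots> \<le> e" using Q \<open>e > 0\<close> by (simp add: field_simps)
    finally show "\<bar>bilin_form a b m c z v\<bar> \<le> 0 + e" by simp
  qed
  then show ?thesis by simp
qed

text \<open>Derivatives of order \<open>m + 1\<close> of test functions are orthogonal to the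
  polynomials of degree \<open>m\<close>, so the iterated integral \<open>z\<close> of
  \<open>g\<close> solves the homogeneous weak problem. As uniqueness is assumed for the given
  right-hand side, \<open>z\<close> is added to \<open>u\<close>: the sum is another weak solution
  in \<open>H0_space\<close>, hence equal to \<open>u\<close> almost everywhere. So \<open>z\<close>
  vanishes, and differentiation gives \<open>g = 0\<close>.\<close>

lemma red_unique:
  assumes u: "rep a b (Suc m) u gu" "continuous_on {a..b} gu" "orth a b m gu"
    and sol: "\<And>v. v \<in> H0_space a b (Suc m) \<Longrightarrow> L2_inner a b f v = bilin_form a b m c u v"
    and unique: "\<And>w. w \<in> H0_space a b (Suc m) \<Longrightarrow>
       (\<forall>v\<in>H0_space a b (Suc m). L2_inner a b f v = bilin_form a b m c w v) \<Longrightarrow>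
       (AE t in lebesgue_on {a..b}. w t = u t)"
    and g: "continuous_on {a..b} g" "orth a b m g"
    and \<pi>: "degree \<pi> \<le> m" "\<And>t. t \<in> {a..b} \<Longrightarrow> red g t = poly \<pi> t" and t: "t \<in> {a..b}"
  shows "g t = 0"
proof -
  have pg: "pc a b g" using g(1) by (rule pc_continuous)
  let ?z = "Jn a (Suc m) g"
  note rz = rep_Jn[OF pg, of "Suc m"]
  let ?w = "\<lambda>t. u t + ?z t"
  have rw: "rep a b (Suc m) ?w (\<lambda>t. gu t + 1 * g t)" using rep_lin[OF u(1) rz, of 1] by simp
  have pgu: "pc a b gu" using u(1) by (rule rep_pc)
  have "orth a b m (\<lambda>t. gu t + 1 * g t)"
    unfolding orth_def
  proof (intro allI impI)
    fix q :: "real poly" assume "degree q \<le> m"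
    then have z: "integral {a..b} (\<lambda>t. poly q t * gu t) = 0" "integral {a..b} (\<lambda>t. poly q t * g t) = 0"
      using u(3) g(2) unfolding orth_def by auto
    have "integral {a..b} (\<lambda>t. poly q t * (gu t + 1 * g t))
        = integral {a..b} (\<lambda>t. poly q t * gu t) + integral {a..b} (\<lambda>t. poly q t * g t)"
      using pg pgu by (simp add: distrib_left integral_add pc_integrable pc_mult)
    then show "integral {a..b} (\<lambda>t. poly q t * (gu t + 1 * g t)) = 0" using z by simp
  qed
  then have w0: "?w \<in> H0_space a b (Suc m)"
    by (intro rep_H0_space[OF ab rw] continuous_intros u(2) g(1))
  have z0: "bilin_form a b m c ?z \<phi> = 0" if \<phi>: "\<phi> \<in> test_fun a b" for \<phi>
  proof -
    let ?h = "(deriv ^^ Suc m) \<phi>"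
    have ph: "pc a b ?h" using test_fun_higher_deriv[OF \<phi>] by (rule pc_test_fun)
    have "Jn a k ?h b = 0" if "1 \<le> k" "k \<le> Suc m" for k
      using Jn_deriv_test_fun[OF \<phi>, of b k "Suc m - k"] that ab
        test_fun_zero[OF test_fun_higher_deriv[OF \<phi>], of b] by (auto simp del: funpow.simps)
    then have oh: "orth a b m ?h" using orth_iff_end_data[OF _ ph, of m] ab by simp
    have "bilin_form a b m c ?z \<phi> = integral {a..b} (\<lambda>t. red g t * ?h t)"
      by (rule form_eq[OF rz rep_test_fun[OF \<phi>] oh])
    also have "\<dots> = integral {a..b} (\<lambda>t. poly \<pi> t * ?h t)" using \<pi>(2) by (intro integral_cong) auto
    also have "\<dots> = 0" using oh \<pi>(1) unfolding orth_def by blast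
    finally show ?thesis .
  qed
  have "L2_inner a b f v = bilin_form a b m c ?w v" if v: "v \<in> H0_space a b (Suc m)" for v
  proof -
    have "v \<in> H_space a b (Suc m)" using v by (simp add: H0_space_def)
    then show ?thesis
      using bilin_lin_left[OF u(1) rz] bilin_zero_on_H0[OF rz v z0] sol[OF v] by simp
  qed
  then have "AE t in lebesgue_on {a..b}. ?w t = u t" using unique[OF w0] by blast
  then have "AE t in lebesgue. t \<in> {a..b} \<longrightarrow> ?z t = 0"
    by (simp add: AE_restrict_space_iff del: funpow.simps)
  then have "?z s = 0" if "s \<in> {a..b}" for s
    using continuous_zero_of_AE_zero[OF ab Jn_cont[OF pg] _ that] by blast
  then show ?thesis by (rule Jn_zero_imp_zero[OF ab g(1) _ t])
qed

end

section \<open>Classical derivatives\<close>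

lemma deriv_on_0: "deriv_on S 0 f = f"
  by (simp add: deriv_on_def)

lemma deriv_on_Suc: "deriv_on S (Suc k) f t = vector_derivative (deriv_on S k f) (at t within S)"
  by (simp add: deriv_on_def)

lemma C_on_DERIV:
  assumes "f \<in> C_on k {a..b}" "i < k" "t \<in> {a..b}"
  shows "(deriv_on {a..b} i f has_real_derivative deriv_on {a..b} (Suc i) f t) (at t within {a..b})"
proof -
  have "deriv_on {a..b} i f differentiable (at t within {a..b})"
    using assms unfolding C_on_def differentiable_on_def by auto
  then show ?thesis
    unfolding deriv_on_Suc has_real_derivative_iff_has_vector_derivative
    by (rule vector_derivative_works[THEN iffD1])
qed

lemma C_on_cont:
  assumes "f \<in> C_on k {a..b}" "i \<le> k"
  shows "continuous_on {a..b} (deriv_on {a..b} i f)"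
proof (cases "i = k")
  case True
  then show ?thesis using assms by (simp add: C_on_def)
next
  case False
  then show ?thesis
    using assms unfolding C_on_def by (intro differentiable_imp_continuous_on) auto
qed

lemma C_on_continuous: "f \<in> C_on k {a..b} \<Longrightarrow> continuous_on {a..b} f"
  using C_on_cont[of f k a b 0] by (simp add: deriv_on_0)

lemma deriv_onI:
  assumes "a < b" "t \<in> {a..b}" "(deriv_on {a..b} k f has_real_derivative y) (at t within {a..b})"
  shows "deriv_on {a..b} (Suc k) f t = y"
proof -
  have "deriv_on {a..b} k f differentiable (at t within {a..b})"
    using assms(3) by (meson differentiableI_vector has_real_derivative_iff_has_vector_derivative)
  then have "(deriv_on {a..b} k f has_vector_derivative deriv_on {a..b} (Suc k) f t) (at t within {a..b})"
    unfolding deriv_on_Suc by (rule vector_derivative_works[THEN iffD1])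
  then show ?thesis
    using vector_derivative_unique_within_closed_interval[OF assms(1), of t] assms(2,3)
    by (auto simp: has_real_derivative_iff_has_vector_derivative)
qed

lemma Jn_of_chain:
  assumes "\<And>i t. i < n \<Longrightarrow> t \<in> {a..b} \<Longrightarrow> J a (D (Suc i)) t = D i t" "k \<le> n" "t \<in> {a..b}"
  shows "Jn a k (D n) t = D (n - k) t"
  using assms(2,3)
proof (induction k arbitrary: t)
  case (Suc k)
  have "Jn a (Suc k) (D n) t = J a (D (n - k)) t"
    using Suc by (auto intro!: J_cong)
  also have "n - k = Suc (n - Suc k)" using Suc.prems by simp
  finally show ?case using assms(1)[of "n - Suc k" t] Suc.prems by simp
qed auto

text \<open>Zero data at \<open>a\<close> make iterated integration undo differentiation; zero data
  at \<open>b\<close> turn into orthogonality to polynomials.\<close>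

lemma C_on_rep:
  assumes "a < b" "u \<in> C_on r {a..b}" "Suc m \<le> r"
    and bc: "\<And>k. k \<le> m \<Longrightarrow> deriv_on {a..b} k u a = 0 \<and> deriv_on {a..b} k u b = 0"
  shows "\<And>k t. k \<le> Suc m \<Longrightarrow> t \<in> {a..b} \<Longrightarrow>
      Jn a k (deriv_on {a..b} (Suc m) u) t = deriv_on {a..b} (Suc m - k) u t"
    and "rep a b (Suc m) u (deriv_on {a..b} (Suc m) u)"
    and "orth a b m (deriv_on {a..b} (Suc m) u)"
proof -
  let ?D = "\<lambda>i. deriv_on {a..b} i u"
  have cont: "continuous_on {a..b} (?D (Suc m))" using assms(2,3) by (rule C_on_cont)
  show chain: "Jn a k (?D (Suc m)) t = ?D (Suc m - k) t" if "k \<le> Suc m" "t \<in> {a..b}" for k t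
  proof (rule Jn_of_chain[OF _ that])
    fix i s assume i: "i < Suc m" and s: "s \<in> {a..b}"
    have "(?D (Suc i) has_integral (?D i s - ?D i a)) {a..s}"
    proof (rule fundamental_theorem_of_calculus)
      show "(?D i has_vector_derivative ?D (Suc i) x) (at x within {a..s})" if "x \<in> {a..s}" for x
        using C_on_DERIV[OF assms(2), of i x] i assms(3) that s
        by (auto simp: has_real_derivative_iff_has_vector_derivative
            intro: has_vector_derivative_within_subset)
    qed (use s in auto)
    then show "J a (?D (Suc i)) s = ?D i s" using bc[of i] i by (simp add: J_def integral_unique)
  qed
  show "rep a b (Suc m) u (?D (Suc m))"
    unfolding rep_def using chain[of "Suc m"] pc_continuous[OF cont] by (simp add: deriv_on_0 del: funpow.simps)
  have "Jn a k (?D (Suc m)) b = 0" if "1 \<le> k" "k \<le> Suc m" for k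
    using chain[of k b] that bc[of "Suc m - k"] assms(1) by simp
  then show "orth a b m (?D (Suc m))"
    using assms(1) by (subst orth_iff_end_data[OF _ pc_continuous[OF cont]]) auto
qed

section \<open>Piecewise polynomials\<close>

lemma partition_le:
  assumes "is_partition a b N x" "i \<le> j" "j \<le> N"
  shows "x i \<le> x j"
  using assms(2,3)
proof (induction j)
  case (Suc j)
  have "x j < x (Suc j)" 
    using bspec[of "{1..N}" "\<lambda>j. x (j - 1) < x j" "Suc j"] assms(1) Suc.prems
    unfolding is_partition_def by simp
  then show ?case using Suc by (cases "i = Suc j") auto
qed auto

lemma partition_bounds:
  assumes "is_partition a b N x" "j \<le> N"
  shows "x j \<in> {a..b}"
  using partition_le[OF assms(1), of 0 j] partition_le[OF assms(1), of j N] assms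
  unfolding is_partition_def by auto

lemma partition_less: "is_partition a b N x \<Longrightarrow> j \<in> {1..N} \<Longrightarrow> x (j - 1) < x j"
  unfolding is_partition_def by auto

lemma partition_element:
  assumes "is_partition a b N x" "t \<in> {a..b}" "t \<notin> x ` {..N}"
  obtains j where "j \<in> {1..N}" "t \<in> {x (j - 1)<..<x j}"
proof -
  have ends: "x 0 = a" "x N = b" using assms(1) unfolding is_partition_def by auto
  have "t \<noteq> x N" "t \<noteq> x 0" using assms(3) by auto
  then have ex: "t < x N" "x 0 < t" using ends assms(2) by auto
  define j where "j = (LEAST j. t < x j)"
  have j: "t < x j" "j \<le> N" unfolding j_def using ex(1) by (rule LeastI, rule Least_le)
  have "j \<noteq> 0" using j(1) ex(2) by (metis less_asym)
  then have "j - 1 < j" by simp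
  then have "\<not> t < x (j - 1)" unfolding j_def by (rule not_less_Least)
  moreover have "t \<noteq> x (j - 1)" using assms(3) j(2) by auto
  ultimately show thesis using j \<open>j \<noteq> 0\<close> by (intro that[of j]) auto
qed

text \<open>The index of the element containing \<open>t\<close>, meaningful only off the nodes.\<close>

definition elt :: "(nat \<Rightarrow> real) \<Rightarrow> real \<Rightarrow> nat" where
  "elt x t = (LEAST j. t < x j)"

lemma elt_eq:
  assumes "is_partition a b N x" "j \<in> {1..N}" "t \<in> {x (j - 1)<..<x j}"
  shows "elt x t = j"
  unfolding elt_def
proof (rule Least_equality)
  show "j \<le> i" if "t < x i" for i
  proof (rule ccontr)
    assume "\<not> j \<le> i"
    then have "x i \<le> x (j - 1)" using assms(1,2) by (intro partition_le) auto
    then show False using that assms(3) by auto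
  qed
qed (use assms in auto)

text \<open>Only open elements occur, with neither continuity nor values at the nodes prescribed:
  these are the derivatives of order \<open>m + 1\<close> of splines.\<close>

definition pwpoly :: "nat \<Rightarrow> (nat \<Rightarrow> real) \<Rightarrow> nat \<Rightarrow> (real \<Rightarrow> real) \<Rightarrow> bool" where
  "pwpoly N x d g \<longleftrightarrow>
     (\<forall>j\<in>{1..N}. \<exists>q :: real poly. degree q \<le> d \<and> (\<forall>t\<in>{x (j - 1)<..<x j}. g t = poly q t))"

text \<open>Node values are arbitrary but finite in number, so the sum of their absolute values is
  simply added to the bound.\<close>

lemma pw_pc:
  assumes "is_partition a b N x"
    and pc: "\<And>j. j \<in> {1..N} \<Longrightarrow> continuous_on {x (j - 1)..x j} (G j)"
    and eq: "\<And>j t. j \<in> {1..N} \<Longrightarrow> t \<in> {x (j - 1)<..<x j} \<Longrightarrow> g t = G j t"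
  shows "pc a b g"
proof -
  have "\<exists>B\<ge>0. \<forall>t\<in>{x (j - 1)..x j}. \<bar>G j t\<bar> \<le> B" if "j \<in> {1..N}" for j
    using pc_bound[OF pc_continuous[OF pc[OF that]]] by metis
  then obtain B where B: "\<And>j. j \<in> {1..N} \<Longrightarrow> B j \<ge> 0 \<and> (\<forall>t\<in>{x (j - 1)..x j}. \<bar>G j t\<bar> \<le> B j)"
    by metis
  let ?B = "(\<Sum>j\<in>{1..N}. B j) + (\<Sum>s\<in>x ` {..N}. \<bar>g s\<bar>)"
  show ?thesis
  proof (rule pcI[of a b g ?B "x ` {..N}"])
    fix t assume t: "t \<in> {a..b}"
    have n: "(\<Sum>j\<in>{1..N}. B j) \<ge> 0" "(\<Sum>s\<in>x ` {..N}. \<bar>g s\<bar>) \<ge> 0" using B by (auto intro: sum_nonneg)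
    show "\<bar>g t\<bar> \<le> ?B"
    proof (cases "t \<in> x ` {..N}")
      case True
      then have "\<bar>g t\<bar> \<le> (\<Sum>s\<in>x ` {..N}. \<bar>g s\<bar>)" by (intro member_le_sum) auto
      then show ?thesis using n by linarith
    next
      case False
      then obtain j where j: "j \<in> {1..N}" "t \<in> {x (j - 1)<..<x j}"
        using partition_element[OF assms(1) t] by blast
      have "\<bar>g t\<bar> \<le> B j" using eq[OF j] B[OF j(1)] j(2) by auto
      also have "B j \<le> (\<Sum>j\<in>{1..N}. B j)" using j(1) B by (intro member_le_sum) auto
      finally show ?thesis using n by linarith
    qed
  next
    fix t assume t: "t \<in> {a<..<b} - x ` {..N}"
    then obtain j where j: "j \<in> {1..N}" "t \<in> {x (j - 1)<..<x j}"
      using partition_element[OF assms(1), of t] by auto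
    have "\<forall>\<^sub>F s in nhds t. g s = G j s"
      using eventually_nhds_in_open[of "{x (j - 1)<..<x j}" t] j eq[OF j(1)]
      by (auto elim!: eventually_mono)
    moreover have "isCont (G j) t" using continuous_on_interior[OF pc[OF j(1)], of t] j(2) by simp
    ultimately show "isCont g t" using isCont_cong by blast
  qed auto
qed

lemma pwpoly_pc:
  assumes "is_partition a b N x" "pwpoly N x d g"
  shows "pc a b g"
proof -
  obtain q where "\<And>j. j \<in> {1..N} \<Longrightarrow> \<forall>t\<in>{x (j - 1)<..<x j}. g t = poly (q j) t"
    using assms(2) unfolding pwpoly_def by metis
  then show ?thesis
    by (intro pw_pc[OF assms(1), of "\<lambda>j. poly (q j)"]) (auto intro: continuous_intros)
qed

lemma pwpoly_diff:
  assumes "pwpoly N x d f" "pwpoly N x d g"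
  shows "pwpoly N x d (\<lambda>t. f t - g t)"
  unfolding pwpoly_def
proof
  fix j assume "j \<in> {1..N}"
  then obtain q s :: "real poly" where "degree q \<le> d" "\<forall>t\<in>{x (j - 1)<..<x j}. f t = poly q t"
    "degree s \<le> d" "\<forall>t\<in>{x (j - 1)<..<x j}. g t = poly s t"
    using assms unfolding pwpoly_def by metis
  then show "\<exists>q. degree q \<le> d \<and> (\<forall>t\<in>{x (j - 1)<..<x j}. f t - g t = poly q t)"
    by (intro exI[of _ "q - s"]) (auto intro: degree_diff_le)
qed

lemma integral_pieces_zero:
  assumes "is_partition a b N x" "pc a b F"
    "\<And>j. j \<in> {1..N} \<Longrightarrow> integral {x (j - 1)..x j} F = 0"
  shows "integral {a..b} F = 0"
proof -
  have "integral {a..x j} F = 0" if "j \<le> N" for j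
    using that
  proof (induction j)
    case 0
    then show ?case using assms(1) by (simp add: is_partition_def)
  next
    case (Suc j)
    have "x j \<in> {a..b}" "x (Suc j) \<in> {a..b}" "x j \<le> x (Suc j)"
      using partition_bounds[OF assms(1)] partition_le[OF assms(1), of j "Suc j"] Suc.prems by auto
    then have "integral {a..x j} F + integral {x j..x (Suc j)} F = integral {a..x (Suc j)} F"
      using assms(2) by (intro Henstock_Kurzweil_Integration.integral_combine) (auto intro: pc_integrable_subset)
    then show ?case using Suc assms(3)[of "Suc j"] by simp
  qed
  from this[of N] show ?thesis using assms(1) by (simp add: is_partition_def)
qed

lemma pwpoly_J:
  assumes "is_partition a b N x" "pwpoly N x d g"
  shows "pwpoly N x (Suc d) (J a g)"
  unfolding pwpoly_def
proof
  fix j assume j: "j \<in> {1..N}"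
  then obtain q :: "real poly" where q: "degree q \<le> d" "\<forall>t\<in>{x (j - 1)<..<x j}. g t = poly q t"
    using assms(2) unfolding pwpoly_def by blast
  obtain Q where Q: "pderiv Q = q" "degree Q \<le> Suc (degree q)" using poly_antiderivative by blast
  let ?l = "x (j - 1)"
  have b: "?l \<in> {a..b}" "x j \<in> {a..b}" using partition_bounds[OF assms(1)] j by auto
  have "J a g t = poly (Q + [:J a g ?l - poly Q ?l:]) t" if t: "t \<in> {?l<..<x j}" for t
  proof -
    have "integral {?l..t} g = integral {?l..t} (poly q)"
      by (rule integral_spike[of "{?l}"]) (use q(2) t in auto)
    also have "\<dots> = poly Q t - poly Q ?l" using integral_poly_pderiv[of ?l t Q] Q(1) t by simp
    finally have "integral {?l..t} g = poly Q t - poly Q ?l" .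
    moreover have "integral {a..?l} g + integral {?l..t} g = integral {a..t} g"
      using b t pwpoly_pc[OF assms] by (intro Henstock_Kurzweil_Integration.integral_combine)
        (auto intro: pc_integrable_subset)
    ultimately show ?thesis by (simp add: J_def)
  qed
  moreover have "degree (Q + [:J a g ?l - poly Q ?l:]) \<le> Suc d"
    using Q(2) q(1) by (intro degree_add_le) auto
  ultimately show "\<exists>q. degree q \<le> Suc d \<and> (\<forall>t\<in>{?l<..<x j}. J a g t = poly q t)" by blast
qed

lemma pwpoly_Jn:
  assumes "is_partition a b N x" "pwpoly N x d g"
  shows "pwpoly N x (d + n) (Jn a n g)"
  by (induction n) (auto intro: assms pwpoly_J)

text \<open>Together with \<open>spline_rep\<close> this identifies splines with zero end data with
  the piecewise polynomials of degree \<open>p - m - 1\<close> orthogonal to the polynomials of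
  degree \<open>m\<close>. Every such piecewise polynomial is therefore available for
  testing.\<close>

lemma spline_of_pwpoly:
  assumes "is_partition a b N x" "a < b" "pwpoly N x d g" "orth a b m g"
  shows "Jn a (Suc m) g \<in> spline_space0 (d + Suc m) m a b N x"
proof -
  let ?V = "Jn a (Suc m) g"
  have g: "pc a b g" by (rule pwpoly_pc[OF assms(1,3)])
  have step: "(Jn a (Suc m - i) g has_real_derivative Jn a (Suc m - Suc i) g t) (at t within {a..b})"
    if "i < m" "t \<in> {a..b}" for i t
  proof -
    have "Suc m - i = Suc (Suc m - Suc i)" using that(1) by simp
    moreover have "continuous_on {a..b} (Jn a (Suc m - Suc i) g)" using that(1) by (intro Jn_cont g) auto
    ultimately show ?thesis using J_deriv_within[OF _ that(2)] by simp
  qed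
  have der: "deriv_on {a..b} i ?V t = Jn a (Suc m - i) g t" if "i \<le> m" "t \<in> {a..b}" for i t
    using that
  proof (induction i arbitrary: t)
    case (Suc i)
    have "(deriv_on {a..b} i ?V has_real_derivative Jn a (Suc m - Suc i) g t) (at t within {a..b})"
      by (rule has_field_derivative_transform_within[OF step zero_less_one Suc.prems(2)])
         (use Suc in auto)
    then show ?case by (rule deriv_onI[OF assms(2) Suc.prems(2)])
  qed (simp add: deriv_on_0)
  have "?V \<in> C_on m {a..b}"
    unfolding C_on_def
  proof safe
    fix i assume i: "i < m"
    show "deriv_on {a..b} i ?V differentiable_on {a..b}"
      unfolding differentiable_on_def
    proof
      fix t assume t: "t \<in> {a..b}"
      have "(deriv_on {a..b} i ?V has_real_derivative Jn a (Suc m - Suc i) g t) (at t within {a..b})"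
        by (rule has_field_derivative_transform_within[OF step[OF i t] zero_less_one t])
           (use der i in auto)
      then show "deriv_on {a..b} i ?V differentiable (at t within {a..b})"
        by (meson differentiableI_vector has_real_derivative_iff_has_vector_derivative)
    qed
  next
    have "continuous_on {a..b} (Jn a (Suc m - m) g)" by (intro Jn_cont g) auto
    then show "continuous_on {a..b} (deriv_on {a..b} m ?V)"
      by (rule continuous_on_eq) (use der in auto)
  qed
  moreover have "pwpoly N x (d + Suc m) ?V" using assms(1,3) by (rule pwpoly_Jn)
  moreover have "deriv_on {a..b} k ?V a = 0 \<and> deriv_on {a..b} k ?V b = 0" if k: "k \<le> m" for k
  proof -
    have "Jn a (Suc m - k) g b = 0" using orth_iff_end_data[OF _ g, of m] assms(2,4) k by auto
    then show ?thesis using der[OF k] assms(2) k by (auto simp del: funpow.simps)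
  qed
  ultimately show ?thesis unfolding spline_space0_def spline_space_def pwpoly_def by blast
qed

text \<open>On open elements classical derivatives are those of the pieces. They combine to a global
  representation because all orders up to \<open>m\<close> are continuous across the nodes.\<close>

lemma spline_rep:
  assumes "is_partition a b N x" "a < b" "v \<in> spline_space0 p m a b N x"
  defines "g \<equiv> deriv_on {a..b} (Suc m) v"
  shows "\<And>j q i t. j \<in> {1..N} \<Longrightarrow> \<forall>t\<in>{x (j - 1)<..<x j}. v t = poly q t \<Longrightarrow> t \<in> {x (j - 1)<..<x j} \<Longrightarrow>
      deriv_on {a..b} i v t = poly ((pderiv ^^ i) q) t"
    and "pwpoly N x (p - Suc m) g"
    and "\<And>k t. k \<le> Suc m \<Longrightarrow> t \<in> {a..b} \<Longrightarrow> Jn a k g t = deriv_on {a..b} (Suc m - k) v t"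
    and "rep a b (Suc m) v g" and "orth a b m g"
proof -
  let ?D = "\<lambda>i. deriv_on {a..b} i v"
  have v: "v \<in> C_on m {a..b}" and bc: "\<And>k. k \<le> m \<Longrightarrow> ?D k a = 0 \<and> ?D k b = 0"
    and pw: "\<And>j. j \<in> {1..N} \<Longrightarrow> \<exists>q :: real poly. degree q \<le> p \<and> (\<forall>t\<in>{x (j - 1)<..<x j}. v t = poly q t)"
    using assms(3) unfolding spline_space0_def spline_space_def by auto
  have sub: "{x (j - 1)<..<x j} \<subseteq> {a<..<b}" if "j \<in> {1..N}" for j
  proof -
    have "j - 1 \<le> N" "j \<le> N" using that by auto
    then show ?thesis using partition_bounds[OF assms(1)] by fastforce
  qed
  have DER: "(?D i has_real_derivative poly ((pderiv ^^ Suc i) q) t) (at t)"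
    if "j \<in> {1..N}" "t \<in> {x (j - 1)<..<x j}" "\<And>t. t \<in> {x (j - 1)<..<x j} \<Longrightarrow> ?D i t = poly ((pderiv ^^ i) q) t"
    for i j q t
  proof -
    have "\<forall>\<^sub>F s in nhds t. poly ((pderiv ^^ i) q) s = ?D i s"
      using eventually_nhds_in_open[of "{x (j - 1)<..<x j}" t] that by (auto elim!: eventually_mono)
    then have "(poly ((pderiv ^^ i) q) has_real_derivative poly ((pderiv ^^ Suc i) q) t) (at t)
        \<longleftrightarrow> ?thesis" by (intro DERIV_cong_ev refl)
    then show ?thesis using poly_DERIV[of "(pderiv ^^ i) q" t] by simp
  qed
  show eq: "?D i t = poly ((pderiv ^^ i) q) t"
    if "j \<in> {1..N}" "\<forall>t\<in>{x (j - 1)<..<x j}. v t = poly q t" "t \<in> {x (j - 1)<..<x j}" for j q i t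
    using that(3)
  proof (induction i arbitrary: t)
    case 0
    then show ?case using that by (simp add: deriv_on_0)
  next
    case (Suc i)
    have "(?D i has_real_derivative poly ((pderiv ^^ Suc i) q) t) (at t)"
      using DER[OF that(1) Suc.prems Suc.IH] .
    then have "(?D i has_real_derivative poly ((pderiv ^^ Suc i) q) t) (at t within {a..b})"
      by (rule has_field_derivative_at_within)
    then show ?case using sub[OF that(1)] Suc.prems by (intro deriv_onI[OF assms(2)]) auto
  qed
  show pwg: "pwpoly N x (p - Suc m) g"
    unfolding pwpoly_def
  proof
    fix j assume j: "j \<in> {1..N}"
    then obtain q :: "real poly" where q: "degree q \<le> p" "\<forall>t\<in>{x (j - 1)<..<x j}. v t = poly q t"
      using pw by blast
    then show "\<exists>q. degree q \<le> p - Suc m \<and> (\<forall>t\<in>{x (j - 1)<..<x j}. g t = poly q t)"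
      using eq[OF j q(2)] unfolding g_def
      by (intro exI[of _ "(pderiv ^^ Suc m) q"])
         (auto simp: degree_higher_pderiv simp del: funpow.simps intro: diff_le_mono)
  qed
  show chain: "Jn a k g t = ?D (Suc m - k) t" if "k \<le> Suc m" "t \<in> {a..b}" for k t
    unfolding g_def
  proof (rule Jn_of_chain[OF _ that])
    fix i s assume i: "i < Suc m" and s: "s \<in> {a..b}"
    have "(?D (Suc i) has_integral (?D i s - ?D i a)) {a..s}"
    \<comment> \<open>The derivative of order \<open>m + 1\<close> may fail to exist at the nodes;
      continuity of the order below makes this finite set harmless.\<close>
    proof (rule fundamental_theorem_of_calculus_interior_strong[of "x ` {..N}"])
      show "continuous_on {a..s} (?D i)"
        using C_on_cont[OF v, of i] i s by (auto intro: continuous_on_subset)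
      fix y assume y: "y \<in> {a<..<s} - x ` {..N}"
      then obtain j where j: "j \<in> {1..N}" "y \<in> {x (j - 1)<..<x j}"
        using partition_element[OF assms(1), of y] s by auto
      obtain q :: "real poly" where q: "\<forall>t\<in>{x (j - 1)<..<x j}. v t = poly q t" using pw[OF j(1)] by blast
      have "(?D i has_real_derivative ?D (Suc i) y) (at y)"
        using DER[OF j eq[OF j(1) q]] eq[OF j(1) q j(2), of "Suc i"] by simp
      then show "(?D i has_vector_derivative ?D (Suc i) y) (at y)"
        by (simp add: has_real_derivative_iff_has_vector_derivative)
    qed (use s in auto)
    then show "J a (?D (Suc i)) s = ?D i s" using bc[of i] i by (simp add: J_def integral_unique)
  qed
  have pg: "pc a b g" by (rule pwpoly_pc[OF assms(1) pwg])
  show "rep a b (Suc m) v g"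
    unfolding rep_def using chain[of "Suc m"] pg by (simp add: deriv_on_0 del: funpow.simps)
  have "Jn a k g b = 0" if "1 \<le> k" "k \<le> Suc m" for k
    using chain[of k b] that bc[of "Suc m - k"] assms(2) by simp
  then show "orth a b m g" using assms(2) by (subst orth_iff_end_data[OF _ pg]) auto
qed

section \<open>Consistency and discrete stability\<close>

lemma nrm_const: "a \<le> b \<Longrightarrow> K \<ge> 0 \<Longrightarrow> nrm a b (\<lambda>t. K) = K * sqrt (b - a)"
  by (simp add: nrm_def real_sqrt_mult mult.commute)

lemma step_le_max_step: "j \<in> {1..N} \<Longrightarrow> x j - x (j - 1) \<le> max_step N x"
  unfolding max_step_def by (intro Max_ge) auto

lemma max_step_bounds:
  assumes "is_partition a b N x"
  shows "0 < max_step N x" "max_step N x \<le> b - a"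
proof -
  have N: "N > 0" using assms by (simp add: is_partition_def)
  then have "1 \<in> {1..N}" by simp
  then show "0 < max_step N x"
    using step_le_max_step[of 1 N x] partition_less[OF assms, of 1] by linarith
  show "max_step N x \<le> b - a"
    unfolding max_step_def
  proof (rule Max.boundedI)
    fix y assume "y \<in> (\<lambda>j. x j - x (j - 1)) ` {1..N}"
    then obtain j where j: "j \<in> {1..N}" "y = x j - x (j - 1)" by blast
    then have "j \<le> N" "j - 1 \<le> N" by auto
    then show "y \<le> b - a" using partition_bounds[OF assms, of j] partition_bounds[OF assms, of "j - 1"] j(2) by auto
  qed (use N in auto)
qed

lemma C_on_lipschitz:
  assumes "f \<in> C_on k {a..b}" "k \<ge> 1"
  obtains L where "L \<ge> 0" "\<And>s t. s \<in> {a..b} \<Longrightarrow> t \<in> {a..b} \<Longrightarrow> \<bar>f t - f s\<bar> \<le> L * \<bar>t - s\<bar>"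
proof -
  obtain L where L: "L \<ge> 0" "\<And>t. t \<in> {a..b} \<Longrightarrow> \<bar>deriv_on {a..b} 1 f t\<bar> \<le> L"
    using pc_bound[OF pc_continuous[OF C_on_cont[OF assms]]] by blast
  have "norm (f t - f s) \<le> L * norm (t - s)" if "s \<in> {a..b}" "t \<in> {a..b}" for s t
    by (rule field_differentiable_bound[of "{a..b}" f "deriv_on {a..b} 1 f"])
       (use C_on_DERIV[OF assms(1), of 0] assms(2) L that in \<open>auto simp: deriv_on_0\<close>)
  then show thesis using L(1) by (intro that[of L]) auto
qed

lemma partition_element_bounds:
  assumes "is_partition a b N x" "j \<in> {1..N}" "t \<in> {x (j - 1)<..<x j}"
  shows "x (j - 1) \<in> {a..b}" "t \<in> {a..b}" "\<bar>t - x (j - 1)\<bar> \<le> max_step N x"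
proof -
  have "j - 1 \<le> N" "j \<le> N" using assms(2) by auto
  then have b: "x (j - 1) \<in> {a..b}" "x j \<in> {a..b}" using partition_bounds[OF assms(1)] by auto
  then show "x (j - 1) \<in> {a..b}" "t \<in> {a..b}" using assms(3) by auto
  show "\<bar>t - x (j - 1)\<bar> \<le> max_step N x" using step_le_max_step[OF assms(2), of x] assms(3) by auto
qed

context elliptic_form
begin

text \<open>
  Freezing \<open>c (m + 1)\<close> and the Volterra part at the left node of each element gives a piecewise
  polynomial \<open>D\<close> close to \<open>red g\<close>; its part orthogonal to the polynomials of degree \<open>m\<close> is an
  admissible test function.
\<close>

lemma discrete_stability:
  assumes L: "L \<ge> 0" "\<And>s t. s \<in> {a..b} \<Longrightarrow> t \<in> {a..b} \<Longrightarrow> \<bar>c (Suc m) t - c (Suc m) s\<bar> \<le> L * \<bar>t - s\<bar>"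
  obtains C where "C \<ge> 0" "\<And>N x d g \<epsilon>. is_partition a b N x \<Longrightarrow> pwpoly N x d g \<Longrightarrow> m \<le> d \<Longrightarrow>
      (\<And>w. pwpoly N x d w \<Longrightarrow> orth a b m w \<Longrightarrow> \<bar>integral {a..b} (\<lambda>t. red g t * w t)\<bar> \<le> \<epsilon> * nrm a b w) \<Longrightarrow>
      \<epsilon> \<ge> 0 \<Longrightarrow>
      \<exists>\<pi>. degree \<pi> \<le> m \<and> nrm a b (\<lambda>t. red g t - poly \<pi> t) \<le> \<epsilon> + C * max_step N x * nrm a b g"
proof -
  obtain M where M: "M \<ge> 0"
    "\<And>g s t. pc a b g \<Longrightarrow> s \<in> {a..b} \<Longrightarrow> t \<in> {a..b} \<Longrightarrow>
       \<bar>low g t - low g s\<bar> \<le> M * J a (\<lambda>s. \<bar>g s\<bar>) b * \<bar>t - s\<bar>"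
    using low_bounds by metis
  define C where "C = L + M * (b - a)"
  have C: "C \<ge> 0" using L M ab by (simp add: C_def)
  show thesis
  \<comment> \<open>The freezing error enters twice: in the distance from \<open>red g\<close> to
    \<open>D\<close> and in the bound for the test function \<open>w\<close>.\<close>
  proof (rule that[of "2 * C"])
    show "2 * C \<ge> 0" using C by simp
    fix N x d g \<epsilon>
    assume P: "is_partition a b N x" and g: "pwpoly N x d g" and d: "m \<le> d"
      and test: "\<And>w. pwpoly N x d w \<Longrightarrow> orth a b m w \<Longrightarrow> \<bar>integral {a..b} (\<lambda>t. red g t * w t)\<bar> \<le> \<epsilon> * nrm a b w"
      and \<epsilon>: "\<epsilon> \<ge> 0"
    have pg: "pc a b g" by (rule pwpoly_pc[OF P g])
    define H where "H = max_step N x"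
    have H: "H > 0" using max_step_bounds[OF P] by (simp add: H_def)
    define lf where "lf t = x (elt x t - 1)" for t
    define D where "D t = c (Suc m) (lf t) * g t + low g (lf t)" for t
    have lf: "lf t = x (j - 1)" if "j \<in> {1..N}" "t \<in> {x (j - 1)<..<x j}" for j t
      using elt_eq[OF P that] by (simp add: lf_def)
    have pwD: "pwpoly N x d D"
      unfolding pwpoly_def
    proof
      fix j assume j: "j \<in> {1..N}"
      then obtain q :: "real poly" where q: "degree q \<le> d" "\<forall>t\<in>{x (j - 1)<..<x j}. g t = poly q t"
        using g unfolding pwpoly_def by blast
      let ?q = "smult (c (Suc m) (x (j - 1))) q + [:low g (x (j - 1)):]"
      have "degree ?q \<le> d" using q(1) by (intro degree_add_le order_trans[OF degree_smult_le]) auto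
      moreover have "D t = poly ?q t" if "t \<in> {x (j - 1)<..<x j}" for t
        using q(2) lf[OF j that] that by (simp add: D_def)
      ultimately show "\<exists>q. degree q \<le> d \<and> (\<forall>t\<in>{x (j - 1)<..<x j}. D t = poly q t)" by blast
    qed
    have pD: "pc a b D" by (rule pwpoly_pc[OF P pwD])
    have pr: "pc a b (red g)" using pg by (rule pc_red)
    let ?I = "J a (\<lambda>s. \<bar>g s\<bar>) b"
    have I0: "?I \<ge> 0" using J_abs_le[OF pg, of b] ab by auto
    have "nrm a b (\<lambda>t. red g t - D t) \<le> nrm a b (\<lambda>t. H * (L * \<bar>g t\<bar> + M * ?I))"
    proof (rule nrm_le_off_finite)
      show "\<bar>red g t - D t\<bar> \<le> H * (L * \<bar>g t\<bar> + M * ?I)" if t: "t \<in> {a..b} - x ` {..N}" for t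
      proof -
        obtain j where j: "j \<in> {1..N}" "t \<in> {x (j - 1)<..<x j}"
          using partition_element[OF P, of t] t by blast
        note b = partition_element_bounds[OF P j, folded H_def]
        have "\<bar>c (Suc m) t - c (Suc m) (x (j - 1))\<bar> \<le> L * H"
          using L(2)[OF b(1,2)] mult_left_mono[OF b(3) L(1)] by linarith
        then have 1: "\<bar>(c (Suc m) t - c (Suc m) (x (j - 1))) * g t\<bar> \<le> L * H * \<bar>g t\<bar>"
          unfolding abs_mult by (rule mult_right_mono) simp
        have 2: "\<bar>low g t - low g (x (j - 1))\<bar> \<le> M * ?I * H"
          using M(2)[OF pg b(1,2)] mult_left_mono[OF b(3), of "M * ?I"] M(1) I0 by fastforce
        have "red g t - D t = (c (Suc m) t - c (Suc m) (x (j - 1))) * g t + (low g t - low g (x (j - 1)))"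
          by (simp add: red_def D_def lf[OF j] algebra_simps)
        then show ?thesis using 1 2 by (simp add: algebra_simps)
      qed
      show "pc a b (\<lambda>t. H * (L * \<bar>g t\<bar> + M * ?I))" by (intro pc_cmult pc_add pc_abs pg pc_const)
    qed (use pr pD in \<open>auto intro: pc_diff\<close>)
    also have "\<dots> = H * nrm a b (\<lambda>t. L * \<bar>g t\<bar> + M * ?I)" using H by (simp add: nrm_cmult)
    also have "\<dots> \<le> H * (C * nrm a b g)"
    proof (rule mult_left_mono)
      have "nrm a b (\<lambda>t. L * \<bar>g t\<bar> + M * ?I) \<le> nrm a b (\<lambda>t. L * \<bar>g t\<bar>) + nrm a b (\<lambda>t. M * ?I)"
        by (intro nrm_triangle pc_cmult pc_abs pg pc_const)
      also have "nrm a b (\<lambda>t. L * \<bar>g t\<bar>) = L * nrm a b g"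
        using nrm_cmult[of a b L "\<lambda>t. \<bar>g t\<bar>"] L(1) by (simp add: nrm_def)
      also have "nrm a b (\<lambda>t. M * ?I) = M * ?I * sqrt (b - a)"
        using M(1) I0 ab by (intro nrm_const) auto
      also have "M * ?I * sqrt (b - a) \<le> M * (sqrt (b - a) * nrm a b g) * sqrt (b - a)"
        using integral_abs_le_nrm[OF pg] M(1) ab by (intro mult_right_mono mult_left_mono) (auto simp: J_def)
      also have "\<dots> = M * (sqrt (b - a) * sqrt (b - a)) * nrm a b g" by (simp only: mult_ac)
      also have "\<dots> = M * (b - a) * nrm a b g" using ab by simp
      finally show "nrm a b (\<lambda>t. L * \<bar>g t\<bar> + M * ?I) \<le> C * nrm a b g" by (simp add: C_def distrib_right)
    qed (use H in auto)
    finally have near: "nrm a b (\<lambda>t. red g t - D t) \<le> H * (C * nrm a b g)" .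
    obtain \<pi> where \<pi>: "degree \<pi> \<le> m" "orth a b m (\<lambda>t. D t - poly \<pi> t)"
      using poly_projection[OF ab pD] by blast
    define w where "w t = D t - poly \<pi> t" for t
    have "pwpoly N x d (poly \<pi>)" unfolding pwpoly_def using \<pi>(1) d by (auto intro: order_trans)
    then have pww: "pwpoly N x d w" unfolding w_def[abs_def] using pwD by (intro pwpoly_diff)
    have ow: "orth a b m w" using \<pi>(2) by (simp add: w_def[abs_def])
    have pw: "pc a b w" by (rule pwpoly_pc[OF P pww])
    \<comment> \<open>Since \<open>w\<close> is \<open>D\<close> minus its projection, one factor
      \<open>w\<close> in the square is written as \<open>red g - (red g - D) - \<pi>\<close>; the
      polynomial drops out by orthogonality.\<close>
    have "(nrm a b w)\<^sup>2 = integral {a..b} (\<lambda>t. red g t * w t - (red g t - D t) * w t - poly \<pi> t * w t)"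
      unfolding nrm_square[OF pw] by (rule integral_cong) (simp add: w_def power2_eq_square algebra_simps)
    also have "\<dots> = integral {a..b} (\<lambda>t. red g t * w t) - integral {a..b} (\<lambda>t. (red g t - D t) * w t)
        - integral {a..b} (\<lambda>t. poly \<pi> t * w t)"
      using pr pD pw by (simp add: integral_diff pc_integrable pc_diff pc_mult)
    also have "integral {a..b} (\<lambda>t. poly \<pi> t * w t) = 0" using ow \<pi>(1) unfolding orth_def by blast
    finally have "(nrm a b w)\<^sup>2 \<le> \<epsilon> * nrm a b w + nrm a b (\<lambda>t. red g t - D t) * nrm a b w"
      using test[OF pww ow] cauchy_schwarz[OF pc_diff[OF pr pD] pw] by linarith
    also have "\<dots> \<le> (\<epsilon> + H * (C * nrm a b g)) * nrm a b w"
      using mult_right_mono[OF near nrm_nonneg[OF pw]] by (simp add: distrib_right)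
    finally have "nrm a b w * nrm a b w \<le> (\<epsilon> + H * (C * nrm a b g)) * nrm a b w"
      by (simp only: power2_eq_square)
    moreover have "\<epsilon> + H * (C * nrm a b g) \<ge> 0" using \<epsilon> H C pg by (intro add_nonneg_nonneg mult_nonneg_nonneg) auto
    ultimately have wle: "nrm a b w \<le> \<epsilon> + H * (C * nrm a b g)"
      using nrm_nonneg[OF pw] by (cases "nrm a b w = 0") (auto simp: mult_le_cancel_right)
    have "nrm a b (\<lambda>t. red g t - poly \<pi> t) = nrm a b (\<lambda>t. (red g t - D t) + w t)" by (simp add: w_def)
    also have "\<dots> \<le> nrm a b (\<lambda>t. red g t - D t) + nrm a b w" using pr pD pw by (intro nrm_triangle pc_diff)
    also have "\<dots> \<le> \<epsilon> + 2 * C * max_step N x * nrm a b g"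
      using near wle by (simp add: H_def algebra_simps)
    finally show "\<exists>\<pi>. degree \<pi> \<le> m \<and> nrm a b (\<lambda>t. red g t - poly \<pi> t) \<le> \<epsilon> + 2 * C * max_step N x * nrm a b g"
      using \<pi>(1) by blast
  qed
qed

text \<open>For \<open>k \<le> m\<close> the error of order \<open>k\<close> is already of size
  \<open>H ^ (p + 1 - k)\<close>, and Cauchy-Schwarz is enough. The term of order
  \<open>m + 1\<close> is one power short. There the leading part \<open>E\<close> of the error is
  orthogonal on each element to \<open>w\<close>, which has degree at most \<open>p - m - 1\<close>,
  provided the coefficient is constant; freezing it at the left node costs the missing factor
  \<open>H\<close>.\<close>

lemma consistency:
  assumes p: "p \<ge> 2 * m + 1"
    and L: "L \<ge> 0" "\<And>s t. s \<in> {a..b} \<Longrightarrow> t \<in> {a..b} \<Longrightarrow> \<bar>c (Suc m) t - c (Suc m) s\<bar> \<le> L * \<bar>t - s\<bar>"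
    and u: "u \<in> C_on (p + 2) {a..b}"
    and bc: "\<And>k. k \<le> m \<Longrightarrow> deriv_on {a..b} k u a = 0 \<and> deriv_on {a..b} k u b = 0"
  obtains C where "C \<ge> 0" "\<And>N x W w. is_partition a b N x \<Longrightarrow> W \<in> spline_space0 p m a b N x \<Longrightarrow>
      is_HJ_interpolant p m a b N x u W \<Longrightarrow> pwpoly N x (p - Suc m) w \<Longrightarrow> orth a b m w \<Longrightarrow>
      \<bar>integral {a..b} (\<lambda>t. red (\<lambda>t. deriv_on {a..b} (Suc m) u t - deriv_on {a..b} (Suc m) W t) t * w t)\<bar>
        \<le> C * max_step N x ^ (p + 1 - m) * nrm a b w"
proof -
  let ?d = "\<lambda>i. deriv_on {a..b} i u"
  obtain M1 where M1: "M1 \<ge> 0" "\<And>t. t \<in> {a..b} \<Longrightarrow> \<bar>?d (p + 2) t\<bar> \<le> M1"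
    using pc_bound[OF pc_continuous[OF C_on_cont[OF u, of "p + 2"]]] by auto
  obtain M2 where M2: "M2 \<ge> 0" "\<And>t. t \<in> {a..b} \<Longrightarrow> \<bar>?d (p + 1) t\<bar> \<le> M2"
    using pc_bound[OF pc_continuous[OF C_on_cont[OF u, of "p + 1"]]] by auto
  define M where "M = M1 + M2"
  have M: "M \<ge> 0" "\<And>t. t \<in> {a..b} \<Longrightarrow> \<bar>?d (p + 2) t\<bar> \<le> M" "\<And>t. t \<in> {a..b} \<Longrightarrow> \<bar>?d (p + 1) t\<bar> \<le> M"
    using M1 M2 by (force simp: M_def)+
  have h0: "b - a > 0" using ab by simp
  obtain K where K: "K \<ge> 0"
    "\<And>l r d q. l < r \<Longrightarrow> r - l \<le> b - a \<Longrightarrow>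
      (\<And>i t. i < p + 2 \<Longrightarrow> t \<in> {l..r} \<Longrightarrow> (d i has_real_derivative d (Suc i) t) (at t within {l..r})) \<Longrightarrow>
      (\<And>t. t \<in> {l..r} \<Longrightarrow> \<bar>d (p + 2) t\<bar> \<le> M) \<Longrightarrow> \<bar>d (p + 1) l\<bar> \<le> M \<Longrightarrow> degree q \<le> p \<Longrightarrow>
      (\<And>k. k \<le> m \<Longrightarrow> poly ((pderiv ^^ k) q) l = d k l \<and> poly ((pderiv ^^ k) q) r = d k r) \<Longrightarrow>
      (\<And>\<mu>. \<mu> \<in> HJ_nodes p m \<Longrightarrow> poly q ((l + r) / 2 + (r - l) * \<mu> / 2) = d 0 ((l + r) / 2 + (r - l) * \<mu> / 2)) \<Longrightarrow>
      (\<forall>k\<le>m. \<forall>t\<in>{l..r}. \<bar>d k t - poly ((pderiv ^^ k) q) t\<bar> \<le> K * (r - l) ^ (p + 1 - k)) \<and>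
      (\<exists>E. (\<forall>t\<in>{l..r}. \<bar>d (Suc m) t - poly ((pderiv ^^ Suc m) q) t - poly E t\<bar> \<le> K * (r - l) ^ (p + 1 - m)) \<and>
           (\<forall>t\<in>{l..r}. \<bar>poly E t\<bar> \<le> K * (r - l) ^ (p - m)) \<and>
           (\<forall>s. degree s < p - m \<longrightarrow> integral {l..r} (poly (E * s)) = 0))"
    using interpolation_error[OF p M(1) h0] by blast
  obtain B where B: "B \<ge> 0" "\<And>k t. k \<le> Suc m \<Longrightarrow> t \<in> {a..b} \<Longrightarrow> \<bar>c k t\<bar> \<le> B"
    using c_bound by blast
  \<comment> \<open>Bounds the surplus powers \<open>H ^ (m - k)\<close> for all
    \<open>k \<le> m\<close> at once; the \<open>1\<close> makes the base at least 1, so that larger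
    exponents only increase it.\<close>
  define Q where "Q = (1 + (b - a)) ^ m"
  have Q: "Q \<ge> 0" using ab by (simp add: Q_def)
  define R where "R = B * (K * Q) * sqrt (b - a)"
  have R: "R \<ge> 0" using B(1) K(1) Q ab by (simp add: R_def)
  define C where "C = (\<Sum>k\<le>m. R * (b - a) ^ (Suc m - k)) + (B + L) * K * sqrt (b - a)"
  have C: "C \<ge> 0"
    unfolding C_def using R ab B(1) L(1) K(1) by (intro add_nonneg_nonneg sum_nonneg mult_nonneg_nonneg) auto
  show thesis
  proof (rule that[OF C])
    fix N x W w
    assume P: "is_partition a b N x" and W: "W \<in> spline_space0 p m a b N x"
      and I: "is_HJ_interpolant p m a b N x u W" and w: "pwpoly N x (p - Suc m) w" "orth a b m w"
    define H where "H = max_step N x"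
    have H: "H > 0" "H \<le> b - a" using max_step_bounds[OF P] by (auto simp: H_def)
    let ?g = "\<lambda>t. ?d (Suc m) t - deriv_on {a..b} (Suc m) W t"
    note ru = C_on_rep[OF ab u _ bc] and rW = spline_rep[OF P ab W]
    have le: "Suc m \<le> p + 2" using p by simp
    have pu: "pc a b (?d (Suc m))" using ru(2)[OF le] by (auto intro: rep_pc)
    have pW: "pc a b (deriv_on {a..b} (Suc m) W)" using rW(4) by (rule rep_pc)
    have pg: "pc a b ?g" using pu pW by (rule pc_diff)
    have pw: "pc a b w" by (rule pwpoly_pc[OF P w(1)])
    have Jg: "Jn a (Suc m - k) ?g t = ?d k t - deriv_on {a..b} k W t" if "k \<le> Suc m" "t \<in> {a..b}" for k t
      using Jn_diff[OF pu pW that(2), of "Suc m - k"] ru(1)[OF le, of "Suc m - k" t] rW(3)[of "Suc m - k" t] that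
      by (simp del: funpow.simps)
    have elem: "\<exists>E. (\<forall>t\<in>{x (j - 1)<..<x j}.
         (\<forall>k\<le>m. \<bar>?d k t - deriv_on {a..b} k W t\<bar> \<le> K * H ^ (p + 1 - k)) \<and>
         \<bar>?g t - poly E t\<bar> \<le> K * H ^ (p + 1 - m) \<and> \<bar>poly E t\<bar> \<le> K * H ^ (p - m)) \<and>
         (\<forall>s. degree s < p - m \<longrightarrow> integral {x (j - 1)..x j} (poly (E * s)) = 0)"
      if j: "j \<in> {1..N}" for j
    proof -
      define l r where "l = x (j - 1)" and "r = x j"
      have jN: "j \<le> N" "j - 1 \<le> N" using j by auto
      have lr: "l < r" "r - l \<le> H" using partition_less[OF P j] step_le_max_step[OF j, of x] by (auto simp: l_def r_def H_def)
      have sub: "{l..r} \<subseteq> {a..b}"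
        using partition_bounds[OF P jN(1)] partition_bounds[OF P jN(2)] by (auto simp: l_def r_def)
      obtain q :: "real poly" where q: "degree q \<le> p" "\<forall>t\<in>{l..r}. W t = poly q t"
        "\<forall>k\<le>m. poly ((pderiv ^^ k) q) l = ?d k l \<and> poly ((pderiv ^^ k) q) r = ?d k r"
        "\<forall>\<mu>\<in>HJ_nodes p m. poly q ((l + r) / 2 + (r - l) * \<mu> / 2) = u ((l + r) / 2 + (r - l) * \<mu> / 2)"
        using I j unfolding is_HJ_interpolant_def Let_def l_def r_def by blast
      have ie: "(\<forall>k\<le>m. \<forall>t\<in>{l..r}. \<bar>?d k t - poly ((pderiv ^^ k) q) t\<bar> \<le> K * (r - l) ^ (p + 1 - k)) \<and>
        (\<exists>E. (\<forall>t\<in>{l..r}. \<bar>?d (Suc m) t - poly ((pderiv ^^ Suc m) q) t - poly E t\<bar> \<le> K * (r - l) ^ (p + 1 - m)) \<and>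
           (\<forall>t\<in>{l..r}. \<bar>poly E t\<bar> \<le> K * (r - l) ^ (p - m)) \<and>
           (\<forall>s. degree s < p - m \<longrightarrow> integral {l..r} (poly (E * s)) = 0))"
      proof (rule K(2)[of l r ?d q])
        show "(?d i has_real_derivative ?d (Suc i) t) (at t within {l..r})" if "i < p + 2" "t \<in> {l..r}" for i t
          using C_on_DERIV[OF u that(1), of t] that(2) sub by (auto intro: DERIV_subset)
        show "r - l \<le> b - a" using lr(2) H(2) by linarith
        show "\<bar>?d (p + 2) t\<bar> \<le> M" if "t \<in> {l..r}" for t using M(2) that sub by auto
        show "\<bar>?d (p + 1) l\<bar> \<le> M" using M(3)[of l] sub lr(1) by auto
      qed (use lr(1) q in \<open>auto simp: deriv_on_0\<close>)
      then obtain E where E: "\<And>t. t \<in> {l..r} \<Longrightarrow> \<bar>?d (Suc m) t - poly ((pderiv ^^ Suc m) q) t - poly E t\<bar> \<le> K * (r - l) ^ (p + 1 - m)"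
        "\<And>t. t \<in> {l..r} \<Longrightarrow> \<bar>poly E t\<bar> \<le> K * (r - l) ^ (p - m)"
        "\<forall>s. degree s < p - m \<longrightarrow> integral {l..r} (poly (E * s)) = 0" by blast
      have mono: "K * (r - l) ^ i \<le> K * H ^ i" for i
        using lr K(1) by (intro mult_left_mono power_mono) auto
      have Wq: "deriv_on {a..b} i W t = poly ((pderiv ^^ i) q) t" if "t \<in> {l<..<r}" for i t
        using rW(1)[OF j, of q t i] q(2) that by (auto simp: l_def r_def)
      show ?thesis
        unfolding l_def[symmetric] r_def[symmetric]
      proof (intro exI[of _ E] conjI ballI allI impI)
        fix t assume t: "t \<in> {l<..<r}"
        then have t': "t \<in> {l..r}" by simp
        show "\<bar>?d k t - deriv_on {a..b} k W t\<bar> \<le> K * H ^ (p + 1 - k)" if "k \<le> m" for k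
          using ie that t' order_trans[OF _ mono] unfolding Wq[OF t] by blast
        show "\<bar>?g t - poly E t\<bar> \<le> K * H ^ (p + 1 - m)"
          unfolding Wq[OF t] by (rule order_trans[OF E(1)[OF t'] mono])
        show "\<bar>poly E t\<bar> \<le> K * H ^ (p - m)" by (rule order_trans[OF E(2)[OF t'] mono])
      qed (use E(3) in blast)
    qed
    then have "\<forall>j. \<exists>E. j \<in> {1..N} \<longrightarrow> (\<forall>t\<in>{x (j - 1)<..<x j}.
         (\<forall>k\<le>m. \<bar>?d k t - deriv_on {a..b} k W t\<bar> \<le> K * H ^ (p + 1 - k)) \<and>
         \<bar>?g t - poly E t\<bar> \<le> K * H ^ (p + 1 - m) \<and> \<bar>poly E t\<bar> \<le> K * H ^ (p - m)) \<and>
         (\<forall>s. degree s < p - m \<longrightarrow> integral {x (j - 1)..x j} (poly (E * s)) = 0)" by blast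
    from choice[OF this] obtain E where E: "\<And>j. j \<in> {1..N} \<Longrightarrow> (\<forall>t\<in>{x (j - 1)<..<x j}.
         (\<forall>k\<le>m. \<bar>?d k t - deriv_on {a..b} k W t\<bar> \<le> K * H ^ (p + 1 - k)) \<and>
         \<bar>?g t - poly (E j) t\<bar> \<le> K * H ^ (p + 1 - m) \<and> \<bar>poly (E j) t\<bar> \<le> K * H ^ (p - m)) \<and>
         (\<forall>s. degree s < p - m \<longrightarrow> integral {x (j - 1)..x j} (poly (E j * s)) = 0)" by blast
    define Ef where "Ef t = poly (E (elt x t)) t" for t
    define cf where "cf t = c (Suc m) (x (elt x t - 1))" for t
    have Efe: "Ef t = poly (E j) t" "cf t = c (Suc m) (x (j - 1))" if "j \<in> {1..N}" "t \<in> {x (j - 1)<..<x j}" for j t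
      using elt_eq[OF P that] by (auto simp: Ef_def cf_def)
    have pEf: "pc a b Ef"
      by (rule pw_pc[OF P, of "\<lambda>j. poly (E j)"]) (auto simp: Efe intro: continuous_intros)
    have pcf: "pc a b cf"
      by (rule pw_pc[OF P, of "\<lambda>j t. c (Suc m) (x (j - 1))"]) (auto simp: Efe intro: continuous_intros)
    have low_terms: "\<bar>integral {a..b} (\<lambda>t. c k t * Jn a (Suc m - k) ?g t * Jn a (Suc m - k) w t)\<bar>
        \<le> R * (b - a) ^ (Suc m - k) * (H ^ (p + 1 - m) * nrm a b w)" if k: "k \<le> m" for k
    proof -
      have k': "k \<le> Suc m" using k by simp
      have pf: "pc a b (\<lambda>t. c k t * Jn a (Suc m - k) ?g t)" by (intro pc_mult pc_c k' pc_Jn pg)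
      have "nrm a b (\<lambda>t. c k t * Jn a (Suc m - k) ?g t) \<le> nrm a b (\<lambda>t. B * (K * Q) * H ^ (p + 1 - m))"
      proof (rule nrm_le_off_finite[OF pf])
        fix t assume t: "t \<in> {a..b} - x ` {..N}"
        then have t': "t \<in> {a..b}" by simp
        obtain j where j: "j \<in> {1..N}" "t \<in> {x (j - 1)<..<x j}" using partition_element[OF P, of t] t by blast
        have "\<bar>?d k t - deriv_on {a..b} k W t\<bar> \<le> K * H ^ (p + 1 - k)" using E[OF j(1)] j(2) k by blast
        also have "H ^ (p + 1 - k) = H ^ (m - k) * H ^ (p + 1 - m)"
          using k p by (simp flip: power_add)
        also have "K * (H ^ (m - k) * H ^ (p + 1 - m)) \<le> K * (Q * H ^ (p + 1 - m))"
        proof (intro mult_left_mono mult_right_mono)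
          have "H ^ (m - k) \<le> (1 + (b - a)) ^ (m - k)" using H by (intro power_mono) auto
          also have "\<dots> \<le> Q" unfolding Q_def using ab by (intro power_increasing) auto
          finally show "H ^ (m - k) \<le> Q" .
        qed (use H K(1) in auto)
        finally have "\<bar>Jn a (Suc m - k) ?g t\<bar> \<le> K * (Q * H ^ (p + 1 - m))" unfolding Jg[OF k' t'] .
        then have "\<bar>c k t\<bar> * \<bar>Jn a (Suc m - k) ?g t\<bar> \<le> B * (K * (Q * H ^ (p + 1 - m)))"
          using B(2)[OF k' t'] B(1) by (intro mult_mono) auto
        then show "\<bar>c k t * Jn a (Suc m - k) ?g t\<bar> \<le> B * (K * Q) * H ^ (p + 1 - m)"
          by (simp add: abs_mult mult_ac)
      qed auto
      also have "\<dots> = R * H ^ (p + 1 - m)"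
        using B(1) K(1) Q H ab by (subst nrm_const) (auto simp: R_def)
      finally have 1: "nrm a b (\<lambda>t. c k t * Jn a (Suc m - k) ?g t) \<le> R * H ^ (p + 1 - m)" .
      have "\<bar>integral {a..b} (\<lambda>t. (c k t * Jn a (Suc m - k) ?g t) * Jn a (Suc m - k) w t)\<bar>
          \<le> nrm a b (\<lambda>t. c k t * Jn a (Suc m - k) ?g t) * nrm a b (Jn a (Suc m - k) w)"
        by (intro cauchy_schwarz pf pc_Jn pw)
      also have "\<dots> \<le> (R * H ^ (p + 1 - m)) * ((b - a) ^ (Suc m - k) * nrm a b w)"
        using 1 nrm_Jn_le[OF ab pw] R H nrm_nonneg[OF pc_Jn[OF pw]] by (intro mult_mono) auto
      finally show ?thesis by (simp only: mult_ac)
    qed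
    have top: "\<bar>integral {a..b} (\<lambda>t. c (Suc m) t * ?g t * w t)\<bar>
        \<le> (B + L) * K * sqrt (b - a) * (H ^ (p + 1 - m) * nrm a b w)"
    proof -
      define F where "F t = c (Suc m) t * (?g t - Ef t) + (c (Suc m) t - cf t) * Ef t" for t
      have pF: "pc a b F"
        unfolding F_def[abs_def] by (intro pc_add pc_mult pc_diff pc_c order_refl pu pW pEf pcf)
      have z: "integral {a..b} (\<lambda>t. cf t * Ef t * w t) = 0"
      proof (rule integral_pieces_zero[OF P])
        show "pc a b (\<lambda>t. cf t * Ef t * w t)" by (intro pc_mult pcf pEf pw)
        fix j assume j: "j \<in> {1..N}"
        then obtain s :: "real poly" where s: "degree s \<le> p - Suc m" "\<forall>t\<in>{x (j - 1)<..<x j}. w t = poly s t"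
          using w(1) unfolding pwpoly_def by blast
        have "integral {x (j - 1)..x j} (\<lambda>t. cf t * Ef t * w t)
            = integral {x (j - 1)..x j} (poly (smult (c (Suc m) (x (j - 1))) (E j * s)))"
          by (rule integral_spike[of "{x (j - 1), x j}"])
             (use s(2) in \<open>auto simp: Efe[OF j] mult.assoc\<close>)
        also have "\<dots> = 0"
        proof -
          have "degree s < p - m" using s(1) p by simp
          then have "integral {x (j - 1)..x j} (poly (E j * s)) = 0" using E[OF j] by blast
          then show ?thesis by (simp only: integral_poly_smult mult_zero_right)
        qed
        finally show "integral {x (j - 1)..x j} (\<lambda>t. cf t * Ef t * w t) = 0" .
      qed
      have "integral {a..b} (\<lambda>t. c (Suc m) t * ?g t * w t)
          = integral {a..b} (\<lambda>t. F t * w t + cf t * Ef t * w t)"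
        by (rule integral_cong) (simp add: F_def algebra_simps)
      also have "\<dots> = integral {a..b} (\<lambda>t. F t * w t) + integral {a..b} (\<lambda>t. cf t * Ef t * w t)"
        by (intro integral_add pc_integrable pc_mult pF pcf pEf pw)
      finally have "\<bar>integral {a..b} (\<lambda>t. c (Suc m) t * ?g t * w t)\<bar> \<le> nrm a b F * nrm a b w"
        using z cauchy_schwarz[OF pF pw] by simp
      also have "nrm a b F \<le> nrm a b (\<lambda>t. (B + L) * K * H ^ (p + 1 - m))"
      proof (rule nrm_le_off_finite[OF pF])
        fix t assume t: "t \<in> {a..b} - x ` {..N}"
        then have t': "t \<in> {a..b}" by simp
        obtain j where j: "j \<in> {1..N}" "t \<in> {x (j - 1)<..<x j}" using partition_element[OF P, of t] t by blast
        note b = partition_element_bounds[OF P j, folded H_def]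
        have "\<bar>?g t - Ef t\<bar> \<le> K * H ^ (p + 1 - m)" "\<bar>Ef t\<bar> \<le> K * H ^ (p - m)"
          unfolding Efe[OF j] using E[OF j(1)] j(2) by blast+
        moreover have "\<bar>c (Suc m) t - cf t\<bar> \<le> L * H"
          unfolding Efe[OF j] using L(2)[OF b(1,2)] mult_left_mono[OF b(3) L(1)] by linarith
        ultimately have "\<bar>c (Suc m) t\<bar> * \<bar>?g t - Ef t\<bar> \<le> B * (K * H ^ (p + 1 - m))"
          "\<bar>c (Suc m) t - cf t\<bar> * \<bar>Ef t\<bar> \<le> (L * H) * (K * H ^ (p - m))"
          using B(2)[OF order_refl t'] B(1) L(1) H by (auto intro!: mult_mono)
        then have "\<bar>F t\<bar> \<le> B * (K * H ^ (p + 1 - m)) + (L * H) * (K * H ^ (p - m))"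
          unfolding F_def abs_mult[symmetric] by linarith
        also have "(L * H) * (K * H ^ (p - m)) = L * (K * H ^ (p + 1 - m))"
          using p by (simp add: Suc_diff_le)
        finally show "\<bar>F t\<bar> \<le> (B + L) * K * H ^ (p + 1 - m)" by (simp add: algebra_simps)
      qed auto
      also have "nrm a b (\<lambda>t. (B + L) * K * H ^ (p + 1 - m)) = (B + L) * K * H ^ (p + 1 - m) * sqrt (b - a)"
        using B(1) L(1) K(1) H ab by (intro nrm_const) auto
      finally show ?thesis using pw by (simp add: mult_right_mono mult_ac)
    qed
    let ?S = "\<lambda>k. integral {a..b} (\<lambda>t. c k t * Jn a (Suc m - k) ?g t * Jn a (Suc m - k) w t)"
    let ?T = "integral {a..b} (\<lambda>t. c (Suc m) t * ?g t * w t)"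
    have "integral {a..b} (\<lambda>t. red ?g t * w t)
        = bilin_form a b m c (Jn a (Suc m) ?g) (Jn a (Suc m) w)"
      by (rule form_eq[OF rep_Jn[OF pg] rep_Jn[OF pw] w(2), symmetric])
    also have "\<dots> = (\<Sum>k\<le>m. ?S k) + ?T"
      using rep_bilin[OF ab rep_Jn[OF pg] rep_Jn[OF pw] c_cont] by simp
    finally have eq: "integral {a..b} (\<lambda>t. red ?g t * w t) = (\<Sum>k\<le>m. ?S k) + ?T" .
    have "\<bar>\<Sum>k\<le>m. ?S k\<bar> \<le> (\<Sum>k\<le>m. \<bar>?S k\<bar>)" by (rule sum_abs)
    also have "\<dots> \<le> (\<Sum>k\<le>m. R * (b - a) ^ (Suc m - k) * (H ^ (p + 1 - m) * nrm a b w))"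
      by (rule sum_mono) (use low_terms in blast)
    finally have "\<bar>integral {a..b} (\<lambda>t. red ?g t * w t)\<bar>
        \<le> (\<Sum>k\<le>m. R * (b - a) ^ (Suc m - k) * (H ^ (p + 1 - m) * nrm a b w))
          + (B + L) * K * sqrt (b - a) * (H ^ (p + 1 - m) * nrm a b w)"
      using top unfolding eq by linarith
    also have "\<dots> = C * H ^ (p + 1 - m) * nrm a b w"
      by (simp only: C_def distrib_right sum_distrib_right mult.assoc)
    finally show "\<bar>integral {a..b} (\<lambda>t. red ?g t * w t)\<bar> \<le> C * max_step N x ^ (p + 1 - m) * nrm a b w"
      by (simp add: H_def)
  qed
qed

text \<open>
  The equation holds in a strong form by the lemma of du Bois-Reymond, so it can be tested with
  splines without showing that these belong to \<open>H0_space\<close>.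
\<close>

lemma strong_form:
  assumes u: "rep a b (Suc m) u gu" "continuous_on {a..b} gu" and f: "continuous_on {a..b} f"
    and sol: "\<And>v. v \<in> H0_space a b (Suc m) \<Longrightarrow> L2_inner a b f v = bilin_form a b m c u v"
    and h: "rep a b (Suc m) v h" "orth a b m h"
  shows "L2_inner a b f v = bilin_form a b m c u v"
proof -
  have pf: "pc a b f" using f by (rule pc_continuous)
  \<comment> \<open>The load is moved onto the highest derivative of the test function by
    \<open>m + 1\<close> integrations by parts, so the residual of the weak equation is the pairing
    of \<open>Q\<close> with it. The equation thus says that \<open>Q\<close> is a polynomial of
    degree at most \<open>m\<close>.\<close>
  define Q where "Q t = red gu t - (-1) ^ Suc m * Jn a (Suc m) f t" for t
  have pgu: "pc a b gu" using u(1) by (rule rep_pc)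
  have Qc: "continuous_on {a..b} Q"
    unfolding Q_def[abs_def] red_def[abs_def]
    by (intro continuous_intros c_cont order_refl u(2) low_cont pgu Jn_cont[OF pf]) simp
  have diff: "bilin_form a b m c u v - L2_inner a b f v = integral {a..b} (\<lambda>t. Q t * h t)"
    if r: "rep a b (Suc m) v h" and o: "orth a b m h" for v h
  proof -
    have ph: "pc a b h" using r by (rule rep_pc)
    have v: "v t = Jn a (Suc m) h t" if "t \<in> {a..b}" for t using r that unfolding rep_def by blast
    have ends: "Jn a i h b = 0" if "1 \<le> i" "i \<le> Suc m" for i
      using orth_iff_end_data[OF _ ph, of m] o that ab by auto
    have "L2_inner a b f v = integral {a..b} (\<lambda>t. f t * v t)"
      unfolding L2_inner_def using v by (intro pc_lint pc_mult pf) (rule pc_cong[OF pc_Jn[OF ph]])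
    also have "\<dots> = integral {a..b} (\<lambda>t. f t * Jn a (Suc m) h t)" using v by (intro integral_cong) simp
    also have "\<dots> = (-1) ^ Suc m * integral {a..b} (\<lambda>t. Jn a (Suc m) f t * h t)"
      using ab ends by (intro parts_Jn pf ph) auto
    finally have "bilin_form a b m c u v - L2_inner a b f v
        = integral {a..b} (\<lambda>t. red gu t * h t) - integral {a..b} (\<lambda>t. (-1) ^ Suc m * (Jn a (Suc m) f t * h t))"
      by (simp only: form_eq[OF u(1) r o] integral_mult_right)
    also have "\<dots> = integral {a..b} (\<lambda>t. red gu t * h t - (-1) ^ Suc m * (Jn a (Suc m) f t * h t))"
      by (intro integral_diff[symmetric] pc_integrable pc_mult pc_const pc_red pgu ph pc_Jn pf)
    finally show ?thesis by (simp only: Q_def left_diff_distrib mult.assoc)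
  qed
  have "integral {a..b} (\<lambda>t. Q t * (deriv ^^ Suc m) \<phi> t) = 0" if \<phi>: "\<phi> \<in> test_fun a b" for \<phi>
  proof -
    let ?h = "(deriv ^^ Suc m) \<phi>"
    have ph: "pc a b ?h" using test_fun_higher_deriv[OF \<phi>] by (rule pc_test_fun)
    have "Jn a k ?h b = 0" if "1 \<le> k" "k \<le> Suc m" for k
      using Jn_deriv_test_fun[OF \<phi>, of b k "Suc m - k"] that ab
        test_fun_zero[OF test_fun_higher_deriv[OF \<phi>], of b] by (auto simp del: funpow.simps)
    then have "orth a b m ?h" using orth_iff_end_data[OF _ ph, of m] ab by simp
    from diff[OF rep_test_fun[OF \<phi>] this] show ?thesis
      using sol[OF test_fun_H0_space[OF ab \<phi>]] by simp
  qed
  from du_Bois_Reymond[OF ab Qc this] obtain \<pi> where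
    \<pi>: "degree \<pi> \<le> m" "\<And>t. t \<in> {a..b} \<Longrightarrow> Q t = poly \<pi> t" by blast
  have "integral {a..b} (\<lambda>t. Q t * h t) = integral {a..b} (\<lambda>t. poly \<pi> t * h t)"
    using \<pi>(2) by (intro integral_cong) simp
  also have "\<dots> = 0" using h(2) \<pi>(1) unfolding orth_def by blast
  finally show ?thesis using diff[OF h] by simp
qed

end

section \<open>The main result\<close>

theorem corollary4p4p1:
  fixes m p :: nat and a b :: real
    and f u :: "real \<Rightarrow> real" and c :: "nat \<Rightarrow> real \<Rightarrow> real"
    and N :: "'i \<Rightarrow> nat" and x :: "'i \<Rightarrow> nat \<Rightarrow> real" and \<beta>\<^sub>0 :: real
    and U W :: "'i \<Rightarrow> real \<Rightarrow> real" and C :: real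
  assumes "p \<ge> 2 * m + 1" and "a < b"
    and f: "f \<in> C_on p {a..b}"
    and c: "\<And>k. k \<le> m + 1 \<Longrightarrow> c k \<in> C_on p {a..b}"
    and c_pos: "\<And>t. t \<in> {a..b} \<Longrightarrow> c (m + 1) t > 0"
    and u: "u \<in> C_on (p + 2) {a..b}"
    and u_bc: "\<And>k. k \<le> m \<Longrightarrow> deriv_on {a..b} k u a = 0 \<and> deriv_on {a..b} k u b = 0"
    and u_sol: "\<And>v. v \<in> H0_space a b (m + 1) \<Longrightarrow> L2_inner a b f v = bilin_form a b m c u v"
    and u_unique: "\<And>w. w \<in> H0_space a b (m + 1) \<Longrightarrow>
       (\<forall>v\<in>H0_space a b (m + 1). L2_inner a b f v = bilin_form a b m c w v) \<Longrightarrow>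
       (AE t in lebesgue_on {a..b}. w t = u t)"
    and part: "\<And>i. is_partition a b (N i) (x i)"
    and "\<beta>\<^sub>0 > 0"
    and quasi_uniform: "\<And>i. min_step (N i) (x i) \<ge> \<beta>\<^sub>0 * max_step (N i) (x i)"
    and U: "\<And>i. U i \<in> spline_space0 p m a b (N i) (x i)"
    and U_sol: "\<And>i V. V \<in> spline_space0 p m a b (N i) (x i) \<Longrightarrow>
       L2_inner a b f V = bilin_form a b m c (U i) V"
    and W: "\<And>i. W i \<in> spline_space0 p m a b (N i) (x i)"
    and W_interp: "\<And>i. is_HJ_interpolant p m a b (N i) (x i) u (W i)"
    and "C > 0"
    and lower: "\<And>i. H_norm a b (m + 1) (\<lambda>t. u t - W i t) \<ge> C * max_step (N i) (x i) ^ (p - m)"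
  shows "(\<lambda>i. H_norm a b (m + 1) (\<lambda>t. u t - U i t) / H_norm a b (m + 1) (\<lambda>t. u t - W i t) - 1)
           \<in> O[filtercomap (\<lambda>i. max_step (N i) (x i)) (at_right 0)](\<lambda>i. max_step (N i) (x i))"
proof -
  let ?d = "\<lambda>v. deriv_on {a..b} (Suc m) v"
  have c_cont: "continuous_on {a..b} (c k)" if "k \<le> Suc m" for k
    using c[of k] that by (intro C_on_continuous) auto
  interpret elliptic_form a b m c
    by unfold_locales (use assms(2) c_cont c_pos in auto)
  have p1: "1 \<le> p" and le: "Suc m \<le> p + 2" and m_le: "m \<le> p - Suc m" using assms(1) by auto
  obtain L where L: "L \<ge> 0"
    "\<And>s t. s \<in> {a..b} \<Longrightarrow> t \<in> {a..b} \<Longrightarrow> \<bar>c (Suc m) t - c (Suc m) s\<bar> \<le> L * \<bar>t - s\<bar>"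
    using C_on_lipschitz[OF _ p1, of "c (Suc m)"] c[of "Suc m"] by auto
  have ru: "rep a b (Suc m) u (?d u)" "orth a b m (?d u)"
    by (rule C_on_rep[OF ab u le], erule u_bc)+
  have gu: "continuous_on {a..b} (?d u)" using u le by (rule C_on_cont)
  have sol: "L2_inner a b f v = bilin_form a b m c u v" if "v \<in> H0_space a b (Suc m)" for v
    using u_sol[of v] that by simp
  have unique: "AE t in lebesgue_on {a..b}. w t = u t" if "w \<in> H0_space a b (Suc m)"
    "\<forall>v\<in>H0_space a b (Suc m). L2_inner a b f v = bilin_form a b m c w v" for w
    using u_unique[of w] that by simp
  have uniq: "\<forall>t\<in>{a..b}. g t = 0" 
    if g: "continuous_on {a..b} g" "orth a b m g" "degree \<pi> \<le> m"
    "\<forall>t\<in>{a..b}. red g t = poly \<pi> t" for g \<pi>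
  proof
    show "g t = 0" if t: "t \<in> {a..b}" for t
      by (rule red_unique[OF ru(1) gu ru(2) _ _ g(1,2,3) _ t]) (use sol unique g(4) in blast)+
  qed
  obtain Cs where Cs: "Cs \<ge> 0" "\<And>g \<pi>. pc a b g \<Longrightarrow> orth a b m g \<Longrightarrow> degree \<pi> \<le> m \<Longrightarrow>
      nrm a b g \<le> Cs * nrm a b (\<lambda>t. red g t - poly \<pi> t)"
    by (rule stability, erule (3) uniq, blast)
  obtain Cd where Cd: "Cd \<ge> 0" "\<And>N x d g \<epsilon>. is_partition a b N x \<Longrightarrow> pwpoly N x d g \<Longrightarrow> m \<le> d \<Longrightarrow>
      (\<And>w. pwpoly N x d w \<Longrightarrow> orth a b m w \<Longrightarrow> \<bar>integral {a..b} (\<lambda>t. red g t * w t)\<bar> \<le> \<epsilon> * nrm a b w) \<Longrightarrow>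
      \<epsilon> \<ge> 0 \<Longrightarrow>
      \<exists>\<pi>. degree \<pi> \<le> m \<and> nrm a b (\<lambda>t. red g t - poly \<pi> t) \<le> \<epsilon> + Cd * max_step N x * nrm a b g"
    using discrete_stability[OF L] by blast
  obtain Cc where Cc: "Cc \<ge> 0" "\<And>N x W w. is_partition a b N x \<Longrightarrow> W \<in> spline_space0 p m a b N x \<Longrightarrow>
      is_HJ_interpolant p m a b N x u W \<Longrightarrow> pwpoly N x (p - Suc m) w \<Longrightarrow> orth a b m w \<Longrightarrow>
      \<bar>integral {a..b} (\<lambda>t. red (\<lambda>t. ?d u t - ?d W t) t * w t)\<bar> \<le> Cc * max_step N x ^ (p + 1 - m) * nrm a b w"
    using consistency[OF assms(1) L u u_bc] by blast
  define S where "S = sobolev_const a b (Suc m)"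
  have S: "S \<ge> 0" by (simp add: S_def sobolev_const_nonneg)
  define H where "H i = max_step (N i) (x i)" for i
  have H: "H i > 0" for i using max_step_bounds[OF part] by (simp add: H_def)
  \<comment> \<open>Below this step size the stability term containing \<open>g\<close> itself has a
    factor at most one half and can be absorbed; the \<open>1\<close> keeps the denominator
    positive.\<close>
  define h1 where "h1 = 1 / (2 * (Cs * Cd + 1))"
  have h1: "h1 > 0" using Cs Cd by (simp add: h1_def add_nonneg_pos)
  \<comment> \<open>\<open>S\<close> passes from the highest derivative to the Sobolev norm, 2 comes
    from the absorption, \<open>Cs\<close> and \<open>Cc\<close> from stability and consistency, and
    \<open>C\<close> from the lower bound.\<close>
  define Q where "Q = S * (2 * (Cs * Cc)) / C"
  have main: "\<bar>H_norm a b (m + 1) (\<lambda>t. u t - U i t) / H_norm a b (m + 1) (\<lambda>t. u t - W i t) - 1\<bar> \<le> Q * H i"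
    if small: "H i < h1" for i
  proof -
    let ?gU = "?d (U i)" and ?gW = "?d (W i)"
    note rU = spline_rep[OF part[of i] ab U[of i]] and rW = spline_rep[OF part[of i] ab W[of i]]
    define g where "g t = ?gU t - ?gW t" for t
    define \<epsilon> where "\<epsilon> = Cc * H i ^ (p + 1 - m)"
    have \<epsilon>: "\<epsilon> \<ge> 0" using Cc H[of i] by (simp add: \<epsilon>_def)
    have pu: "pc a b (?d u)" and pU: "pc a b ?gU" and pW: "pc a b ?gW"
      using ru(1) rU(4) rW(4) by (auto intro: rep_pc)
    have pg: "pc a b g" unfolding g_def[abs_def] using pU pW by (rule pc_diff)
    have pwg: "pwpoly (N i) (x i) (p - Suc m) g"
      unfolding g_def[abs_def] by (rule pwpoly_diff[OF rU(2) rW(2)])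
    have og: "orth a b m g"
      unfolding orth_def
    proof (intro allI impI)
      fix q :: "real poly" assume "degree q \<le> m"
      then have "integral {a..b} (\<lambda>t. poly q t * ?gU t) = 0" "integral {a..b} (\<lambda>t. poly q t * ?gW t) = 0"
        using rU(5) rW(5) unfolding orth_def by blast+
      then show "integral {a..b} (\<lambda>t. poly q t * g t) = 0"
        using pU pW by (simp add: g_def right_diff_distrib integral_diff pc_integrable pc_mult)
    qed
    have test: "\<bar>integral {a..b} (\<lambda>t. red g t * w t)\<bar> \<le> \<epsilon> * nrm a b w"
      if w: "pwpoly (N i) (x i) (p - Suc m) w" "orth a b m w" for w
    proof -
      let ?V = "Jn a (Suc m) w"
      have pw: "pc a b w" by (rule pwpoly_pc[OF part w(1)])
      note rV = rep_Jn[OF pw, of "Suc m"]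
      \<comment> \<open>Galerkin orthogonality: both \<open>u\<close> and \<open>U i\<close> satisfy
        the equation tested with this spline, so the residual of \<open>U i - W i\<close> equals
        that of \<open>u - W i\<close>, which consistency bounds.\<close>
      have "?V \<in> spline_space0 p m a b (N i) (x i)"
        using spline_of_pwpoly[OF part ab w] assms(1) by simp
      then have "bilin_form a b m c (U i) ?V = bilin_form a b m c u ?V"
        using U_sol[of ?V i] strong_form[OF ru(1) gu C_on_continuous[OF f] sol rV w(2)] by simp
      then have "integral {a..b} (\<lambda>t. red ?gU t * w t) = integral {a..b} (\<lambda>t. red (?d u) t * w t)"
        using form_eq[OF rU(4) rV w(2)] form_eq[OF ru(1) rV w(2)] by simp
      moreover have diff: "integral {a..b} (\<lambda>t. red (\<lambda>s. y s - z s) t * w t)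
          = integral {a..b} (\<lambda>t. red y t * w t) - integral {a..b} (\<lambda>t. red z t * w t)"
        if "pc a b y" "pc a b z" for y z
      proof -
        have "integral {a..b} (\<lambda>t. red (\<lambda>s. y s - z s) t * w t)
            = integral {a..b} (\<lambda>t. red y t * w t - red z t * w t)"
          using that by (intro integral_cong) (simp add: red_diff left_diff_distrib)
        also have "\<dots> = integral {a..b} (\<lambda>t. red y t * w t) - integral {a..b} (\<lambda>t. red z t * w t)"
          using that by (intro integral_diff pc_integrable pc_mult pc_red pw)
        finally show ?thesis .
      qed
      ultimately have "integral {a..b} (\<lambda>t. red g t * w t)
          = integral {a..b} (\<lambda>t. red (\<lambda>t. ?d u t - ?gW t) t * w t)"
        unfolding g_def[abs_def] using diff[OF pU pW] diff[OF pu pW] by simp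
      then show ?thesis using Cc(2)[OF part W W_interp w] by (simp add: \<epsilon>_def H_def)
    qed
    obtain \<pi> where \<pi>: "degree \<pi> \<le> m"
      "nrm a b (\<lambda>t. red g t - poly \<pi> t) \<le> \<epsilon> + Cd * H i * nrm a b g"
      using Cd(2)[OF part pwg m_le test \<epsilon>] unfolding H_def by blast
    \<comment> \<open>Discrete stability yields a polynomial close to \<open>red g\<close>, and
      continuous stability turns this closeness into a bound for \<open>g\<close>; the term with
      \<open>g\<close> on the right is absorbed next.\<close>
    have "nrm a b g \<le> Cs * (\<epsilon> + Cd * H i * nrm a b g)"
      using Cs(2)[OF pg og \<pi>(1)] mult_left_mono[OF \<pi>(2) Cs(1)] by linarith
    moreover have "Cs * (Cd * H i * nrm a b g) \<le> 1 / 2 * nrm a b g"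
    proof -
      have "(Cs * Cd) * H i \<le> (Cs * Cd + 1) * h1"
        using Cs(1) Cd(1) small H[of i] by (intro mult_mono) auto
      also have "\<dots> = 1 / 2" using Cs(1) Cd(1) by (simp add: h1_def add_nonneg_eq_0_iff)
      finally have "(Cs * Cd * H i) * nrm a b g \<le> 1 / 2 * nrm a b g"
        using nrm_nonneg[OF pg] by (rule mult_right_mono)
      then show ?thesis by (simp only: mult.assoc)
    qed
    ultimately have ng: "nrm a b g \<le> 2 * (Cs * \<epsilon>)" by (simp add: distrib_left)
    let ?A = "H_norm a b (m + 1) (\<lambda>t. u t - U i t)" and ?B = "H_norm a b (m + 1) (\<lambda>t. u t - W i t)"
    \<comment> \<open>The unknown \<open>u\<close> cancels in the difference of the two errors,
      leaving \<open>U i - W i\<close> up to sign.\<close>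
    have "\<bar>?A - ?B\<bar> \<le> S * nrm a b (\<lambda>t. (?d u t - ?gU t) - (?d u t - ?gW t))"
      using H_norm_triangle[OF ab rep_diff[OF ru(1) rU(4)] rep_diff[OF ru(1) rW(4)]] by (simp add: S_def)
    also have "nrm a b (\<lambda>t. (?d u t - ?gU t) - (?d u t - ?gW t)) = nrm a b g"
      using nrm_cmult[of a b "-1" g] by (simp add: g_def)
    also have "S * nrm a b g \<le> S * (2 * (Cs * \<epsilon>))" using ng S by (rule mult_left_mono)
    also have "\<dots> = Q * H i * (C * H i ^ (p - m))"
      using assms(1) \<open>C > 0\<close> by (simp add: Q_def \<epsilon>_def Suc_diff_le)
    also have "\<dots> \<le> Q * H i * ?B"
      using lower[of i] S Cs(1) Cc(1) \<open>C > 0\<close> H[of i] by (intro mult_left_mono) (auto simp: H_def Q_def)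
    finally have AB: "\<bar>?A - ?B\<bar> \<le> Q * H i * ?B" .
    have "0 < C * H i ^ (p - m)" using \<open>C > 0\<close> H[of i] by simp
    then have B: "?B > 0" using lower[of i] by (simp add: H_def)
    then have "?A / ?B - 1 = (?A - ?B) / ?B" by (simp add: diff_divide_distrib)
    then have "\<bar>?A / ?B - 1\<bar> = \<bar>?A - ?B\<bar> / ?B" using B by (simp add: abs_divide)
    also have "\<dots> \<le> Q * H i" using AB B by (simp add: pos_divide_le_eq)
    finally show ?thesis .
  qed
  show ?thesis
  proof (rule bigoI[of _ Q])
    have "\<forall>\<^sub>F h in at_right 0. h < h1" using h1 by (auto simp: eventually_at_right_field)
    then have "\<forall>\<^sub>F i in filtercomap (\<lambda>i. max_step (N i) (x i)) (at_right 0). H i < h1"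
      unfolding H_def by (rule eventually_filtercomapI)
    then show "\<forall>\<^sub>F i in filtercomap (\<lambda>i. max_step (N i) (x i)) (at_right 0).
        norm (H_norm a b (m + 1) (\<lambda>t. u t - U i t) / H_norm a b (m + 1) (\<lambda>t. u t - W i t) - 1)
          \<le> Q * norm (max_step (N i) (x i))"
    proof eventually_elim
      case (elim i)
      then show ?case using main[OF elim] H[of i] by (simp add: H_def)
    qed
  qed
qed

end
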